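(* Let $b$ be in the closed unit ball of $H^\infty(\mathbb{D})$ and let $I$ be an open arc of $\mathbb{T}$. Then the following are equivalent: (i) $b$ has an analytic continuation across $I$ and $|b|=1$ on $I$; (ii) $I$ is contained in the resolvent set of $X^*$; (iii) every function $f$ in $\mathcal{H}(b)$ has an analytic continuation across $I$; (iv) every function $f$ in $\mathcal{H}(b)$ has a continuous extension to $\mathbb{D}\cup I$; (v) $b$ has a continuous extension to $\mathbb{D}\cup I$ and $|b|=1$ on $I$.
   Context: $\mathbb{D}=\{z\in\mathbb{C}:|z|<1\}$, $\mathbb{T}=\partial\mathbb{D}$, and $H^p(\mathbb{D})$ is the classical Hardy space, also viewed as a closed subspace of $L^p(\mathbb{T})$ (normalized arc length measure) via boundary values; $H^2=H^2(\mathbb{D})$. De Branges--Rovnyak space: for $\varphi\in L^\infty(\mathbb{T})$, the Toeplitz operator on $H^2$ is $T_\varphi f=P_+(\varphi f)$, where $P_+$ is the orthogonal projection of $L^2(\mathbb{T})$ onto $H^2$. For $b$ in the closed unit ball of $H^\infty(\mathbb{D})$, $\mathcal{H}(b):=(Id-T_bT_{\overline{b}})^{1/2}H^2$, which is a Hilbert space with the inner product $$\langle(Id-T_bT_{\overline b})^{1/2}f,(Id-T_bT_{\overline b})^{1/2}g\rangle_b=\langle f,g\rangle_2\qquad\text{for } f,g\perp\ker(Id-T_bT_{\overline b})^{1/2}.$$ Let $S^*$ be the backward shift on $H^2$, $S^*f(z)=(f(z)-f(0))/z$. The space $\mathcal{H}(b)$ is invariant under $S^*$, and $X:=S^*|_{\mathcal{H}(b)}$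 is a contraction on $\mathcal{H}(b)$; $X^*$ denotes its adjoint with respect to $\langle\cdot,\cdot\rangle_b$, and its resolvent set is the set of $\lambda\in\mathbb{C}$ such that $\lambda Id-X^*$ is boundedly invertible on $\mathcal{H}(b)$. *)

theory Defs
  imports "HOL-Complex_Analysis.Complex_Analysis"
begin

section \<open>Bounded operators on a space of functions with a complex inner product\<close>

text \<open>
  A Hilbert space of functions is given by its carrier \<open>V\<close> (closed under pointwise addition and
  scalar multiplication) and its inner product \<open>ip\<close>, linear in the first argument. Operators that
  are introduced by definite description are set to \<open>0\<close> off \<open>V\<close>, so that they are determined by
  their action on \<open>V\<close>.
\<close>

type_synonym cfun = "complex \<Rightarrow> complex"

definition hnorm :: "(cfun \<Rightarrow> cfun \<Rightarrow> complex) \<Rightarrow> cfun \<Rightarrow> real" where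
  "hnorm ip f = sqrt (Re (ip f f))"

definition bounded_op :: "cfun set \<Rightarrow> (cfun \<Rightarrow> cfun \<Rightarrow> complex) \<Rightarrow> (cfun \<Rightarrow> cfun) \<Rightarrow> bool" where
  "bounded_op V ip A \<longleftrightarrow>
     (\<forall>f\<in>V. A f \<in> V) \<and>
     (\<forall>f\<in>V. \<forall>g\<in>V. A (\<lambda>z. f z + g z) = (\<lambda>z. A f z + A g z)) \<and>
     (\<forall>c. \<forall>f\<in>V. A (\<lambda>z. c * f z) = (\<lambda>z. c * A f z)) \<and>
     (\<exists>C. \<forall>f\<in>V. hnorm ip (A f) \<le> C * hnorm ip f)"

definition positive_op :: "cfun set \<Rightarrow> (cfun \<Rightarrow> cfun \<Rightarrow> complex) \<Rightarrow> (cfun \<Rightarrow> cfun) \<Rightarrow> bool" where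
  "positive_op V ip A \<longleftrightarrow>
     bounded_op V ip A \<and> (\<forall>f\<in>V. Im (ip (A f) f) = 0 \<and> Re (ip (A f) f) \<ge> 0)"

definition op_sqrt :: "cfun set \<Rightarrow> (cfun \<Rightarrow> cfun \<Rightarrow> complex) \<Rightarrow> (cfun \<Rightarrow> cfun) \<Rightarrow> cfun \<Rightarrow> cfun" where
  "op_sqrt V ip A = (THE R. positive_op V ip R \<and> (\<forall>f\<in>V. R (R f) = A f) \<and>
                            (\<forall>f. f \<notin> V \<longrightarrow> R f = (\<lambda>z. 0)))"

definition op_adjoint :: "cfun set \<Rightarrow> (cfun \<Rightarrow> cfun \<Rightarrow> complex) \<Rightarrow> (cfun \<Rightarrow> cfun) \<Rightarrow> cfun \<Rightarrow> cfun" where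
  "op_adjoint V ip A = (THE B. (\<forall>f\<in>V. B f \<in> V) \<and>
                               (\<forall>f\<in>V. \<forall>g\<in>V. ip (A f) g = ip f (B g)) \<and>
                               (\<forall>f. f \<notin> V \<longrightarrow> B f = (\<lambda>z. 0)))"

definition resolvent_set :: "cfun set \<Rightarrow> (cfun \<Rightarrow> cfun \<Rightarrow> complex) \<Rightarrow> (cfun \<Rightarrow> cfun) \<Rightarrow> complex set" where
  "resolvent_set V ip A =
     {\<mu>. \<exists>B. bounded_op V ip B \<and>
             (\<forall>f\<in>V. B (\<lambda>z. \<mu> * f z - A f z) = f) \<and>
             (\<forall>f\<in>V. (\<lambda>z. \<mu> * B f z - A (B f) z) = f)}"


section \<open>The Hardy space and Toeplitz operators\<close>

text \<open>Normalized arc length measure on the unit circle, as a Borel measure on the plane.\<close>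

definition arc_measure :: "complex measure" where
  "arc_measure = distr (uniform_measure lborel {0..2 * pi}) borel cis"

definition L2_inner :: "cfun \<Rightarrow> cfun \<Rightarrow> complex" where
  "L2_inner g h = (LINT \<zeta>|arc_measure. g \<zeta> * cnj (h \<zeta>))"

text \<open>
  A function on the disc is represented by its extension by \<open>0\<close> to the whole plane, so that
  equality in \<open>H2\<close> is equality on the disc. In particular the values of an element of \<open>H2\<close> on
  the unit circle are not its boundary values; those are the radial limits \<open>bdry f\<close>, which
  exist almost everywhere. Setting \<open>bdry f\<close> to \<open>0\<close> off the circle keeps it Borel measurable on the
  plane whatever the values of \<open>f\<close> off the disc.
\<close>

definition H2 :: "cfun set" where
  "H2 = {f. f holomorphic_on ball 0 1 \<and> (\<forall>z. z \<notin> ball 0 1 \<longrightarrow> f z = 0) \<and>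
            (\<exists>C. \<forall>r::real. 0 \<le> r \<and> r < 1 \<longrightarrow>
                   (LINT \<zeta>|arc_measure. (cmod (f (of_real r * \<zeta>)))\<^sup>2) \<le> C)}"

definition bdry :: "cfun \<Rightarrow> cfun" where
  "bdry f \<zeta> = (if cmod \<zeta> = 1 then Lim (at_left (1::real)) (\<lambda>r. f (of_real r * \<zeta>)) else 0)"

definition H2_inner :: "cfun \<Rightarrow> cfun \<Rightarrow> complex" where
  "H2_inner f g = L2_inner (bdry f) (bdry g)"

text \<open>The orthogonal projection of \<open>L\<^sup>2\<close> of the circle onto the boundary functions of \<open>H2\<close>.\<close>

definition P_plus :: "cfun \<Rightarrow> cfun" where
  "P_plus g = (THE h. h \<in> H2 \<and> (\<forall>k\<in>H2. L2_inner (\<lambda>\<zeta>. g \<zeta> - bdry h \<zeta>) (bdry k) = 0))"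

definition toeplitz :: "cfun \<Rightarrow> cfun \<Rightarrow> cfun" where
  "toeplitz \<phi> f = P_plus (\<lambda>\<zeta>. \<phi> \<zeta> * bdry f \<zeta>)"

definition backward_shift :: "cfun \<Rightarrow> cfun" where
  "backward_shift f = (\<lambda>z. if z \<in> ball 0 1
                           then (if z = 0 then deriv f 0 else (f z - f 0) / z) else 0)"


section \<open>De Branges--Rovnyak spaces\<close>

definition defect_sqrt :: "cfun \<Rightarrow> cfun \<Rightarrow> cfun" where
  "defect_sqrt b = op_sqrt H2 H2_inner
     (\<lambda>f z. f z - toeplitz (bdry b) (toeplitz (\<lambda>\<zeta>. cnj (bdry b \<zeta>)) f) z)"

definition Hb :: "cfun \<Rightarrow> cfun set" where
  "Hb b = defect_sqrt b ` H2"

text \<open>The preimage of \<open>u\<close> under \<open>defect_sqrt b\<close> that is orthogonal to the kernel.\<close>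

definition Hb_lift :: "cfun \<Rightarrow> cfun \<Rightarrow> cfun" where
  "Hb_lift b u = (THE f. f \<in> H2 \<and> defect_sqrt b f = u \<and>
                         (\<forall>k\<in>H2. defect_sqrt b k = (\<lambda>z. 0) \<longrightarrow> H2_inner f k = 0))"

definition Hb_inner :: "cfun \<Rightarrow> cfun \<Rightarrow> cfun \<Rightarrow> complex" where
  "Hb_inner b u v = H2_inner (Hb_lift b u) (Hb_lift b v)"

definition X_adj :: "cfun \<Rightarrow> cfun \<Rightarrow> cfun" where
  "X_adj b = op_adjoint (Hb b) (Hb_inner b) backward_shift"


section \<open>Extensions across an arc\<close>

text \<open>The end points may be more than \<open>2 * pi\<close> apart, so the whole circle is admitted as an arc.\<close>

definition open_arc :: "complex set \<Rightarrow> bool" where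
  "open_arc I \<longleftrightarrow> (\<exists>\<alpha> \<beta>. \<alpha> < \<beta> \<and> I = cis ` {\<alpha><..<\<beta>})"

definition analytic_continuation_across :: "cfun \<Rightarrow> complex set \<Rightarrow> cfun \<Rightarrow> bool" where
  "analytic_continuation_across f I F \<longleftrightarrow>
     (\<exists>U. open U \<and> I \<subseteq> U \<and> F holomorphic_on (ball 0 1 \<union> U)) \<and> (\<forall>z\<in>ball 0 1. F z = f z)"

definition continuous_extension_to :: "cfun \<Rightarrow> complex set \<Rightarrow> cfun \<Rightarrow> bool" where
  "continuous_extension_to f I F \<longleftrightarrow>
     continuous_on (ball 0 1 \<union> I) F \<and> (\<forall>z\<in>ball 0 1. F z = f z)"

end

theory Submission
  imports Defs "HOL-Library.Function_Algebras"
begin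

text \<open>
  The pivot is a sixth condition: the reproducing kernel \<open>kb w\<close>, for which
  \<open>\<parallel>kb w\<parallel>\<^sup>2 = (1 - |b w|\<^sup>2) / (1 - |w|\<^sup>2)\<close>, stays bounded as \<open>w\<close> approaches points of \<open>I\<close>. It follows
  from (i) by comparison with the values of \<open>b\<close> on \<open>I\<close>. It implies (ii): \<open>X\<^sup>*\<close> acts on
  \<open>(1 - T\<^sub>b T\<^sub>b\<^sup>*) h\<close> as multiplication of \<open>h\<close> by \<open>z\<close>, and evaluation near a point \<open>l\<close> of \<open>I\<close>
  being bounded, \<open>l - X\<^sup>*\<close> is bounded below; its range is dense because the coefficients of a vector
  orthogonal to it have constant modulus. From (ii), the equation satisfied by \<open>kb w\<close>
  under \<open>X\<^sup>*\<close> turns \<open>f w = \<langle>f, kb w\<rangle>\<close> into a power series that converges near \<open>l\<close>, which is (iii). Under (iv),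
  uniform boundedness gives back bounded kernels, hence \<open>|b| = 1\<close> on \<open>I\<close>, while continuity of \<open>kb w\<close> for
  a suitable \<open>w\<close> gives continuity of \<open>b\<close>, that is (v); and (v) gives (i) by Schwarz reflection.

  As the space is given by boundary values and an operator square root, radial limits in \<open>L\<^sup>2\<close>
  are obtained from a maximal inequality, and the square root from a monotone iteration.
\<close>

section \<open>Abstract Hilbert space theory relative to a carrier set of functions\<close>

section \<open>Hilbert spaces of functions\<close>

text \<open>The square root in the definition of the space is never computed with. Everything passes
  through its square \<open>A\<close>: by \<open>Hb_inner_A\<close>, pairing with \<open>A h\<close>
  in the space is pairing with \<open>h\<close> in \<open>H2\<close>, and
  \<open>Hb_if_bounded\<close> decides membership by duality. The hard step is the lower bound for
  \<open>l\<close> minus the adjoint shift. The squared norm of \<open>A h\<close> is the limit of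
  circle integrals of |A h|^2 + (1 - |b|^2) |Ms h|^2, where \<open>Ms\<close> is the adjoint of
  multiplication by \<open>b\<close>. Replacing \<open>h\<close> by (l - z) h multiplies both
  \<open>A h\<close> and \<open>Ms h\<close> by l - z, up to multiples of one scalar, and evaluation
  at \<open>l\<close> controls that scalar. Near \<open>l\<close> division by l - z is useless;
  there the weight is O(1 - |z|), and the estimate is made for polynomials \<open>h\<close>, because
  \<open>Ms h\<close> is then a polynomial too, hence bounded, and the weighted term dies as the
  radius tends to 1. Since \<open>H2_inner\<close> is an integral of radial limits, even Parseval's
  identity requires an integrable majorant for all radii at once; this is the purpose of the maximal
  inequality.\<close>

definition cs :: "complex \<Rightarrow> cfun \<Rightarrow> cfun" where
  "cs c f = (\<lambda>z. c * f z)"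

lemma cs_apply: "cs c f z = c * f z"
  by (simp add: cs_def)

lemma cs_add_right: "cs c (f + g) = cs c f + cs c g"
  and cs_diff_right: "cs c (f - g) = cs c f - cs c g"
  and cs_add_left: "cs (c + d) f = cs c f + cs d f"
  and cs_cs: "cs c (cs d f) = cs (c * d) f"
  and cs_one: "cs 1 f = f"
  and cs_zero: "cs 0 f = 0"
  and cs_zero_right: "cs c 0 = 0"
  and cs_minus_one: "cs (-1) f = - f"
  by (auto simp: fun_eq_iff algebra_simps cs_apply)

text \<open>First-order condition at a minimum: at t = -a/(q+1) the quadratic is negative unless a =
  0. The 1 keeps the divisor positive when q = 0.\<close>

lemma quadratic_nonneg_imp_linear_zero:
  fixes a q :: real
  assumes "\<And>t. 0 \<le> 2 * t * a + t\<^sup>2 * q" and "0 \<le> q"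
  shows "a = 0"
proof -
  define p where "p = q + 1"
  have p: "p > 0" using \<open>0 \<le> q\<close> by (simp add: p_def)
  have "0 \<le> 2 * (- a / p) * a + (- a / p)\<^sup>2 * q" using assms(1) by blast
  also have "\<dots> \<le> 2 * (- a / p) * a + (- a / p)\<^sup>2 * p"
    by (intro add_left_mono mult_left_mono) (auto simp: p_def)
  also have "\<dots> = - a\<^sup>2 / p" using p by (simp add: field_simps power2_eq_square)
  finally show ?thesis using p by (simp add: divide_le_0_iff)
qed

text \<open>\<open>H2\<close> and \<open>Hb b\<close> consist of functions of the same type and
  differ in carrier and inner product, so they become instances of a locale. The axioms are relative
  to \<open>V\<close> because \<open>ip\<close> is a total function without meaning outside.\<close>

locale hilbert =
  fixes V :: "cfun set" and ip :: "cfun \<Rightarrow> cfun \<Rightarrow> complex"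
  assumes V_zero: "0 \<in> V"
    and V_add: "\<And>f g. f \<in> V \<Longrightarrow> g \<in> V \<Longrightarrow> f + g \<in> V"
    and V_cs: "\<And>c f. f \<in> V \<Longrightarrow> cs c f \<in> V"
    and ip_add_left: "\<And>f g h. f \<in> V \<Longrightarrow> g \<in> V \<Longrightarrow> h \<in> V \<Longrightarrow> ip (f + g) h = ip f h + ip g h"
    and ip_cs_left: "\<And>c f h. f \<in> V \<Longrightarrow> h \<in> V \<Longrightarrow> ip (cs c f) h = c * ip f h"
    and ip_commute: "\<And>f g. f \<in> V \<Longrightarrow> g \<in> V \<Longrightarrow> ip g f = cnj (ip f g)"
    and ip_pos: "\<And>f. f \<in> V \<Longrightarrow> 0 \<le> Re (ip f f)"
    and ip_definite: "\<And>f. f \<in> V \<Longrightarrow> ip f f = 0 \<Longrightarrow> f = 0"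
    and complete: "\<And>s. \<lbrakk>\<And>n. s n \<in> V; \<And>e. e > 0 \<Longrightarrow> \<exists>M. \<forall>m\<ge>M. \<forall>n\<ge>M. hnorm ip (s m - s n) < e\<rbrakk>
        \<Longrightarrow> \<exists>l\<in>V. (\<lambda>n::nat. hnorm ip (s n - l)) \<longlonglongrightarrow> 0"
begin

abbreviation nrm :: "cfun \<Rightarrow> real" where "nrm \<equiv> hnorm ip"

definition linop :: "(cfun \<Rightarrow> cfun) \<Rightarrow> bool" where
  "linop A \<longleftrightarrow> (\<forall>f\<in>V. A f \<in> V) \<and> (\<forall>f\<in>V. \<forall>g\<in>V. A (f + g) = A f + A g) \<and>
     (\<forall>c. \<forall>f\<in>V. A (cs c f) = cs c (A f))"

definition subsp :: "cfun set \<Rightarrow> bool" where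
  "subsp W \<longleftrightarrow> W \<subseteq> V \<and> 0 \<in> W \<and> (\<forall>f\<in>W. \<forall>g\<in>W. f + g \<in> W) \<and> (\<forall>c. \<forall>f\<in>W. cs c f \<in> W)"

lemma bounded_op_iff:
  "bounded_op V ip A \<longleftrightarrow> linop A \<and> (\<exists>C. \<forall>f\<in>V. nrm (A f) \<le> C * nrm f)"
  by (auto simp: bounded_op_def linop_def plus_fun_def cs_def)

lemma V_uminus: "f \<in> V \<Longrightarrow> - f \<in> V"
  using V_cs[of f "-1"] by (simp add: cs_minus_one)

lemma V_diff: "f \<in> V \<Longrightarrow> g \<in> V \<Longrightarrow> f - g \<in> V"
  using V_add[of f "-g"] V_uminus[of g] by simp

lemmas V_closed = V_zero V_add V_cs V_uminus V_diff

lemma ip_uminus_left: "f \<in> V \<Longrightarrow> h \<in> V \<Longrightarrow> ip (- f) h = - ip f h"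
  using ip_cs_left[of f h "-1"] by (simp add: cs_minus_one)

lemma ip_diff_left: "f \<in> V \<Longrightarrow> g \<in> V \<Longrightarrow> h \<in> V \<Longrightarrow> ip (f - g) h = ip f h - ip g h"
  using ip_add_left[of f "-g" h] by (simp add: V_uminus ip_uminus_left)

lemma ip_zero_left: "h \<in> V \<Longrightarrow> ip 0 h = 0"
  using ip_cs_left[of 0 h 0] by (simp add: cs_zero V_zero)

lemma ip_add_right: "f \<in> V \<Longrightarrow> g \<in> V \<Longrightarrow> h \<in> V \<Longrightarrow> ip h (f + g) = ip h f + ip h g"
  by (subst (1 2 3) ip_commute) (auto simp: V_closed ip_add_left)

lemma ip_diff_right: "f \<in> V \<Longrightarrow> g \<in> V \<Longrightarrow> h \<in> V \<Longrightarrow> ip h (f - g) = ip h f - ip h g"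
  by (subst (1 2 3) ip_commute) (auto simp: V_closed ip_diff_left)

lemma ip_uminus_right: "f \<in> V \<Longrightarrow> h \<in> V \<Longrightarrow> ip h (- f) = - ip h f"
  by (subst (1 2) ip_commute) (auto simp: V_closed ip_uminus_left)

lemma ip_cs_right: "f \<in> V \<Longrightarrow> h \<in> V \<Longrightarrow> ip h (cs c f) = cnj c * ip h f"
  by (subst (1 2) ip_commute) (auto simp: V_closed ip_cs_left)

lemma ip_zero_right: "h \<in> V \<Longrightarrow> ip h 0 = 0"
  by (subst ip_commute) (auto simp: V_closed ip_zero_left)

lemmas ip_simps = ip_add_left ip_cs_left ip_diff_left ip_uminus_left ip_zero_left
  ip_add_right ip_cs_right ip_diff_right ip_uminus_right ip_zero_right

lemma Re_ip_commute: "f \<in> V \<Longrightarrow> g \<in> V \<Longrightarrow> Re (ip g f) = Re (ip f g)"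
  by (subst ip_commute) auto

lemma nrm_nonneg: "f \<in> V \<Longrightarrow> 0 \<le> nrm f"
  by (simp add: hnorm_def ip_pos)

lemma nrm_sq: "f \<in> V \<Longrightarrow> (nrm f)\<^sup>2 = Re (ip f f)"
  by (simp add: hnorm_def ip_pos)

lemma ip_self: "f \<in> V \<Longrightarrow> ip f f = of_real ((nrm f)\<^sup>2)"
  using ip_commute[of f f] by (auto simp: complex_eq_iff nrm_sq)

lemma nrm_eq_0: "f \<in> V \<Longrightarrow> nrm f = 0 \<longleftrightarrow> f = 0"
  using ip_self[of f] ip_definite[of f] by (auto simp: ip_zero_left V_zero hnorm_def)

lemma nrm_zero [simp]: "nrm 0 = 0"
  by (simp add: nrm_eq_0 V_zero)

lemma nrm_cs: "f \<in> V \<Longrightarrow> nrm (cs c f) = cmod c * nrm f"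
proof -
  assume f: "f \<in> V"
  have "ip (cs c f) (cs c f) = of_real ((cmod c)\<^sup>2) * ip f f"
    using f by (simp add: ip_simps V_closed complex_norm_square del: of_real_power)
  then have "Re (ip (cs c f) (cs c f)) = (cmod c)\<^sup>2 * Re (ip f f)"
    by (simp del: of_real_power)
  then show ?thesis
    using f by (simp add: hnorm_def real_sqrt_mult)
qed

lemma nrm_uminus: "f \<in> V \<Longrightarrow> nrm (- f) = nrm f"
  using nrm_cs[of f "-1"] by (simp add: cs_minus_one)

lemma nrm_minus_commute: "f \<in> V \<Longrightarrow> g \<in> V \<Longrightarrow> nrm (f - g) = nrm (g - f)"
  using nrm_uminus[of "f - g"] by (simp add: V_diff)

lemma nrm_add_sq: "f \<in> V \<Longrightarrow> g \<in> V \<Longrightarrow> (nrm (f + g))\<^sup>2 = (nrm f)\<^sup>2 + 2 * Re (ip f g) + (nrm g)\<^sup>2"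
  using Re_ip_commute[of f g] by (simp add: nrm_sq V_closed ip_simps)

lemma nrm_diff_sq: "f \<in> V \<Longrightarrow> g \<in> V \<Longrightarrow> (nrm (f - g))\<^sup>2 = (nrm f)\<^sup>2 - 2 * Re (ip f g) + (nrm g)\<^sup>2"
  using Re_ip_commute[of f g] by (simp add: nrm_sq V_closed ip_simps)

lemma Cauchy_Schwarz:
  assumes f: "f \<in> V" and g: "g \<in> V"
  shows "cmod (ip f g) \<le> nrm f * nrm g"
proof (cases "g = 0")
  case True
  then show ?thesis using f by (simp add: ip_simps)
next
  case False
  then have g0: "nrm g > 0" using g nrm_eq_0[of g] nrm_nonneg[of g] by linarith
  define c where "c = ip f g / of_real ((nrm g)\<^sup>2)"
  have cg: "cs c g \<in> V" using g by (rule V_cs)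
  have "Re (ip f (cs c g)) = (cmod (ip f g))\<^sup>2 / (nrm g)\<^sup>2"
  proof -
    have "ip f (cs c g) = cnj (ip f g) * ip f g / of_real ((nrm g)\<^sup>2)"
      using f g by (simp add: ip_simps c_def)
    also have "cnj (ip f g) * ip f g = of_real ((cmod (ip f g))\<^sup>2)"
      by (simp add: complex_norm_square mult.commute del: of_real_power)
    finally show ?thesis by (simp only: Re_divide_of_real Re_complex_of_real)
  qed
  moreover have "(nrm (cs c g))\<^sup>2 = (cmod (ip f g))\<^sup>2 / (nrm g)\<^sup>2"
  proof -
    have "cmod c = cmod (ip f g) / (nrm g)\<^sup>2"
      by (simp only: c_def norm_divide norm_of_real abs_power2)
    then show ?thesis
      using g0 g by (simp add: nrm_cs power_mult_distrib power_divide field_simps power2_eq_square)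
  qed
  ultimately have "0 \<le> (nrm f)\<^sup>2 - (cmod (ip f g))\<^sup>2 / (nrm g)\<^sup>2"
    using nrm_diff_sq[OF f cg] zero_le_power2[of "nrm (f - cs c g)"] by simp
  then have "(cmod (ip f g))\<^sup>2 \<le> (nrm f * nrm g)\<^sup>2"
    using g0 by (simp add: field_simps power_mult_distrib)
  then show ?thesis
    using nrm_nonneg f g by (simp add: power2_le_iff_abs_le)
qed

lemma nrm_triangle:
  assumes f: "f \<in> V" and g: "g \<in> V"
  shows "nrm (f + g) \<le> nrm f + nrm g"
proof -
  have "Re (ip f g) \<le> nrm f * nrm g"
    using Cauchy_Schwarz[OF f g] complex_Re_le_cmod[of "ip f g"] by linarith
  then have "(nrm (f + g))\<^sup>2 \<le> (nrm f + nrm g)\<^sup>2"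
    using nrm_add_sq[OF f g] by (simp add: power2_sum)
  then show ?thesis using nrm_nonneg f g by (simp add: power2_le_iff_abs_le V_closed)
qed

lemma nrm_triangle_diff: "f \<in> V \<Longrightarrow> g \<in> V \<Longrightarrow> nrm (f - g) \<le> nrm f + nrm g"
  using nrm_triangle[of f "-g"] by (simp add: V_uminus nrm_uminus)

lemma nrm_triangle3:
  "f \<in> V \<Longrightarrow> g \<in> V \<Longrightarrow> h \<in> V \<Longrightarrow> nrm (f - h) \<le> nrm (f - g) + nrm (g - h)"
  using nrm_triangle[of "f - g" "g - h"] by (simp add: V_diff)

lemma nrm_reverse: "f \<in> V \<Longrightarrow> g \<in> V \<Longrightarrow> \<bar>nrm f - nrm g\<bar> \<le> nrm (f - g)"
  using nrm_triangle[of "f - g" g] nrm_triangle[of "g - f" f] nrm_minus_commute[of f g]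
  by (simp add: V_diff)

lemma parallelogram:
  "f \<in> V \<Longrightarrow> g \<in> V \<Longrightarrow> (nrm (f + g))\<^sup>2 + (nrm (f - g))\<^sup>2 = 2 * (nrm f)\<^sup>2 + 2 * (nrm g)\<^sup>2"
  by (simp add: nrm_add_sq nrm_diff_sq)

lemma linop_diff: "linop A \<Longrightarrow> f \<in> V \<Longrightarrow> g \<in> V \<Longrightarrow> A (f - g) = A f - A g"
proof -
  assume A: "linop A" and f: "f \<in> V" and g: "g \<in> V"
  have "A (f + cs (-1) g) = A f + cs (-1) (A g)"
    using A f g V_cs unfolding linop_def by metis
  then show ?thesis by (simp add: cs_minus_one)
qed

lemma linop_zero: "linop A \<Longrightarrow> A 0 = 0"
  using linop_diff[of A 0 0] V_zero by simp

subsection \<open>Limits\<close>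

definition tends :: "(nat \<Rightarrow> cfun) \<Rightarrow> cfun \<Rightarrow> bool" where
  "tends s l \<longleftrightarrow> (\<forall>n. s n \<in> V) \<and> l \<in> V \<and> (\<lambda>n. nrm (s n - l)) \<longlonglongrightarrow> 0"

lemma tends_ip_left: "tends s l \<Longrightarrow> g \<in> V \<Longrightarrow> (\<lambda>n. ip (s n) g) \<longlonglongrightarrow> ip l g"
proof -
  assume s: "tends s l" and g: "g \<in> V"
  have "(\<lambda>n. ip (s n) g - ip l g) \<longlonglongrightarrow> 0"
  proof (rule Lim_null_comparison)
    show "\<forall>\<^sub>F n in sequentially. norm (ip (s n) g - ip l g) \<le> nrm (s n - l) * nrm g"
      using s g Cauchy_Schwarz[of "s _ - l" g] unfolding tends_def
      by (intro always_eventually) (simp add: V_diff ip_diff_left[symmetric])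
    show "(\<lambda>n. nrm (s n - l) * nrm g) \<longlonglongrightarrow> 0"
      using s unfolding tends_def by (intro tendsto_mult_left_zero) auto
  qed
  then show ?thesis by (simp add: Lim_null[symmetric])
qed

lemma tends_ip_right: "tends s l \<Longrightarrow> g \<in> V \<Longrightarrow> (\<lambda>n. ip g (s n)) \<longlonglongrightarrow> ip g l"
proof -
  assume s: "tends s l" and g: "g \<in> V"
  have "(\<lambda>n. cnj (ip (s n) g)) \<longlonglongrightarrow> cnj (ip l g)"
    by (intro tendsto_intros tends_ip_left s g)
  then show ?thesis
    using s g by (subst (1 2) ip_commute) (auto simp: tends_def)
qed

lemma tends_nrm: "tends s l \<Longrightarrow> (\<lambda>n. nrm (s n)) \<longlonglongrightarrow> nrm l"
proof -
  assume s: "tends s l"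
  have "(\<lambda>n. nrm (s n) - nrm l) \<longlonglongrightarrow> 0"
  proof (rule Lim_null_comparison)
    show "\<forall>\<^sub>F n in sequentially. norm (nrm (s n) - nrm l) \<le> nrm (s n - l)"
      using s nrm_reverse[of "s _" l] unfolding tends_def
      by (intro always_eventually) simp
    show "(\<lambda>n. nrm (s n - l)) \<longlonglongrightarrow> 0" using s by (simp add: tends_def)
  qed
  then show ?thesis by (simp add: Lim_null[symmetric])
qed

lemma tends_add: "tends s l \<Longrightarrow> tends t m \<Longrightarrow> tends (\<lambda>n. s n + t n) (l + m)"
proof -
  assume s: "tends s l" and t: "tends t m"
  have "(\<lambda>n. nrm ((s n + t n) - (l + m))) \<longlonglongrightarrow> 0"
  proof (rule Lim_null_comparison)
    show "\<forall>\<^sub>F n in sequentially. norm (nrm ((s n + t n) - (l + m))) \<le> nrm (s n - l) + nrm (t n - m)"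
    proof (intro always_eventually allI)
      fix n
      have eq: "s n + t n - (l + m) = (s n - l) + (t n - m)" by (simp add: fun_eq_iff)
      show "norm (nrm ((s n + t n) - (l + m))) \<le> nrm (s n - l) + nrm (t n - m)"
        unfolding eq using s t nrm_triangle[of "s n - l" "t n - m"]
        by (simp add: tends_def V_diff V_add nrm_nonneg)
    qed
    show "(\<lambda>n. nrm (s n - l) + nrm (t n - m)) \<longlonglongrightarrow> 0"
      using s t tendsto_add[of "\<lambda>n. nrm (s n - l)" 0 _ "\<lambda>n. nrm (t n - m)" 0] by (simp add: tends_def)
  qed
  then show ?thesis using s t by (simp add: tends_def V_add)
qed

lemma tends_const: "l \<in> V \<Longrightarrow> tends (\<lambda>n. l) l"
  by (simp add: tends_def)

lemma tends_cs: "tends s l \<Longrightarrow> tends (\<lambda>n. cs c (s n)) (cs c l)"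
  using tendsto_mult_right_zero[of "\<lambda>n. nrm (s n - l)" sequentially "cmod c"]
  by (simp add: tends_def V_cs V_diff cs_diff_right[symmetric] nrm_cs)

lemma tends_bounded_op:
  assumes A: "linop A" and C: "\<And>f. f \<in> V \<Longrightarrow> nrm (A f) \<le> C * nrm f" and s: "tends s l"
  shows "tends (\<lambda>n. A (s n)) (A l)"
proof -
  have "(\<lambda>n. nrm (A (s n) - A l)) \<longlonglongrightarrow> 0"
  proof (rule Lim_null_comparison)
    show "\<forall>\<^sub>F n in sequentially. norm (nrm (A (s n) - A l)) \<le> C * nrm (s n - l)"
      using s C[of "s _ - l"] A linop_diff[OF A, of "s _" l] unfolding tends_def
      by (intro always_eventually) (simp add: V_diff nrm_nonneg linop_def)
    show "(\<lambda>n. C * nrm (s n - l)) \<longlonglongrightarrow> 0"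
      using s by (intro tendsto_mult_right_zero) (simp add: tends_def)
  qed
  then show ?thesis using s A by (simp add: tends_def linop_def)
qed

lemma tends_unique: "tends s l \<Longrightarrow> tends s m \<Longrightarrow> l = m"
proof -
  assume s: "tends s l" and t: "tends s m"
  have "(\<lambda>n. nrm (s n - m)) \<longlonglongrightarrow> nrm (l - m)"
    using tends_nrm[OF tends_add[OF s tends_const[of "-m"]]] t by (simp add: tends_def V_uminus)
  then have "nrm (l - m) = 0" using t LIMSEQ_unique by (auto simp: tends_def)
  then show ?thesis using s t nrm_eq_0[of "l - m"] by (simp add: tends_def V_diff)
qed

lemma Cauchy_tends:
  assumes "\<And>n. s n \<in> V" and "\<And>e. e > 0 \<Longrightarrow> \<exists>M. \<forall>m\<ge>M. \<forall>n\<ge>M. nrm (s m - s n) < e"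
  shows "\<exists>l. tends s l"
  using complete[of s] assms by (auto simp: tends_def)

lemma tends_Cauchy:
  assumes s: "tends s l" and "e > 0"
  shows "\<exists>M. \<forall>m\<ge>M. \<forall>n\<ge>M. nrm (s m - s n) < e"
proof -
  have "\<forall>\<^sub>F n in sequentially. nrm (s n - l) < e/2"
    using s \<open>e > 0\<close> by (intro order_tendstoD(2)[of _ 0]) (auto simp: tends_def)
  then obtain M where M: "\<And>n. n \<ge> M \<Longrightarrow> nrm (s n - l) < e/2"
    by (auto simp: eventually_sequentially)
  have "nrm (s m - s n) < e" if "m \<ge> M" "n \<ge> M" for m n
    using nrm_triangle3[of "s m" l "s n"] M[OF that(1)] M[OF that(2)] s nrm_minus_commute[of l "s n"]
    by (simp add: tends_def)
  then show ?thesis by blast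
qed

subsection \<open>Riesz representation, density, adjoints\<close>

text \<open>The representing vector minimizes \<open>\<parallel>w\<parallel>\<^sup>2 - 2 Re (\<phi> w)\<close> over the closure of \<open>W\<close>; since
  \<open>W\<close> need not be closed, this also yields orthogonal projections and range inclusions.\<close>

lemma riesz_subspace:
  assumes W: "subsp W"
    and add: "\<And>f g. f \<in> W \<Longrightarrow> g \<in> W \<Longrightarrow> \<phi> (f + g) = \<phi> f + \<phi> g"
    and scale: "\<And>c f. f \<in> W \<Longrightarrow> \<phi> (cs c f) = c * \<phi> f"
    and bnd: "\<And>f. f \<in> W \<Longrightarrow> cmod (\<phi> f) \<le> C * nrm f"
  shows "\<exists>g s. tends s g \<and> (\<forall>n. s n \<in> W) \<and> (\<forall>w\<in>W. \<phi> w = ip w g) \<and> nrm g \<le> max 0 C"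
proof -
  have WV: "\<And>w. w \<in> W \<Longrightarrow> w \<in> V" and W0: "0 \<in> W"
    and Wadd: "\<And>v w. v \<in> W \<Longrightarrow> w \<in> W \<Longrightarrow> v + w \<in> W"
    and Wcs: "\<And>c w. w \<in> W \<Longrightarrow> cs c w \<in> W"
    using W by (auto simp: subsp_def)
  define J where "J w = (nrm w)\<^sup>2 - 2 * Re (\<phi> w)" for w
  define d where "d = Inf (J ` W)"
  \<comment> \<open>Completing the square bounds \<open>J\<close> below, so its infimum is
    finite.\<close>
  have Jlow: "J w \<ge> - C\<^sup>2" if "w \<in> W" for w
  proof -
    have "Re (\<phi> w) \<le> C * nrm w"
      using bnd[OF that] complex_Re_le_cmod[of "\<phi> w"] by linarith
    moreover have "0 \<le> (nrm w - C)\<^sup>2" by simp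
    ultimately show ?thesis by (simp add: J_def power2_diff mult_ac)
  qed
  have bdd: "bdd_below (J ` W)" using Jlow by (auto intro!: bdd_belowI)
  have dle: "d \<le> J w" if "w \<in> W" for w
    unfolding d_def using that bdd by (auto intro: cInf_lower)
  have "\<exists>w\<in>W. J w < d + 1 / real (Suc n)" for n
  proof (rule ccontr)
    assume "\<not> ?thesis"
    then have "d + 1 / real (Suc n) \<le> Inf (J ` W)"
      using W0 by (intro cInf_greatest) (auto simp: not_less)
    then show False by (simp add: d_def)
  qed
  then obtain s where sW: "\<And>n. s n \<in> W" and sJ: "\<And>n. J (s n) < d + 1 / real (Suc n)"
    by metis
  have sV: "\<And>n. s n \<in> V" using sW WV by blast
  \<comment> \<open>At the midpoint of two near minimizers \<open>J\<close> is still at least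
    \<open>d\<close>; the parallelogram law turns this into closeness.\<close>
  have close: "(nrm (s m - s n))\<^sup>2 \<le> 2 * (1 / real (Suc m) + 1 / real (Suc n))" for m n
  proof -
    let ?a = "cs (1/2) (s m + s n)"
    have aW: "?a \<in> W" using sW Wadd Wcs by blast
    have "\<phi> ?a = (\<phi> (s m) + \<phi> (s n)) / 2"
      using scale[OF Wadd[OF sW sW]] add[OF sW sW] by simp
    then have "Re (\<phi> ?a) = (Re (\<phi> (s m)) + Re (\<phi> (s n))) / 2" by (simp only: Re_divide_numeral plus_complex.sel)
    then have "4 * J ?a = (nrm (s m + s n))\<^sup>2 - 4 * (Re (\<phi> (s m)) + Re (\<phi> (s n)))"
      using sV[of m] sV[of n] by (simp add: J_def nrm_cs V_add power_mult_distrib power_divide)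
    moreover have "4 * d \<le> 4 * J ?a" using dle[OF aW] by simp
    ultimately show ?thesis
      using parallelogram[OF sV[of m] sV[of n]] sJ[of m] sJ[of n] by (simp add: J_def)
  qed
  have "\<exists>l. tends s l"
  proof (rule Cauchy_tends[OF sV])
    fix e :: real assume e: "e > 0"
    obtain M :: nat where M: "1 / real (Suc M) < e\<^sup>2 / 4"
      using e nat_approx_posE[of "e\<^sup>2/4"] by auto
    have "nrm (s m - s n) < e" if "m \<ge> M" "n \<ge> M" for m n
    proof -
      have "1 / real (Suc m) \<le> 1 / real (Suc M)" "1 / real (Suc n) \<le> 1 / real (Suc M)"
        using that by (auto simp: field_simps)
      moreover have "x < e\<^sup>2" if "a \<le> c" "b \<le> c" "x \<le> 2 * (a + b)" "c < e\<^sup>2 / 4" for a b c x :: real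
        using that by argo
      ultimately have "(nrm (s m - s n))\<^sup>2 < e\<^sup>2" using close[of m n] M by blast
      then show ?thesis using e by (simp add: power2_less_imp_less)
    qed
    then show "\<exists>M. \<forall>m\<ge>M. \<forall>n\<ge>M. nrm (s m - s n) < e" by blast
  qed
  then obtain g where sg: "tends s g" by blast
  then have gV: "g \<in> V" by (simp add: tends_def)
  have Re_eq: "Re (\<phi> w) = Re (ip w g)" if w: "w \<in> W" for w
  proof -
    have wV: "w \<in> V" using w WV by blast
    \<comment> \<open>Adding t w to \<open>s n\<close> cannot bring \<open>J\<close> below
      \<open>d\<close>, so it gains at most 1/(n+1), which vanishes in the limit.\<close>
    have ineq: "0 \<le> 2 * t * (Re (ip w g) - Re (\<phi> w)) + t\<^sup>2 * (nrm w)\<^sup>2" for t :: real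
    proof (rule LIMSEQ_le)
      show "(\<lambda>n. - (1 / real (Suc n))) \<longlonglongrightarrow> 0"
        using tendsto_minus[OF LIMSEQ_Suc[OF lim_1_over_n]] by simp
      show "(\<lambda>n. 2 * t * (Re (ip w (s n)) - Re (\<phi> w)) + t\<^sup>2 * (nrm w)\<^sup>2) \<longlonglongrightarrow>
            2 * t * (Re (ip w g) - Re (\<phi> w)) + t\<^sup>2 * (nrm w)\<^sup>2"
        by (intro tendsto_intros tends_ip_right sg wV)
      have "- (1 / real (Suc n)) \<le> 2 * t * (Re (ip w (s n)) - Re (\<phi> w)) + t\<^sup>2 * (nrm w)\<^sup>2" for n
      proof -
        let ?c = "complex_of_real t"
        have tw: "cs ?c w \<in> V" "cs ?c w \<in> W" using wV V_cs w Wcs by auto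
        have "d \<le> J (s n + cs ?c w)" using dle Wadd sW tw by blast
        also have "J (s n + cs ?c w) = J (s n) + 2 * t * (Re (ip w (s n)) - Re (\<phi> w)) + t\<^sup>2 * (nrm w)\<^sup>2"
          using Re_ip_commute[OF wV sV[of n]]
          by (simp add: J_def nrm_add_sq[OF sV tw(1)] nrm_cs wV ip_simps sV add sW tw scale w
              power_mult_distrib algebra_simps)
        finally show ?thesis using sJ[of n] by linarith
      qed
      then show "\<exists>N. \<forall>n\<ge>N. - (1 / real (Suc n)) \<le> 2 * t * (Re (ip w (s n)) - Re (\<phi> w)) + t\<^sup>2 * (nrm w)\<^sup>2"
        by blast
    qed
    then show ?thesis using quadratic_nonneg_imp_linear_zero[OF _ zero_le_power2] by fastforce
  qed
  have rep: "\<phi> w = ip w g" if w: "w \<in> W" for w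
  proof -
    \<comment> \<open>Replacing \<open>w\<close> by i w yields the imaginary parts.\<close>
    have "Re (\<phi> (cs \<i> w)) = Re (ip (cs \<i> w) g)" using Re_eq Wcs w by blast
    then show ?thesis using Re_eq[OF w] w WV[OF w] gV by (simp add: scale ip_simps complex_eq_iff)
  qed
  have "nrm g \<le> max 0 C"
  proof (rule ccontr)
    assume "\<not> nrm g \<le> max 0 C"
    then have gt: "nrm g > C" "nrm g > 0" by auto
    \<comment> \<open>On the approximating sequence \<phi> is pairing with \<open>g\<close>; in the
      limit |g|^2 <= C |g|.\<close>
    have "(\<lambda>n. cmod (ip (s n) g)) \<longlonglongrightarrow> cmod (ip g g)"
      by (intro tendsto_intros tends_ip_left sg gV)
    moreover have "(\<lambda>n. C * nrm (s n)) \<longlonglongrightarrow> C * nrm g"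
      by (intro tendsto_intros tends_nrm sg)
    moreover have "\<forall>n. cmod (ip (s n) g) \<le> C * nrm (s n)"
      using bnd sW rep by metis
    ultimately have "cmod (ip g g) \<le> C * nrm g" by (meson LIMSEQ_le)
    then have "nrm g * nrm g \<le> C * nrm g"
      using gV by (simp add: ip_self norm_power power2_eq_square norm_mult)
    then show False using gt by simp
  qed
  then show ?thesis using sg sW rep by blast
qed

text \<open>The Riesz vector \<open>g\<close> of w -> <w, f> on \<open>W\<close> is the projection
  of \<open>f\<close> to the closure of \<open>W\<close>. Then f - g is orthogonal to
  \<open>W\<close>, hence 0, and \<open>g\<close> comes with an approximating sequence.\<close>

lemma dense_if_orthogonal_trivial:
  assumes W: "subsp W" and orth: "\<And>f. f \<in> V \<Longrightarrow> (\<And>w. w \<in> W \<Longrightarrow> ip w f = 0) \<Longrightarrow> f = 0" and f: "f \<in> V"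
  shows "\<exists>s. tends s f \<and> (\<forall>n. s n \<in> W)"
proof -
  have WV: "\<And>w. w \<in> W \<Longrightarrow> w \<in> V" using W by (auto simp: subsp_def)
  have "\<exists>g s. tends s g \<and> (\<forall>n. s n \<in> W) \<and> (\<forall>w\<in>W. ip w f = ip w g) \<and> nrm g \<le> max 0 (nrm f)"
    using WV f Cauchy_Schwarz
    by (intro riesz_subspace[OF W]) (auto simp: ip_simps mult.commute[of "nrm f"])
  then obtain g s where g: "tends s g" "\<And>n. s n \<in> W" "\<And>w. w \<in> W \<Longrightarrow> ip w f = ip w g" by blast
  have "f - g = 0" using g f WV by (intro orth) (auto simp: V_closed ip_simps tends_def)
  then show ?thesis using g by auto
qed

lemma V_subsp: "subsp V"
  by (simp add: subsp_def V_closed)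

lemma ip_eq_all_imp_eq:
  assumes "f \<in> V" "g \<in> V" "\<And>h. h \<in> V \<Longrightarrow> ip h f = ip h g"
  shows "f = g"
  using assms(3)[of "f - g"] ip_definite[of "f - g"] assms(1,2) by (simp add: V_diff ip_simps)

text \<open>Riesz applied to f -> <A f, g> for each \<open>g\<close>. As the sign of
  \<open>C\<close> is not fixed, the bound is stated with \<open>max 0 C\<close>.\<close>

lemma adjoint_exists:
  assumes A: "linop A" and C: "\<And>f. f \<in> V \<Longrightarrow> nrm (A f) \<le> C * nrm f"
  shows "\<exists>B. linop B \<and> (\<forall>f\<in>V. \<forall>g\<in>V. ip (A f) g = ip f (B g)) \<and> (\<forall>g\<in>V. nrm (B g) \<le> max 0 C * nrm g)"
proof -
  have Ain: "\<And>f. f \<in> V \<Longrightarrow> A f \<in> V" using A by (simp add: linop_def)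
  have "\<exists>h. h \<in> V \<and> (\<forall>f\<in>V. ip (A f) g = ip f h) \<and> nrm h \<le> max 0 C * nrm g" if g: "g \<in> V" for g
  proof -
    have "\<exists>h s. tends s h \<and> (\<forall>n. s n \<in> V) \<and> (\<forall>w\<in>V. ip (A w) g = ip w h) \<and> nrm h \<le> max 0 (C * nrm g)"
    proof (rule riesz_subspace[OF V_subsp])
      show "cmod (ip (A f) g) \<le> C * nrm g * nrm f" if "f \<in> V" for f
      proof -
        have "cmod (ip (A f) g) \<le> nrm (A f) * nrm g" using Cauchy_Schwarz Ain that g by blast
        also have "\<dots> \<le> C * nrm f * nrm g" using C[OF that] nrm_nonneg[OF g] by (rule mult_right_mono)
        finally show ?thesis by (simp add: mult_ac)
      qed
    qed (use A g in \<open>auto simp: linop_def ip_simps\<close>)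
    then obtain h where h: "h \<in> V" "\<forall>w\<in>V. ip (A w) g = ip w h" "nrm h \<le> max 0 (C * nrm g)"
      by (auto simp: tends_def)
    have "max 0 (C * nrm g) = max 0 C * nrm g"
      using nrm_nonneg[OF g] by (auto simp: max_def mult_le_0_iff zero_le_mult_iff)
    then show ?thesis using h by metis
  qed
  then obtain B where B: "\<And>g. g \<in> V \<Longrightarrow> B g \<in> V" "\<And>g f. g \<in> V \<Longrightarrow> f \<in> V \<Longrightarrow> ip (A f) g = ip f (B g)"
    "\<And>g. g \<in> V \<Longrightarrow> nrm (B g) \<le> max 0 C * nrm g"
    by metis
  have "B (f + g) = B f + B g" if "f \<in> V" "g \<in> V" for f g
    using that B Ain by (intro ip_eq_all_imp_eq) (auto simp: V_closed ip_simps simp flip: B(2))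
  moreover have "B (cs c f) = cs c (B f)" if "f \<in> V" for f c
    using that B Ain by (intro ip_eq_all_imp_eq) (auto simp: V_closed ip_simps simp flip: B(2))
  ultimately have "linop B" using B(1) by (auto simp: linop_def)
  then show ?thesis using B by blast
qed

text \<open>Fixing the value 0 off \<open>V\<close> leaves exactly one candidate, so the definite
  description denotes it.\<close>

lemma op_adjoint_props:
  assumes A: "linop A" and C: "\<And>f. f \<in> V \<Longrightarrow> nrm (A f) \<le> C * nrm f"
  shows "linop (op_adjoint V ip A)"
    and "\<And>f g. f \<in> V \<Longrightarrow> g \<in> V \<Longrightarrow> ip (A f) g = ip f (op_adjoint V ip A g)"
    and "\<And>g. g \<in> V \<Longrightarrow> nrm (op_adjoint V ip A g) \<le> max 0 C * nrm g"
proof -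
  let ?P = "\<lambda>B. (\<forall>f\<in>V. B f \<in> V) \<and> (\<forall>f\<in>V. \<forall>g\<in>V. ip (A f) g = ip f (B g)) \<and>
                (\<forall>f. f \<notin> V \<longrightarrow> B f = (\<lambda>z. 0))"
  obtain B where B: "linop B" "\<And>f g. f \<in> V \<Longrightarrow> g \<in> V \<Longrightarrow> ip (A f) g = ip f (B g)"
      "\<And>g. g \<in> V \<Longrightarrow> nrm (B g) \<le> max 0 C * nrm g"
    using adjoint_exists[OF A C] by blast
  have Bin: "\<And>f. f \<in> V \<Longrightarrow> B f \<in> V" using B(1) by (simp add: linop_def)
  define B' where "B' f = (if f \<in> V then B f else (\<lambda>z. 0))" for f
  have "op_adjoint V ip A = B'"
    unfolding op_adjoint_def
  proof (rule the_equality)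
    show "?P B'" using B Bin by (simp add: B'_def)
    fix Q assume Q: "?P Q"
    show "Q = B'"
    proof
      fix f show "Q f = B' f"
      proof (cases "f \<in> V")
        case True
        then have "Q f = B f"
          using Q Bin B(2) by (intro ip_eq_all_imp_eq) (metis, metis, metis)
        then show ?thesis using True by (simp add: B'_def)
      qed (use Q in \<open>simp add: B'_def\<close>)
    qed
  qed
  then show "linop (op_adjoint V ip A)"
    and "\<And>f g. f \<in> V \<Longrightarrow> g \<in> V \<Longrightarrow> ip (A f) g = ip f (op_adjoint V ip A g)"
    and "\<And>g. g \<in> V \<Longrightarrow> nrm (op_adjoint V ip A g) \<le> max 0 C * nrm g"
    using B by (simp_all add: B'_def linop_def V_closed)
qed

text \<open>The lower bound makes preimages of Cauchy sequences Cauchy, so the range is closed;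
  being dense, it is everything. The inverse is bounded by 1/c.\<close>

lemma invertible_if_bounded_below:
  assumes A: "linop A" and C: "\<And>f. f \<in> V \<Longrightarrow> nrm (A f) \<le> C * nrm f"
    and c: "c > 0" and below: "\<And>f. f \<in> V \<Longrightarrow> c * nrm f \<le> nrm (A f)"
    and dense: "\<And>u. u \<in> V \<Longrightarrow> (\<And>f. f \<in> V \<Longrightarrow> ip (A f) u = 0) \<Longrightarrow> u = 0"
  shows "\<exists>B. bounded_op V ip B \<and> (\<forall>f\<in>V. B (A f) = f) \<and> (\<forall>f\<in>V. A (B f) = f)"
proof -
  have Ain: "\<And>f. f \<in> V \<Longrightarrow> A f \<in> V" using A by (simp add: linop_def)
  have Aadd: "\<And>f g. f \<in> V \<Longrightarrow> g \<in> V \<Longrightarrow> A (f + g) = A f + A g"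
    and Acs: "\<And>c f. f \<in> V \<Longrightarrow> A (cs c f) = cs c (A f)" using A by (simp_all add: linop_def)
  have W: "subsp (A ` V)"
    unfolding subsp_def using Ain Aadd[symmetric] Acs[symmetric] V_closed linop_zero[OF A]
    by (auto simp: image_iff)
  have surj: "\<exists>f\<in>V. A f = g" if g: "g \<in> V" for g
  proof -
    obtain t where t: "tends t g" "\<And>n. t n \<in> A ` V"
      using dense_if_orthogonal_trivial[OF W _ g] dense by blast
    then obtain s where s: "\<And>n. s n \<in> V" "\<And>n. t n = A (s n)" unfolding image_iff by metis
    have "\<exists>l. tends s l"
    proof (rule Cauchy_tends[OF s(1)])
      fix e :: real assume "e > 0"
      then obtain M where M: "\<And>m n. m \<ge> M \<Longrightarrow> n \<ge> M \<Longrightarrow> nrm (t m - t n) < c * e"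
        using tends_Cauchy[OF t(1), of "c * e"] c by auto
      have "nrm (s m - s n) < e" if "m \<ge> M" "n \<ge> M" for m n
      proof -
        have "c * nrm (s m - s n) \<le> nrm (t m - t n)"
          using below[of "s m - s n"] s by (simp add: V_diff linop_diff[OF A])
        then have "c * nrm (s m - s n) < c * e" using M[OF that] by linarith
        then show ?thesis using c by simp
      qed
      then show "\<exists>M. \<forall>m\<ge>M. \<forall>n\<ge>M. nrm (s m - s n) < e" by blast
    qed
    then obtain l where l: "tends s l" by blast
    have "tends t (A l)" using tends_bounded_op[OF A C l] s(2)[symmetric] by simp
    then show ?thesis using tends_unique[OF t(1)] l by (auto simp: tends_def)
  qed
  have inj: "f = g" if "f \<in> V" "g \<in> V" "A f = A g" for f g
  proof -
    have "c * nrm (f - g) \<le> 0" using below[of "f - g"] that by (simp add: V_diff linop_diff[OF A])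
    then have "nrm (f - g) = 0" using c nrm_nonneg[of "f - g"] that
      by (simp add: V_diff mult_le_0_iff)
    then show ?thesis using nrm_eq_0[of "f - g"] that by (simp add: V_diff)
  qed
  obtain B where B: "\<And>g. g \<in> V \<Longrightarrow> B g \<in> V" "\<And>g. g \<in> V \<Longrightarrow> A (B g) = g"
    using surj by metis
  have BA: "\<And>f. f \<in> V \<Longrightarrow> B (A f) = f" using B Ain inj by blast
  have "B (f + g) = B f + B g" if "f \<in> V" "g \<in> V" for f g
    using inj[of "B (f + g)" "B f + B g"] B[OF that(1)] B[OF that(2)] B[OF V_add[OF that]]
    by (simp add: V_add Aadd)
  moreover have "B (cs c f) = cs c (B f)" if "f \<in> V" for c f
    using inj[of "B (cs c f)" "cs c (B f)"] B[OF that] B[OF V_cs[OF that]]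
    by (simp add: V_cs Acs)
  ultimately have "linop B" using B(1) by (simp add: linop_def)
  moreover have "nrm (B f) \<le> (1 / c) * nrm f" if "f \<in> V" for f
    using below[of "B f"] B that c by (simp add: field_simps)
  ultimately have "bounded_op V ip B" unfolding bounded_op_iff by blast
  then show ?thesis using BA B(2) by blast
qed

end


text \<open>The definitions write the zero function as an abstraction, the algebra of functions as
  0.\<close>

lemma zero_cfun [simp]: "(\<lambda>z. 0) = (0 :: cfun)"
  by (simp add: zero_fun_def)

context hilbert
begin

subsection \<open>Positive square roots\<close>

text \<open>Polarization: reality of the form at f + g gives the imaginary parts, at f + i g the
  real parts.\<close>

lemma symmetric_if_real:
  assumes R: "linop R" and re: "\<And>f. f \<in> V \<Longrightarrow> Im (ip (R f) f) = 0" and f: "f \<in> V" and g: "g \<in> V"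
  shows "ip (R f) g = ip f (R g)"
proof -
  have Rin: "R f \<in> V" "R g \<in> V" and ig: "cs \<i> g \<in> V"
    and Radd: "R (f + g) = R f + R g" "R (f + cs \<i> g) = R f + cs \<i> (R g)"
    using R f g V_cs by (auto simp: linop_def)
  have "Im (ip (R f) f) + Im (ip (R f) g) + Im (ip (R g) f) + Im (ip (R g) g) = 0"
    using re[OF V_add[OF f g]] f g Rin by (simp add: Radd ip_simps V_closed)
  then have 1: "Im (ip (R f) g) = - Im (ip (R g) f)" using re[OF f] re[OF g] by simp
  have "Im (ip (R f + cs \<i> (R g)) (f + cs \<i> g)) = 0"
    using re[OF V_add[OF f ig]] Radd by simp
  then have 2: "Re (ip (R f) g) = Re (ip (R g) f)"
    using re[OF f] re[OF g] f g Rin by (simp add: ip_simps V_closed algebra_simps)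
  have "ip f (R g) = cnj (ip (R g) f)" using Rin f by (intro ip_commute)
  then show ?thesis using 1 2 by (simp add: complex_eq_iff)
qed

text \<open>Along g + t R g the nonnegative form has no constant term, so its linear coefficient,
  twice |R g|^2, must vanish.\<close>

lemma positive_null:
  assumes R: "linop R" and pos: "\<And>f. f \<in> V \<Longrightarrow> Im (ip (R f) f) = 0 \<and> 0 \<le> Re (ip (R f) f)"
    and g: "g \<in> V" and null: "Re (ip (R g) g) = 0"
  shows "R g = 0"
proof -
  define k where "k = R g"
  have Rin: "\<And>f. f \<in> V \<Longrightarrow> R f \<in> V" using R by (simp add: linop_def)
  have k: "k \<in> V" using Rin g by (simp add: k_def)
  have "0 \<le> 2 * t * (nrm k)\<^sup>2 + t\<^sup>2 * Re (ip (R k) k)" for t :: real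
  proof -
    have tk: "cs t k \<in> V" using k by (rule V_cs)
    have "R (g + cs t k) = k + cs t (R k)" using R g k tk by (simp add: linop_def k_def)
    moreover have "ip (R k) g = ip k k"
      using symmetric_if_real[OF R _ k g] pos by (simp add: k_def)
    ultimately have "ip (R (g + cs t k)) (g + cs t k) = ip k g + 2 * of_real t * ip k k + of_real (t\<^sup>2) * ip (R k) k"
      using k g tk Rin[OF k] by (simp add: ip_simps V_closed algebra_simps power2_eq_square)
    then have "Re (ip (R (g + cs t k)) (g + cs t k)) = 2 * t * (nrm k)\<^sup>2 + t\<^sup>2 * Re (ip (R k) k)"
      using null k by (simp add: ip_self k_def[symmetric] flip: of_real_power)
    then show ?thesis using pos[OF V_add[OF g tk]] by simp
  qed
  then have "(nrm k)\<^sup>2 = 0"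
    using pos[OF k] by (intro quadratic_nonneg_imp_linear_zero[of "(nrm k)\<^sup>2" "Re (ip (R k) k)"]) auto
  then show ?thesis using nrm_eq_0[OF k] by (simp add: k_def)
qed

end

text \<open>The iteration \<open>Y \<mapsto> (B + Y\<^sup>2) / 2\<close> converges to \<open>1 - sqrt (1 - B)\<close>; the scalar iteration
  \<open>y \<mapsto> (1 + y\<^sup>2) / 2\<close> majorizes its increments.\<close>

primrec sqrt_iter :: "(cfun \<Rightarrow> cfun) \<Rightarrow> nat \<Rightarrow> cfun \<Rightarrow> cfun" where
  "sqrt_iter B 0 = (\<lambda>f. 0)"
| "sqrt_iter B (Suc n) = (\<lambda>f. cs (1/2) (B f + sqrt_iter B n (sqrt_iter B n f)))"

fun sqrt_major :: "nat \<Rightarrow> real" where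
  "sqrt_major 0 = 0"
| "sqrt_major (Suc n) = (1 + (sqrt_major n)\<^sup>2) / 2"

lemma sqrt_major_bounds: "0 \<le> sqrt_major n" "sqrt_major n \<le> 1"
proof -
  have "0 \<le> sqrt_major n \<and> sqrt_major n \<le> 1"
    by (induction n) (auto simp: power_le_one)
  then show "0 \<le> sqrt_major n" "sqrt_major n \<le> 1" by auto
qed

text \<open>The difference is (y - 1)^2 / 2.\<close>

lemma sqrt_major_Suc_le: "sqrt_major n \<le> sqrt_major (Suc n)"
  using zero_le_power2[of "sqrt_major n - 1"] by (simp add: power2_diff)

lemma incseq_sqrt_major: "incseq sqrt_major"
  by (rule incseq_SucI) (rule sqrt_major_Suc_le)

lemma Cauchy_sqrt_major: "Cauchy sqrt_major"
  using incseq_convergent[OF incseq_sqrt_major, of 1] sqrt_major_bounds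
  by (metis convergent_Cauchy convergent_def)

text \<open>In the application \<open>B\<close> is \<open>M\<close> after \<open>Ms\<close>, and 1 -
  B is the operator whose root defines the space.\<close>

locale hilbert_contraction = hilbert +
  fixes B
  assumes B: "linop B" and B_le: "\<And>f. f \<in> V \<Longrightarrow> nrm (B f) \<le> nrm f"
    and B_sym: "\<And>f g. f \<in> V \<Longrightarrow> g \<in> V \<Longrightarrow> ip (B f) g = ip f (B g)"
begin

abbreviation Y where "Y \<equiv> sqrt_iter B"

lemma linop_Y: "linop (Y n)"
proof (induction n)
  case 0
  then show ?case by (auto simp: linop_def V_zero cs_zero_right)
next
  case (Suc n)
  have "Y n f \<in> V" "B f \<in> V" if "f \<in> V" for f using Suc B that by (auto simp: linop_def)
  then show ?case using Suc B
    unfolding linop_def by (auto simp: V_closed cs_add_right cs_cs mult.commute)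
qed

lemma Y_in: "f \<in> V \<Longrightarrow> Y n f \<in> V"
  using linop_Y by (simp add: linop_def)

lemma B_in: "f \<in> V \<Longrightarrow> B f \<in> V"
  using B by (simp add: linop_def)

lemma Y_le: "f \<in> V \<Longrightarrow> nrm (Y n f) \<le> sqrt_major n * nrm f"
proof (induction n arbitrary: f)
  case (Suc n)
  have "nrm (Y n (Y n f)) \<le> sqrt_major n * nrm (Y n f)" using Suc.IH Y_in Suc.prems by blast
  also have "\<dots> \<le> sqrt_major n * (sqrt_major n * nrm f)"
    using Suc.IH Suc.prems sqrt_major_bounds by (intro mult_left_mono) auto
  finally have "nrm (Y n (Y n f)) \<le> (sqrt_major n)\<^sup>2 * nrm f" by (simp add: power2_eq_square)
  moreover have "nrm (B f + Y n (Y n f)) \<le> nrm (B f) + nrm (Y n (Y n f))"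
    using Suc.prems Y_in B_in by (intro nrm_triangle) auto
  ultimately have "nrm (B f + Y n (Y n f)) \<le> (1 + (sqrt_major n)\<^sup>2) * nrm f"
    using B_le[OF Suc.prems] by (simp add: algebra_simps)
  then show ?case using Suc.prems Y_in B_in by (simp add: nrm_cs V_closed)
qed simp

lemma Y_sym: "f \<in> V \<Longrightarrow> g \<in> V \<Longrightarrow> ip (Y n f) g = ip f (Y n g)"
proof (induction n arbitrary: f g)
  case (Suc n)
  have "ip (Y n (Y n f)) g = ip f (Y n (Y n g))" using Suc Y_in by simp
  then show ?case using Suc.prems Y_in B_in B_sym[OF Suc.prems] by (simp add: ip_simps V_closed)
qed (simp add: ip_simps)

text \<open>Serves the uniqueness of the root: a rival root commutes with its own square, hence with
  \<open>B\<close> and with every iterate.\<close>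

lemma Y_commute:
  assumes T: "linop T" and BT: "\<And>f. f \<in> V \<Longrightarrow> B (T f) = T (B f)"
  shows "f \<in> V \<Longrightarrow> Y n (T f) = T (Y n f)"
proof (induction n arbitrary: f)
  case 0
  then show ?case using linop_zero[OF T] by simp
next
  case (Suc n)
  have "Y n (Y n (T f)) = T (Y n (Y n f))" using Suc Y_in by simp
  then show ?case using T BT Suc.prems Y_in B_in V_closed by (simp add: linop_def)
qed

lemma Y_step: "f \<in> V \<Longrightarrow> nrm (Y (Suc n) f - Y n f) \<le> (sqrt_major (Suc n) - sqrt_major n) * nrm f"
proof (induction n arbitrary: f)
  case 0
  then show ?case using B_le[OF 0] B_in[OF 0] by (simp add: nrm_cs)
next
  case (Suc n)
  let ?Y = "Y (Suc n)" and ?y = "sqrt_major (Suc n)"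
  note f = Suc.prems
  have in': "?Y f \<in> V" "Y n f \<in> V" by (rule Y_in[OF f])+
  have d: "0 \<le> ?y - sqrt_major n" using sqrt_major_Suc_le[of n] by simp
  \<comment> \<open>a^2 - b^2 = a (a - b) + (a - b) b holds without commutativity. The scalar
    sequence satisfies the same identity, so the increments stay majorized.\<close>
  have eq: "Y (Suc (Suc n)) f - ?Y f = cs (1/2) (?Y (?Y f - Y n f) + (?Y (Y n f) - Y n (Y n f)))"
  proof -
    have "Y (Suc (Suc n)) f - ?Y f = cs (1/2) (B f + ?Y (?Y f)) - cs (1/2) (B f + Y n (Y n f))"
      by simp
    also have "\<dots> = cs (1/2) (?Y (?Y f) - Y n (Y n f))"
      by (simp only: cs_diff_right[symmetric] add_diff_cancel_left)
    finally have "Y (Suc (Suc n)) f - ?Y f = cs (1/2) (?Y (?Y f) - Y n (Y n f))" .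
    moreover have "?Y (?Y f - Y n f) = ?Y (?Y f) - ?Y (Y n f)"
      by (rule linop_diff[OF linop_Y in'])
    ultimately show ?thesis by (simp only: diff_add_cancel add_diff_eq)
  qed
  have "nrm (?Y (?Y f - Y n f)) \<le> ?y * nrm (?Y f - Y n f)" using in' V_diff Y_le by blast
  also have "\<dots> \<le> ?y * ((?y - sqrt_major n) * nrm f)"
    by (intro mult_left_mono Suc.IH f sqrt_major_bounds)
  finally have 1: "nrm (?Y (?Y f - Y n f)) \<le> ?y * ((?y - sqrt_major n) * nrm f)" .
  have "nrm (?Y (Y n f) - Y n (Y n f)) \<le> (?y - sqrt_major n) * nrm (Y n f)"
    by (rule Suc.IH[OF in'(2)])
  also have "\<dots> \<le> (?y - sqrt_major n) * (sqrt_major n * nrm f)"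
    by (intro mult_left_mono d Y_le f)
  finally have 2: "nrm (?Y (Y n f) - Y n (Y n f)) \<le> (?y - sqrt_major n) * (sqrt_major n * nrm f)" .
  have v: "?Y (?Y f - Y n f) \<in> V" "?Y (Y n f) - Y n (Y n f) \<in> V"
    using in' Y_in V_diff by blast+
  have "nrm (Y (Suc (Suc n)) f - ?Y f) =
      (1/2) * nrm (?Y (?Y f - Y n f) + (?Y (Y n f) - Y n (Y n f)))"
    unfolding eq by (subst nrm_cs[OF V_add[OF v]]) (simp add: norm_divide)
  also have "\<dots> \<le> (1/2) * (?y * ((?y - sqrt_major n) * nrm f) + (?y - sqrt_major n) * (sqrt_major n * nrm f))"
    using order_trans[OF nrm_triangle[OF v] add_mono[OF 1 2]] by (intro mult_left_mono) auto
  also have "\<dots> = (?y\<^sup>2 - (sqrt_major n)\<^sup>2) / 2 * nrm f"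
    by (simp only: power2_eq_square) argo
  also have "(?y\<^sup>2 - (sqrt_major n)\<^sup>2) / 2 = sqrt_major (Suc (Suc n)) - ?y"
    by (simp only: sqrt_major.simps(2)[of "Suc n"] sqrt_major.simps(2)[of n]) argo
  finally show ?case .
qed

lemma Y_diff_le:
  assumes f: "f \<in> V"
  shows "nrm (Y (n + p) f - Y n f) \<le> (sqrt_major (n + p) - sqrt_major n) * nrm f"
proof (induction p)
  case (Suc p)
  have "nrm (Y (Suc (n + p)) f - Y n f) \<le> nrm (Y (Suc (n + p)) f - Y (n + p) f) + nrm (Y (n + p) f - Y n f)"
    by (intro nrm_triangle3 Y_in f)
  also have "\<dots> \<le> (sqrt_major (Suc (n + p)) - sqrt_major (n + p)) * nrm f
      + (sqrt_major (n + p) - sqrt_major n) * nrm f"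
    by (intro add_mono Y_step f Suc)
  also have "\<dots> = (sqrt_major (Suc (n + p)) - sqrt_major n) * nrm f" by argo
  finally show ?case by (simp only: add_Suc_right)
qed simp

lemma Y_tends: "f \<in> V \<Longrightarrow> \<exists>l. tends (\<lambda>n. Y n f) l"
proof (rule Cauchy_tends)
  fix e :: real assume f: "f \<in> V" and e: "e > 0"
  define e' where "e' = e / (nrm f + 1)"
  have e': "e' > 0" using e nrm_nonneg[OF f] by (simp add: e'_def)
  obtain M where M: "\<And>m n. m \<ge> M \<Longrightarrow> n \<ge> M \<Longrightarrow> dist (sqrt_major m) (sqrt_major n) < e'"
    using Cauchy_sqrt_major e' unfolding Cauchy_def by metis
  have *: "nrm (Y m f - Y n f) < e" if "m \<ge> n" "n \<ge> M" for m n
  proof -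
    have "nrm (Y m f - Y n f) \<le> (sqrt_major m - sqrt_major n) * nrm f"
      using Y_diff_le[OF f, of n "m - n"] that by simp
    also have "\<dots> \<le> e' * nrm f"
      using M[of m n] that nrm_nonneg[OF f] by (intro mult_right_mono) (auto simp: dist_real_def)
    also have "\<dots> < e' * (nrm f + 1)" using e' by simp
    also have "\<dots> = e" using nrm_nonneg[OF f] by (simp add: e'_def)
    finally show ?thesis .
  qed
  have "nrm (Y m f - Y n f) < e" if "m \<ge> M" "n \<ge> M" for m n
    using *[of n m] *[of m n] that nrm_minus_commute[of "Y m f" "Y n f"] Y_in f
    by (cases "m \<ge> n") auto
  then show "\<exists>M. \<forall>m\<ge>M. \<forall>n\<ge>M. nrm (Y m f - Y n f) < e" by blast
qed (rule Y_in)

definition Yl where "Yl f = (SOME l. tends (\<lambda>n. Y n f) l)"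

lemma tends_Yl: "f \<in> V \<Longrightarrow> tends (\<lambda>n. Y n f) (Yl f)"
  unfolding Yl_def using Y_tends by (rule someI_ex)

lemma Yl_in: "f \<in> V \<Longrightarrow> Yl f \<in> V"
  using tends_Yl by (simp add: tends_def)

lemma linop_Yl: "linop Yl"
  unfolding linop_def
proof (intro conjI ballI allI)
  fix f g c assume f: "f \<in> V"
  show "Yl f \<in> V" using Yl_in f .
  show "Yl (cs c f) = cs c (Yl f)"
    using tends_Yl[OF V_cs[OF f], of c] tends_cs[OF tends_Yl[OF f], of c] linop_Y f tends_unique
    by (simp add: linop_def)
next
  fix f g assume f: "f \<in> V" "g \<in> V"
  show "Yl (f + g) = Yl f + Yl g"
    using tends_Yl[OF V_add[OF f]] tends_add[OF tends_Yl[OF f(1)] tends_Yl[OF f(2)]] linop_Y f tends_unique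
    by (simp add: linop_def)
qed

lemma Yl_le: "f \<in> V \<Longrightarrow> nrm (Yl f) \<le> nrm f"
proof (rule LIMSEQ_le_const2[OF tends_nrm[OF tends_Yl]])
  assume f: "f \<in> V"
  have "nrm (Y n f) \<le> nrm f" for n
    using Y_le[OF f, of n] mult_right_mono[OF sqrt_major_bounds(2)[of n] nrm_nonneg[OF f]] by simp
  then show "\<exists>N. \<forall>n\<ge>N. nrm (Y n f) \<le> nrm f" by blast
qed

lemma Yl_sym: "f \<in> V \<Longrightarrow> g \<in> V \<Longrightarrow> ip (Yl f) g = ip f (Yl g)"
  using Y_sym tends_ip_left[OF tends_Yl, of f g] tends_ip_right[OF tends_Yl, of g f] LIMSEQ_unique
  by simp

lemma Yl_commute:
  assumes T: "linop T" and C: "\<And>f. f \<in> V \<Longrightarrow> nrm (T f) \<le> C * nrm f"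
    and BT: "\<And>f. f \<in> V \<Longrightarrow> B (T f) = T (B f)" and f: "f \<in> V"
  shows "Yl (T f) = T (Yl f)"
proof -
  have "T f \<in> V" using T f by (simp add: linop_def)
  then have "tends (\<lambda>n. Y n (T f)) (Yl (T f))" by (rule tends_Yl)
  moreover have "tends (\<lambda>n. T (Y n f)) (T (Yl f))" by (rule tends_bounded_op[OF T C tends_Yl[OF f]])
  ultimately show ?thesis using Y_commute[OF T BT f] tends_unique by simp
qed

lemma Yl_eq: "f \<in> V \<Longrightarrow> Yl f = cs (1/2) (B f + Yl (Yl f))"
proof -
  assume f: "f \<in> V"
  have 1: "tends (\<lambda>n. Y n (Yl f)) (Yl (Yl f))" using tends_Yl Yl_in f by blast
  have "(\<lambda>n. nrm (Y n (Y n f) - Yl (Yl f))) \<longlonglongrightarrow> 0"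
  proof (rule Lim_null_comparison)
    \<comment> \<open>The iterates have norm at most 1, so replacing the inner \<open>Y n f\<close>
      by \<open>Yl f\<close> costs at most the distance of the two.\<close>
    have "nrm (Y n (Y n f) - Yl (Yl f)) \<le> nrm (Y n f - Yl f) + nrm (Y n (Yl f) - Yl (Yl f))" for n
    proof -
      have "nrm (Y n (Y n f) - Y n (Yl f)) \<le> sqrt_major n * nrm (Y n f - Yl f)"
        using Y_le[of "Y n f - Yl f" n] linop_diff[OF linop_Y] f Y_in Yl_in by (simp add: V_diff)
      also have "\<dots> \<le> 1 * nrm (Y n f - Yl f)"
        using f by (intro mult_right_mono sqrt_major_bounds nrm_nonneg V_diff Y_in Yl_in)
      finally show ?thesis
        using nrm_triangle3[of "Y n (Y n f)" "Y n (Yl f)" "Yl (Yl f)"] f Y_in Yl_in by simp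
    qed
    then show "\<forall>\<^sub>F n in sequentially. norm (nrm (Y n (Y n f) - Yl (Yl f)))
        \<le> nrm (Y n f - Yl f) + nrm (Y n (Yl f) - Yl (Yl f))"
      using f Y_in Yl_in by (intro always_eventually) (simp add: nrm_nonneg V_diff)
    show "(\<lambda>n. nrm (Y n f - Yl f) + nrm (Y n (Yl f) - Yl (Yl f))) \<longlonglongrightarrow> 0"
      using tends_Yl[OF f] 1 by (intro tendsto_add_zero) (auto simp: tends_def)
  qed
  then have "tends (\<lambda>n. Y n (Y n f)) (Yl (Yl f))" using f Y_in Yl_in by (simp add: tends_def)
  then have "tends (\<lambda>n. Y (Suc n) f) (cs (1/2) (B f + Yl (Yl f)))"
    using tends_cs[OF tends_add[OF tends_const[OF B_in[OF f]]]] by simp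
  moreover have "tends (\<lambda>n. Y (Suc n) f) (Yl f)"
    using tends_Yl[OF f] LIMSEQ_Suc unfolding tends_def by blast
  ultimately show ?thesis using tends_unique by blast
qed

text \<open>The root is 1 - Yl: its square is 1 - 2 Yl + Yl^2, and the fixed point equation says 2
  Yl = B + Yl^2.\<close>

lemma op_sqrt_props:
  assumes A: "\<And>f. f \<in> V \<Longrightarrow> A f = f - B f"
  shows "positive_op V ip (op_sqrt V ip A)" and "\<And>f. f \<in> V \<Longrightarrow> op_sqrt V ip A (op_sqrt V ip A f) = A f"
proof -
  let ?P = "\<lambda>R. positive_op V ip R \<and> (\<forall>f\<in>V. R (R f) = A f) \<and> (\<forall>f. f \<notin> V \<longrightarrow> R f = (\<lambda>z. 0))"
  define R where "R f = (if f \<in> V then f - Yl f else (\<lambda>z. 0))" for f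
  have Rf: "\<And>f. f \<in> V \<Longrightarrow> R f = f - Yl f" by (simp add: R_def)
  have Rin: "\<And>f. f \<in> V \<Longrightarrow> R f \<in> V" using V_diff Yl_in Rf by simp
  have Rlin: "linop R"
    using linop_Yl V_closed Yl_in by (simp add: linop_def Rf cs_diff_right)
  have Rle: "nrm (R f) \<le> 2 * nrm f" if "f \<in> V" for f
    using nrm_triangle_diff[of f "Yl f"] Yl_le that Yl_in Rf by fastforce
  have Rpos: "Im (ip (R f) f) = 0 \<and> 0 \<le> Re (ip (R f) f)" if f: "f \<in> V" for f
  proof -
    have "ip (Yl f) f = cnj (ip (Yl f) f)"
      using Yl_sym[OF f f] ip_commute[OF Yl_in[OF f] f] by simp
    then have "Im (ip (Yl f) f) = 0" by (simp add: complex_eq_iff)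
    moreover have "cmod (ip (Yl f) f) \<le> nrm f * nrm f"
      using Cauchy_Schwarz[OF Yl_in[OF f] f] mult_right_mono[OF Yl_le[OF f] nrm_nonneg[OF f]] by linarith
    then have "Re (ip (Yl f) f) \<le> (nrm f)\<^sup>2"
      using complex_Re_le_cmod[of "ip (Yl f) f"] by (simp add: power2_eq_square)
    ultimately show ?thesis using f Yl_in[OF f]
      by (simp add: Rf ip_simps V_closed ip_self flip: of_real_power)
  qed
  have RR: "R (R f) = A f" if f: "f \<in> V" for f
  proof -
    have "R (R f) = f - Yl f - (Yl f - Yl (Yl f))"
      using f Yl_in[OF f] Rin[OF f] linop_diff[OF linop_Yl f Yl_in[OF f]] by (simp add: Rf V_diff)
    also have "\<dots> = f - (cs 2 (Yl f) - Yl (Yl f))"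
      by (simp add: fun_eq_iff cs_apply)
    also have "cs 2 (Yl f) = B f + Yl (Yl f)"
      using arg_cong[OF Yl_eq[OF f], of "cs 2"] by (simp add: cs_cs cs_one)
    finally show ?thesis using A[OF f] by (simp add: fun_eq_iff)
  qed
  have PR: "?P R"
    using Rlin Rle Rpos RR by (auto simp: positive_op_def bounded_op_iff R_def)
  have "op_sqrt V ip A = R"
    unfolding op_sqrt_def
  proof (rule the_equality[where P = ?P and a = R, OF PR])
    fix Q assume Q: "?P Q"
    then have Qlin: "linop Q" and Qpos: "\<And>f. f \<in> V \<Longrightarrow> Im (ip (Q f) f) = 0 \<and> 0 \<le> Re (ip (Q f) f)"
      and QQ: "\<And>f. f \<in> V \<Longrightarrow> Q (Q f) = A f"
      by (auto simp: positive_op_def bounded_op_iff)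
    obtain C where C: "\<And>f. f \<in> V \<Longrightarrow> nrm (Q f) \<le> C * nrm f"
      using Q by (auto simp: positive_op_def bounded_op_iff)
    have Qin: "\<And>f. f \<in> V \<Longrightarrow> Q f \<in> V" using Qlin by (simp add: linop_def)
    have Bf: "B f = f - A f" if "f \<in> V" for f using A[OF that] by simp
    have BQ: "B (Q f) = Q (B f)" if f: "f \<in> V" for f
    proof -
      have "A f \<in> V" using A[OF f] V_diff B_in f by simp
      then have "Q (B f) = Q f - Q (A f)" using linop_diff[OF Qlin f] Bf[OF f] by simp
      moreover have "Q (A f) = A (Q f)" using QQ[OF f] QQ[OF Qin[OF f]] by simp
      ultimately show ?thesis using Bf[OF Qin[OF f]] by simp
    qed
    have YQ: "\<And>f. f \<in> V \<Longrightarrow> Yl (Q f) = Q (Yl f)" using Yl_commute[OF Qlin C BQ] by blast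
    have RQ: "R (Q f) = Q (R f)" if f: "f \<in> V" for f
      using YQ[OF f] Qin[OF f] f Rf linop_diff[OF Qlin f Yl_in[OF f]] by simp
    have "R f = Q f" if f: "f \<in> V" for f
    proof -
      \<comment> \<open>As \<open>R\<close> and \<open>Q\<close> commute, (R + Q) g = R^2 f - Q^2 f
        = 0. Both forms are nonnegative at \<open>g\<close> and add up to 0, so each vanishes and
        \<open>positive_null\<close> applies to both.\<close>
      define g where "g = R f - Q f"
      have g: "g \<in> V" using f Rin Qin V_diff by (simp add: g_def)
      have Rg: "R g = A f - Q (R f)"
        using linop_diff[OF Rlin Rin[OF f] Qin[OF f]] RR[OF f] RQ[OF f] by (simp add: g_def)
      have Qg: "Q g = Q (R f) - A f"
        using linop_diff[OF Qlin Rin[OF f] Qin[OF f]] QQ[OF f] by (simp add: g_def)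
      have "R g + Q g = 0" unfolding Rg Qg by simp
      then have "ip (R g) g + ip (Q g) g = 0"
        using g Rin Qin by (simp add: ip_add_left[symmetric] ip_simps)
      then have "Re (ip (R g) g) + Re (ip (Q g) g) = 0" by (metis plus_complex.sel(1) zero_complex.sel(1))
      then have "Re (ip (R g) g) = 0" "Re (ip (Q g) g) = 0" using Rpos[OF g] Qpos[OF g] by linarith+
      then have z: "R g = 0" "Q g = 0"
        using positive_null[OF Rlin Rpos g] positive_null[OF Qlin Qpos g] by auto
      have "ip g g = ip (R f) g - ip (Q f) g"
        using f Rin Qin g by (subst (1) g_def) (simp add: ip_simps)
      also have "\<dots> = ip f (R g) - ip f (Q g)"
        using symmetric_if_real[OF Rlin _ f g] symmetric_if_real[OF Qlin _ f g] Rpos Qpos by simp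
      finally have "g = 0" using z g f by (intro ip_definite) (auto simp: ip_simps)
      then show ?thesis by (simp add: g_def)
    qed
    then show "Q = R" using Q by (auto simp: R_def fun_eq_iff)
  qed
  then show "positive_op V ip (op_sqrt V ip A)" "\<And>f. f \<in> V \<Longrightarrow> op_sqrt V ip A (op_sqrt V ip A f) = A f"
    using PR by auto
qed

end

context hilbert
begin

subsection \<open>Uniform boundedness\<close>

text \<open>Sokal's gliding hump: the signs of the steps of length \<open>3\<^sup>-\<^sup>j\<close> are chosen so that the
  \<open>j\<close>-th functional stays large at the limit.\<close>

lemma uniform_boundedness:
  assumes k: "\<And>n::nat. k n \<in> V" and bnd: "\<And>f. f \<in> V \<Longrightarrow> \<exists>M. \<forall>n. cmod (ip f (k n)) \<le> M"
  shows "\<exists>C. \<forall>n. nrm (k n) \<le> C"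
proof (rule ccontr)
  assume "\<not> ?thesis"
  \<comment> \<open>Growth 4^j against steps of length 3^-j: the j-th step alone contributes more
    than (4/3)^j to the j-th pairing.\<close>
  then have "\<forall>j::nat. \<exists>n. nrm (k n) > 4 ^ j" by (metis linorder_not_le)
  then obtain m where m: "\<And>j. nrm (k (m j)) > 4 ^ j" by metis
  define K where "K j = k (m j)" for j
  have KV: "\<And>j. K j \<in> V" and K4: "\<And>j. nrm (K j) > 4 ^ j" using k m by (auto simp: K_def)
  have K0: "nrm (K j) > 0" for j by (rule less_trans[OF _ K4]) simp
  define \<xi> where "\<xi> j = cs (of_real (1 / (3 ^ j * nrm (K j)))) (K j)" for j
  have \<xi>V: "\<And>j. \<xi> j \<in> V" using KV V_cs by (simp add: \<xi>_def)
  have \<xi>n: "nrm (\<xi> j) = 1 / 3 ^ j" for j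
    unfolding \<xi>_def using KV[of j] K0[of j] by (subst nrm_cs) (auto simp: norm_divide norm_mult norm_power)
  have \<xi>K: "ip (\<xi> j) (K j) = of_real (nrm (K j) / 3 ^ j)" for j
    unfolding \<xi>_def using KV[of j] K0[of j]
    by (simp add: ip_cs_left ip_self power2_eq_square field_simps)
  define x where "x = rec_nat 0 (\<lambda>j v. if cmod (ip (v + \<xi> j) (K j)) \<ge> nrm (K j) / 3 ^ j then v + \<xi> j else v - \<xi> j)"
  have x0: "x 0 = 0" by (simp add: x_def)
  have xS: "x (Suc j) = (if cmod (ip (x j + \<xi> j) (K j)) \<ge> nrm (K j) / 3 ^ j then x j + \<xi> j else x j - \<xi> j)" for j
    by (simp add: x_def)
  have xV: "x j \<in> V" for j by (induction j) (auto simp: x0 xS V_closed \<xi>V)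
  have xd: "nrm (x (Suc j) - x j) = 1 / 3 ^ j" for j
    using \<xi>n[of j] nrm_uminus[OF \<xi>V[of j]] by (simp add: xS)
  have xK: "cmod (ip (x (Suc j)) (K j)) \<ge> nrm (K j) / 3 ^ j" for j
  proof (cases "cmod (ip (x j + \<xi> j) (K j)) \<ge> nrm (K j) / 3 ^ j")
    case False
    let ?a = "ip (x j) (K j)" and ?q = "complex_of_real (nrm (K j) / 3 ^ j)"
    \<comment> \<open>The two candidate values differ by twice the required size, so if the plus
      sign gives too little, the minus sign gives enough.\<close>
    have "2 * (nrm (K j) / 3 ^ j) = cmod ((?a + ?q) - (?a - ?q))"
      using K0[of j] by (simp add: norm_mult norm_divide norm_power)
    also have "\<dots> \<le> cmod (?a + ?q) + cmod (?a - ?q)" by (rule norm_triangle_ineq4)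
    finally have "cmod (?a - ?q) \<ge> nrm (K j) / 3 ^ j"
      using False by (simp only: ip_add_left[OF xV \<xi>V KV] \<xi>K)
    then show ?thesis using False by (simp only: xS if_False ip_diff_left[OF xV \<xi>V KV] \<xi>K)
  qed (simp add: xS)
  have xnp: "nrm (x (n + p) - x n) \<le> (3/2) * (1 / 3 ^ n - 1 / 3 ^ (n + p))" for n p
  proof (induction p)
    case (Suc p)
    have "nrm (x (Suc (n + p)) - x n) \<le> nrm (x (Suc (n + p)) - x (n + p)) + nrm (x (n + p) - x n)"
      by (intro nrm_triangle3 xV)
    also have "\<dots> \<le> 1 / 3 ^ (n + p) + (3/2) * (1 / 3 ^ n - 1 / 3 ^ (n + p))"
      by (rule add_mono[OF eq_refl[OF xd] Suc])
    also have "\<dots> = (3/2) * (1 / 3 ^ n - 1 / 3 ^ Suc (n + p))" by (simp add: field_simps)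
    finally show ?case by (simp only: add_Suc_right)
  qed simp
  have "\<exists>l. tends x l"
  proof (rule Cauchy_tends[OF xV])
    fix e :: real assume e: "e > 0"
    obtain N where N: "(1/3 :: real) ^ N < e * (2/3)"
      using e real_arch_pow_inv[of "e * (2/3)" "1/3"] by auto
    have *: "nrm (x i - x j) < e" if "j \<ge> N" "i \<ge> j" for i j
    proof -
      have "nrm (x i - x j) \<le> (3/2) * (1 / 3 ^ j - 1 / 3 ^ i)" using xnp[of j "i - j"] that by simp
      also have "\<dots> \<le> (3/2) * (1/3) ^ j" by (simp add: power_one_over)
      also have "\<dots> \<le> (3/2) * (1/3) ^ N" using that by (intro mult_left_mono power_decreasing) auto
      finally show ?thesis using N by simp
    qed
    have "nrm (x i - x j) < e" if "i \<ge> N" "j \<ge> N" for i j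
      using *[of i j] *[of j i] that nrm_minus_commute[OF xV xV, of i j] by (cases "i \<ge> j") auto
    then show "\<exists>M. \<forall>i\<ge>M. \<forall>j\<ge>M. nrm (x i - x j) < e" by blast
  qed
  then obtain l where l: "tends x l" by blast
  then have lV: "l \<in> V" by (simp add: tends_def)
  have xl: "nrm (x n - l) \<le> (3/2) / 3 ^ n" for n
  proof -
    have "(\<lambda>p. nrm (x n - x (p + n))) \<longlonglongrightarrow> nrm (x n - l)"
    proof -
      have "tends (\<lambda>p. x (p + n)) l"
        using l LIMSEQ_ignore_initial_segment[of "\<lambda>n. nrm (x n - l)" 0 n] by (simp add: tends_def)
      then have "tends (\<lambda>p. x n + cs (-1) (x (p + n))) (x n + cs (-1) l)"
        by (intro tends_add tends_const xV tends_cs)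
      then show ?thesis using tends_nrm by (fastforce simp: cs_minus_one)
    qed
    moreover have "nrm (x n - x (p + n)) \<le> (3/2) / 3 ^ n" for p
    proof -
      have "(3/2) * (1 / 3 ^ n - 1 / 3 ^ (n + p)) \<le> (3/2) / (3 :: real) ^ n" by simp
      then have "nrm (x (n + p) - x n) \<le> (3/2) / 3 ^ n" by (rule order_trans[OF xnp])
      then show ?thesis using nrm_minus_commute[OF xV xV, of n "p + n"] by (simp add: add.commute)
    qed
    ultimately show ?thesis by (meson LIMSEQ_le_const2)
  qed
  have big: "cmod (ip l (K j)) \<ge> (1/2) * (4/3) ^ j" for j
  proof -
    \<comment> \<open>All later steps together have length at most half of 3^-j, so half of the
      value survives at the limit.\<close>
    have "cmod (ip (x (Suc j)) (K j)) - cmod (ip l (K j)) \<le> cmod (ip (x (Suc j) - l) (K j))"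
      using norm_triangle_ineq2 by (simp add: ip_diff_left xV lV KV)
    also have "\<dots> \<le> nrm (x (Suc j) - l) * nrm (K j)" by (intro Cauchy_Schwarz V_diff xV lV KV)
    also have "\<dots> \<le> (3/2) / 3 ^ Suc j * nrm (K j)" by (intro mult_right_mono xl less_imp_le[OF K0])
    also have "\<dots> = (1/2) * (nrm (K j) / 3 ^ j)" by simp
    finally have "(1/2) * (nrm (K j) / 3 ^ j) \<le> cmod (ip l (K j))" using xK[of j] by linarith
    moreover have "(4/3) ^ j \<le> nrm (K j) / 3 ^ j"
      using K4[of j] by (simp add: power_divide divide_right_mono)
    ultimately show ?thesis by linarith
  qed
  obtain M where M: "\<And>n. cmod (ip l (k n)) \<le> M" using bnd[OF lV] by blast
  obtain j where "(4/3 :: real) ^ j > 2 * M" using real_arch_pow[of "4/3" "2*M"] by auto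
  then show False using big[of j] M[of "m j"] unfolding K_def by linarith
qed

end


section \<open>Fourier analysis on circles inside the disc; Szego and Poisson kernels\<close>

section \<open>Integration over the circle\<close>

lemma measurable_cis [measurable]: "cis \<in> borel_measurable borel"
  by (intro borel_measurable_continuous_onI continuous_intros)

lemma measurable_cnj [measurable]: "cnj \<in> borel_measurable borel"
  by (intro borel_measurable_continuous_onI continuous_intros)

lemma space_arc [simp]: "space arc_measure = UNIV"
  and sets_arc [simp, measurable_cong]: "sets arc_measure = sets borel"
  by (simp_all add: arc_measure_def)

lemma emeasure_arc_UNIV: "emeasure arc_measure UNIV = 1"
proof -
  have "emeasure arc_measure UNIV = emeasure (uniform_measure lborel {0..2 * pi}) (cis -` UNIV \<inter> UNIV)"
    unfolding arc_measure_def by (subst emeasure_distr) auto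
  also have "\<dots> = 1" by (simp add: divide_ennreal ennreal_1[symmetric] del: ennreal_1)
  finally show ?thesis .
qed

interpretation arc: finite_measure arc_measure
  by standard (simp add: emeasure_arc_UNIV)

lemma measure_arc_UNIV [simp]: "measure arc_measure UNIV = 1"
  using emeasure_arc_UNIV by (simp add: measure_def)

text \<open>\<open>arc_measure\<close> is a measure on the whole plane carried by the circle, so
  pointwise facts are only ever required there.\<close>

lemma AE_arc: "(\<And>\<zeta>. cmod \<zeta> = 1 \<Longrightarrow> P \<zeta>) \<Longrightarrow> AE \<zeta> in arc_measure. P \<zeta>"
proof -
  assume P: "\<And>\<zeta>. cmod \<zeta> = 1 \<Longrightarrow> P \<zeta>"
  have "AE \<zeta> in arc_measure. cmod \<zeta> = 1"
    unfolding arc_measure_def by (subst AE_distr_iff) auto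
  then show ?thesis by (rule AE_mp) (use P in auto)
qed

lemma AE_arc_norm: "AE \<zeta> in arc_measure. cmod \<zeta> = 1"
  by (rule AE_arc)

lemma integrable_arc_bounded:
  fixes f :: "complex \<Rightarrow> 'b::{banach, second_countable_topology}"
  assumes "f \<in> borel_measurable borel" and "\<And>\<zeta>. cmod \<zeta> = 1 \<Longrightarrow> norm (f \<zeta>) \<le> B"
  shows "integrable arc_measure f"
  using assms by (intro arc.integrable_const_bound[of _ B] AE_arc) auto

lemma integral_arc_cong:
  fixes f :: "complex \<Rightarrow> 'b::{banach, second_countable_topology}"
  assumes "f \<in> borel_measurable borel" "g \<in> borel_measurable borel"
    and "\<And>\<zeta>. cmod \<zeta> = 1 \<Longrightarrow> f \<zeta> = g \<zeta>"
  shows "(LINT \<zeta>|arc_measure. f \<zeta>) = (LINT \<zeta>|arc_measure. g \<zeta>)"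
  using assms by (intro integral_cong_AE AE_arc) auto

lemma integral_arc:
  fixes f :: "complex \<Rightarrow> complex"
  assumes [measurable]: "f \<in> borel_measurable borel"
  shows "(LINT \<zeta>|arc_measure. f \<zeta>) = (1 / (2 * pi)) *\<^sub>R (\<integral>t. indicator {0..2 * pi} t *\<^sub>R f (cis t) \<partial>lborel)"
proof -
  have um: "uniform_measure lborel {0..2 * pi} = density lborel (\<lambda>t. ennreal (indicator {0..2 * pi} t / (2 * pi)))"
    unfolding uniform_measure_def
    by (intro density_cong AE_I2) (auto simp: divide_ennreal[symmetric] split: split_indicator)
  have "(LINT \<zeta>|arc_measure. f \<zeta>) = (\<integral>t. f (cis t) \<partial>uniform_measure lborel {0..2 * pi})"
    unfolding arc_measure_def by (rule integral_distr) auto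
  also have "\<dots> = (\<integral>t. (indicator {0..2 * pi} t / (2 * pi)) *\<^sub>R f (cis t) \<partial>lborel)"
    unfolding um by (rule integral_density) auto
  also have "\<dots> = (\<integral>t. (1 / (2 * pi)) *\<^sub>R (indicator {0..2 * pi} t *\<^sub>R f (cis t)) \<partial>lborel)"
    by (intro Bochner_Integration.integral_cong) auto
  also have "\<dots> = (1 / (2 * pi)) *\<^sub>R (\<integral>t. indicator {0..2 * pi} t *\<^sub>R f (cis t) \<partial>lborel)"
    by (rule integral_scaleR_right)
  finally show ?thesis .
qed

text \<open>Orthonormality of the characters; negative powers are written as powers of
  \<open>cnj\<close>, matching the conjugated second argument of the inner product.\<close>

lemma integral_arc_power:
  fixes m n :: nat
  shows "(LINT \<zeta>|arc_measure. \<zeta> ^ m * cnj \<zeta> ^ n) = (if m = n then 1 else 0)"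
proof -
  define k where "k = real m - real n"
  have cis_eq: "cis t ^ m * cnj (cis t) ^ n = cis (k * t)" for t
    by (simp add: cis_cnj Complex.DeMoivre cis_mult k_def algebra_simps)
  have I: "(LINT \<zeta>|arc_measure. \<zeta> ^ m * cnj \<zeta> ^ n) = (1 / (2 * pi)) *\<^sub>R (\<integral>t. indicator {0..2 * pi} t *\<^sub>R cis (k * t) \<partial>lborel)"
    by (subst integral_arc) (auto simp: cis_eq)
  show ?thesis
  proof (cases "m = n")
    case True
    have "\<zeta> ^ m * cnj \<zeta> ^ n = 1" if "cmod \<zeta> = 1" for \<zeta>
      using that complex_norm_square[of \<zeta>] True by (simp flip: power_mult_distrib)
    then have "(LINT \<zeta>|arc_measure. \<zeta> ^ m * cnj \<zeta> ^ n) = (LINT \<zeta>|arc_measure. 1)"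
      by (intro integral_arc_cong) auto
    then show ?thesis using True by simp
  next
    case False
    then have k: "k \<noteq> 0" by (simp add: k_def)
    have "(\<integral>t. indicator {0..2 * pi} t *\<^sub>R cis (k * t) \<partial>lborel) =
        - \<i> / of_real k * cis (k * (2 * pi)) - - \<i> / of_real k * cis (k * 0)"
    proof (rule integral_FTC_Icc)
      fix t :: real
      have "((\<lambda>t. cis (k * t)) has_vector_derivative k *\<^sub>R (\<i> * cis (k * t))) (at t within {0..2*pi})"
        unfolding cis_conv_exp of_real_mult scaleR_conv_of_real
        by (rule has_vector_derivative_real_field) (auto intro!: derivative_eq_intros)
      then have "((\<lambda>t. - \<i> / of_real k * cis (k * t)) has_vector_derivative
          (- \<i> / of_real k) * (k *\<^sub>R (\<i> * cis (k * t)))) (at t within {0..2*pi})"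
        by (rule has_vector_derivative_mult_right)
      then show "((\<lambda>t. - \<i> / of_real k * cis (k * t)) has_vector_derivative cis (k * t)) (at t within {0..2*pi})"
        using k by (simp add: scaleR_conv_of_real)
    qed (auto intro!: continuous_intros)
    also have "cis (k * (2 * pi)) = 1"
      using cis_multiple_2pi[of "real m - real n"] by (simp add: k_def mult.commute)
    finally show ?thesis using False by (simp add: I)
  qed
qed

section \<open>Functions on the disc\<close>

definition disc_hol :: "cfun \<Rightarrow> bool" where
  "disc_hol f \<longleftrightarrow> f holomorphic_on ball 0 1 \<and> (\<forall>z. z \<notin> ball 0 1 \<longrightarrow> f z = 0)"

definition cut :: "cfun \<Rightarrow> cfun" where
  "cut f = (\<lambda>z. if z \<in> ball 0 1 then f z else 0)"

definition tc :: "cfun \<Rightarrow> nat \<Rightarrow> complex" where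
  "tc f n = (deriv ^^ n) f 0 / fact n"

lemma disc_hol_cut: "f holomorphic_on ball 0 1 \<Longrightarrow> disc_hol (cut f)"
  unfolding disc_hol_def cut_def by (auto elim!: holomorphic_transform)

lemma disc_hol_eqI:
  assumes "disc_hol f" "disc_hol g" "\<And>z. cmod z < 1 \<Longrightarrow> f z = g z"
  shows "f = g"
  using assms unfolding disc_hol_def fun_eq_iff by (metis mem_ball_0)

lemma disc_hol_measurable [measurable_dest]: "disc_hol f \<Longrightarrow> f \<in> borel_measurable borel"
proof -
  assume f: "disc_hol f"
  have "(\<lambda>z. indicator (ball 0 1) z *\<^sub>R f z) \<in> borel_measurable borel"
    using f by (intro borel_measurable_continuous_on_indicator)
      (auto simp: disc_hol_def intro: holomorphic_on_imp_continuous_on)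
  also have "(\<lambda>z. indicator (ball 0 1) z *\<^sub>R f z) = f"
    using f by (auto simp: disc_hol_def fun_eq_iff split: split_indicator)
  finally show ?thesis .
qed

lemma disc_hol_dilate_measurable [measurable]:
  "disc_hol f \<Longrightarrow> (\<lambda>\<zeta>. f (of_real r * \<zeta>)) \<in> borel_measurable borel"
  using measurable_compose[OF _ disc_hol_measurable, of "\<lambda>\<zeta>. of_real r * \<zeta>" borel f] by simp

lemma tc_sums: "disc_hol f \<Longrightarrow> cmod z < 1 \<Longrightarrow> (\<lambda>n. tc f n * z ^ n) sums f z"
  using holomorphic_power_series[of f 0 1 z] by (simp add: disc_hol_def tc_def)

lemma tc_summable:
  assumes f: "disc_hol f" and r: "0 \<le> r" "r < 1"
  shows "summable (\<lambda>n. cmod (tc f n) * r ^ n)"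
proof -
  obtain s where s: "r < s" "s < 1" using r dense by blast
  have "summable (\<lambda>n. tc f n * of_real s ^ n)"
    using tc_sums[OF f, of "of_real s"] s r by (auto intro: sums_summable)
  then have "summable (\<lambda>n. norm (tc f n * of_real r ^ n))"
    by (rule powser_insidea) (use s r in auto)
  then show ?thesis using r by (simp add: norm_mult norm_power)
qed

lemma disc_hol_circle_bounded:
  assumes f: "disc_hol f" and r: "0 \<le> r" "r < 1"
  shows "\<exists>B\<ge>0. \<forall>\<zeta>. cmod \<zeta> = 1 \<longrightarrow> cmod (f (of_real r * \<zeta>)) \<le> B"
proof -
  have "cmod (f (of_real r * \<zeta>)) \<le> (\<Sum>n. cmod (tc f n) * r ^ n)" if "cmod \<zeta> = 1" for \<zeta>
  proof -
    have z: "cmod (of_real r * \<zeta>) < 1" using that r by (simp add: norm_mult)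
    have eq: "norm (tc f n * (of_real r * \<zeta>) ^ n) = cmod (tc f n) * r ^ n" for n
      using that r by (simp add: norm_mult norm_power)
    have "norm (\<Sum>n. tc f n * (of_real r * \<zeta>) ^ n) \<le> (\<Sum>n. norm (tc f n * (of_real r * \<zeta>) ^ n))"
      by (rule summable_norm) (simp only: eq, rule tc_summable[OF f r])
    then show ?thesis by (simp only: eq sums_unique[OF tc_sums[OF f z], symmetric])
  qed
  moreover have "0 \<le> (\<Sum>n. cmod (tc f n) * r ^ n)"
    using r by (intro suminf_nonneg tc_summable[OF f r]) auto
  ultimately show ?thesis by blast
qed

text \<open>On a circle inside the disc the Taylor series has a summable majorant, so it may be
  integrated term by term against a bounded \<open>h\<close>.\<close>

lemma integral_circle_series:
  assumes f: "disc_hol f" and r: "0 \<le> r" "r < 1"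
    and [measurable]: "h \<in> borel_measurable borel" and B: "\<And>\<zeta>. cmod \<zeta> = 1 \<Longrightarrow> cmod (h \<zeta>) \<le> B"
  shows "(\<lambda>n. tc f n * of_real r ^ n * (LINT \<zeta>|arc_measure. \<zeta> ^ n * h \<zeta>)) sums
      (LINT \<zeta>|arc_measure. f (of_real r * \<zeta>) * h \<zeta>)"
proof -
  have B0: "0 \<le> B" using order_trans[OF norm_ge_zero B[of 1]] by simp
  let ?u = "\<lambda>n \<zeta>. tc f n * of_real r ^ n * (\<zeta> ^ n * h \<zeta>)"
  have bnd: "norm (?u n \<zeta>) \<le> cmod (tc f n) * r ^ n * B" if "cmod \<zeta> = 1" for n \<zeta>
    using B[OF that] that r by (simp add: norm_mult norm_power mult_left_mono)
  have S: "summable (\<lambda>n. cmod (tc f n) * r ^ n * B)"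
    by (rule summable_mult2) (rule tc_summable[OF f r])
  have int: "integrable arc_measure (?u n)" for n
    by (rule integrable_arc_bounded[where B = "cmod (tc f n) * r ^ n * B"]) (use bnd in auto)
  have *: "(\<lambda>n. LINT \<zeta>|arc_measure. ?u n \<zeta>) sums (LINT \<zeta>|arc_measure. (\<Sum>n. ?u n \<zeta>))"
  proof (rule sums_integral[OF int])
    show "AE \<zeta> in arc_measure. summable (\<lambda>n. norm (?u n \<zeta>))"
      by (rule AE_arc, rule summable_comparison_test_ev[OF _ S]) (use bnd in auto)
    show "summable (\<lambda>n. LINT \<zeta>|arc_measure. norm (?u n \<zeta>))"
    proof (rule summable_comparison_test_ev[OF _ S], intro always_eventually allI)
      fix n
      have "(LINT \<zeta>|arc_measure. norm (?u n \<zeta>)) \<le> (LINT \<zeta>|arc_measure. cmod (tc f n) * r ^ n * B)"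
        by (intro integral_mono_AE AE_arc integrable_norm int) (use bnd in auto)
      then show "norm (LINT \<zeta>|arc_measure. norm (?u n \<zeta>)) \<le> cmod (tc f n) * r ^ n * B"
        by simp
    qed
  qed
  have sm: "(\<Sum>n. ?u n \<zeta>) = f (of_real r * \<zeta>) * h \<zeta>" if "cmod \<zeta> = 1" for \<zeta>
  proof -
    have z: "cmod (of_real r * \<zeta>) < 1" using that r by (simp add: norm_mult)
    have "(\<lambda>n. tc f n * (of_real r * \<zeta>) ^ n * h \<zeta>) sums (f (of_real r * \<zeta>) * h \<zeta>)"
      by (rule sums_mult2[OF tc_sums[OF f z]])
    then show ?thesis by (simp add: power_mult_distrib mult_ac sums_iff)
  qed
  have "(LINT \<zeta>|arc_measure. (\<Sum>n. ?u n \<zeta>)) = (LINT \<zeta>|arc_measure. f (of_real r * \<zeta>) * h \<zeta>)"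
    using f sm by (intro integral_arc_cong) (auto intro!: borel_measurable_suminf)
  moreover have "(LINT \<zeta>|arc_measure. ?u n \<zeta>) = tc f n * of_real r ^ n * (LINT \<zeta>|arc_measure. \<zeta> ^ n * h \<zeta>)" for n
    by simp
  ultimately show ?thesis using * by simp
qed

lemma circle_coefficient:
  assumes g: "disc_hol g" and s: "0 \<le> s" "s < 1"
  shows "(LINT \<zeta>|arc_measure. g (of_real s * \<zeta>) * cnj \<zeta> ^ n) = tc g n * of_real s ^ n"
proof -
  have "(\<lambda>m. tc g m * of_real s ^ m * (if m = n then 1 else 0)) sums (LINT \<zeta>|arc_measure. g (of_real s * \<zeta>) * cnj \<zeta> ^ n)"
    using integral_circle_series[OF g s, of "\<lambda>\<zeta>. cnj \<zeta> ^ n" 1]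
    by (simp only: integral_arc_power) (simp add: norm_power)
  moreover have "(\<lambda>m. tc g m * of_real s ^ m * (if m = n then 1 else 0)) = (\<lambda>m. if m = n then tc g m * of_real s ^ m else 0)"
    by auto
  ultimately have "(\<lambda>m. if m = n then tc g m * of_real s ^ m else 0) sums (LINT \<zeta>|arc_measure. g (of_real s * \<zeta>) * cnj \<zeta> ^ n)"
    by (simp only:)
  from sums_unique2[OF this sums_single[of n "\<lambda>m. tc g m * of_real s ^ m"]] show ?thesis .
qed

lemma circle_coefficient':
  assumes g: "disc_hol g" and s: "0 \<le> s" "s < 1"
  shows "(LINT \<zeta>|arc_measure. g (of_real s * \<zeta>) * \<zeta> ^ n) = (if n = 0 then g 0 else 0)"
proof -
  have eq: "(LINT \<zeta>|arc_measure. \<zeta> ^ m * \<zeta> ^ n) = (if m = 0 \<and> n = 0 then 1 else 0)" for m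
    using integral_arc_power[of "m + n" 0] by (simp add: power_add)
  have "(\<lambda>m. tc g m * of_real s ^ m * (if m = 0 \<and> n = 0 then 1 else 0)) sums (LINT \<zeta>|arc_measure. g (of_real s * \<zeta>) * \<zeta> ^ n)"
    using integral_circle_series[OF g s, of "\<lambda>\<zeta>. \<zeta> ^ n" 1] by (simp only: eq) (simp add: norm_power)
  moreover have "(\<lambda>m. tc g m * of_real s ^ m * (if m = 0 \<and> n = 0 then 1 else 0)) =
      (\<lambda>m. if m = 0 then (if n = 0 then tc g 0 else 0) else 0)"
    by auto
  ultimately have "(\<lambda>m. if m = 0 then (if n = 0 then tc g 0 else 0) else 0) sums (LINT \<zeta>|arc_measure. g (of_real s * \<zeta>) * \<zeta> ^ n)"
    by (simp only:)
  from sums_unique2[OF this sums_single[of 0 "\<lambda>m. if n = 0 then tc g 0 else 0"]]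
  have "(LINT \<zeta>|arc_measure. g (of_real s * \<zeta>) * \<zeta> ^ n) = (if n = 0 then tc g 0 else 0)" .
  then show ?thesis by (simp add: tc_def)
qed

text \<open>Two radii are allowed because the Poisson formula pairs \<open>f\<close> and a Szego
  kernel on different circles.\<close>

lemma circle_parseval:
  assumes f: "disc_hol f" and g: "disc_hol g" and r: "0 \<le> r" "r < 1" and s: "0 \<le> s" "s < 1"
  shows "(\<lambda>n. tc f n * cnj (tc g n) * of_real (r * s) ^ n) sums
      (LINT \<zeta>|arc_measure. f (of_real r * \<zeta>) * cnj (g (of_real s * \<zeta>)))"
proof -
  obtain B where B: "\<And>\<zeta>. cmod \<zeta> = 1 \<Longrightarrow> cmod (g (of_real s * \<zeta>)) \<le> B"
    using disc_hol_circle_bounded[OF g s] by blast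
  have gm [measurable]: "(\<lambda>\<zeta>. g (of_real s * \<zeta>)) \<in> borel_measurable borel" using g by simp
  have eq: "(LINT \<zeta>|arc_measure. \<zeta> ^ n * cnj (g (of_real s * \<zeta>))) = cnj (tc g n) * of_real s ^ n" for n
  proof -
    have "(LINT \<zeta>|arc_measure. \<zeta> ^ n * cnj (g (of_real s * \<zeta>))) =
        cnj (LINT \<zeta>|arc_measure. g (of_real s * \<zeta>) * cnj \<zeta> ^ n)"
      by (subst Bochner_Integration.integral_cnj[symmetric]) (simp add: mult.commute)
    then show ?thesis by (simp add: circle_coefficient[OF g s])
  qed
  have "(\<lambda>n. tc f n * of_real r ^ n * (LINT \<zeta>|arc_measure. \<zeta> ^ n * cnj (g (of_real s * \<zeta>)))) sums
      (LINT \<zeta>|arc_measure. f (of_real r * \<zeta>) * cnj (g (of_real s * \<zeta>)))"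
    by (rule integral_circle_series[OF f r]) (use B in auto)
  then show ?thesis unfolding eq by (simp add: power_mult_distrib mult_ac)
qed

text \<open>Without conjugation all exponents are nonnegative, so only the constant terms
  survive.\<close>

lemma circle_product_mean:
  assumes f: "disc_hol f" and g: "disc_hol g" and r: "0 \<le> r" "r < 1" and s: "0 \<le> s" "s < 1"
  shows "(LINT \<zeta>|arc_measure. f (of_real r * \<zeta>) * g (of_real s * \<zeta>)) = f 0 * g 0"
proof -
  obtain B where B: "\<And>\<zeta>. cmod \<zeta> = 1 \<Longrightarrow> cmod (g (of_real s * \<zeta>)) \<le> B"
    using disc_hol_circle_bounded[OF g s] by blast
  have gm [measurable]: "(\<lambda>\<zeta>. g (of_real s * \<zeta>)) \<in> borel_measurable borel" using g by simp
  have "(\<lambda>n. tc f n * of_real r ^ n * (LINT \<zeta>|arc_measure. \<zeta> ^ n * g (of_real s * \<zeta>))) sums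
      (LINT \<zeta>|arc_measure. f (of_real r * \<zeta>) * g (of_real s * \<zeta>))"
    by (rule integral_circle_series[OF f r]) (use B in auto)
  moreover have "(\<lambda>n. tc f n * of_real r ^ n * (LINT \<zeta>|arc_measure. \<zeta> ^ n * g (of_real s * \<zeta>))) =
      (\<lambda>n. if n = 0 then tc f 0 * g 0 else 0)"
    using circle_coefficient'[OF g s] by (auto simp: mult.commute fun_eq_iff)
  ultimately have "(\<lambda>n. if n = 0 then tc f 0 * g 0 else 0) sums (LINT \<zeta>|arc_measure. f (of_real r * \<zeta>) * g (of_real s * \<zeta>))"
    by (simp only:)
  from sums_unique2[OF this sums_single[of 0 "\<lambda>m. tc f 0 * g 0"]]
  have "(LINT \<zeta>|arc_measure. f (of_real r * \<zeta>) * g (of_real s * \<zeta>)) = tc f 0 * g 0" .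
  then show ?thesis by (simp add: tc_def)
qed

subsection \<open>Szego and Poisson kernels\<close>

definition szego :: "complex \<Rightarrow> cfun" where
  "szego w = (\<lambda>z. if z \<in> ball 0 1 then 1 / (1 - cnj w * z) else 0)"

lemma one_minus_ne: "cmod w \<le> 1 \<Longrightarrow> cmod z < 1 \<Longrightarrow> 1 - cnj w * z \<noteq> 0"
proof
  assume *: "cmod w \<le> 1" "cmod z < 1" "1 - cnj w * z = 0"
  then have "cmod (cnj w * z) = 1" by simp
  then have "cmod w * cmod z = 1" by (simp add: norm_mult)
  then show False using * mult_right_le_one_le[of "cmod z" "cmod w"]
    by (simp add: mult.commute)
qed

lemma szego_disc_hol: "cmod w \<le> 1 \<Longrightarrow> disc_hol (szego w)"
proof -
  assume w: "cmod w \<le> 1"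
  have "(\<lambda>z. 1 / (1 - cnj w * z)) holomorphic_on ball 0 1"
    by (intro holomorphic_intros) (use one_minus_ne[OF w] in auto)
  then show ?thesis using disc_hol_cut[of "\<lambda>z. 1 / (1 - cnj w * z)"] by (simp add: cut_def szego_def)
qed

text \<open>Taylor coefficients are computed throughout by exhibiting a power series, not by
  differentiating.\<close>

lemma tc_unique:
  assumes f: "disc_hol f" and a: "\<And>z. cmod z < 1 \<Longrightarrow> (\<lambda>n. a n * z ^ n) sums f z"
  shows "tc f n = a n"
proof -
  have "(deriv ^^ n) f 0 = fact n * a n"
  proof -
    have "f has_fps_expansion Abs_fps a"
    proof (rule has_fps_expansionI)
      have "eventually (\<lambda>z. z \<in> ball 0 1) (nhds (0 :: complex))"
        by (intro eventually_nhds_in_open) auto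
      then show "\<forall>\<^sub>F u in nhds 0. (\<lambda>n. fps_nth (Abs_fps a) n * u ^ n) sums f u"
        by eventually_elim (use a in auto)
    qed
    from fps_nth_fps_expansion[OF this, of n] show ?thesis by simp
  qed
  then show ?thesis by (simp add: tc_def)
qed

lemma tc_szego: "cmod w \<le> 1 \<Longrightarrow> tc (szego w) n = cnj w ^ n"
proof (rule tc_unique)
  fix z assume w: "cmod w \<le> 1" and z: "cmod z < 1"
  have "cmod (cnj w * z) < 1"
    using w z mult_left_le_one_le[of "cmod z" "cmod w"] by (simp add: norm_mult)
  from geometric_sums[OF this] show "(\<lambda>n. cnj w ^ n * z ^ n) sums szego w z"
    using z by (simp add: szego_def power_mult_distrib)
qed (rule szego_disc_hol)

text \<open>The Poisson kernel, written through the Szego kernel; \<open>poisson_eq\<close> gives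
  the classical quotient. It is cut to 0 off the circle so that its bounds hold for all arguments,
  as the locale \<open>maximal_kernel\<close> demands.\<close>

definition poisson :: "real \<Rightarrow> complex \<Rightarrow> complex \<Rightarrow> real" where
  "poisson r x y = (if cmod x = 1 \<and> cmod y = 1 then 2 * Re (1 / (1 - of_real r * (cnj x * y))) - 1 else 0)"

lemma poisson_szego:
  assumes "cmod x = 1" "cmod y = 1" "0 \<le> r" "r < 1"
  shows "complex_of_real (poisson r x y) = szego x (of_real r * y) + cnj (szego x (of_real r * y)) - 1"
proof -
  have "szego x (of_real r * y) = 1 / (1 - of_real r * (cnj x * y))"
    using assms by (simp add: szego_def norm_mult mult_ac)
  then show ?thesis using assms by (simp add: poisson_def complex_eq_iff)
qed

lemma poisson_sym: "poisson r x y = poisson r y x"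
proof -
  have "cnj (1 / (1 - of_real r * (cnj x * y))) = 1 / (1 - of_real r * (cnj y * x))" by (simp add: mult.commute)
  then have "Re (1 / (1 - of_real r * (cnj x * y))) = Re (1 / (1 - of_real r * (cnj y * x)))"
    by (metis cnj.sel(1))
  then show ?thesis by (simp add: poisson_def conj_commute)
qed

lemma poisson_eq:
  assumes "cmod x = 1" "cmod y = 1" "0 \<le> r" "r < 1"
  shows "poisson r x y = (1 - r\<^sup>2) / (cmod (1 - of_real r * (cnj x * y)))\<^sup>2"
proof -
  define w where "w = of_real r * (cnj x * y)"
  have w: "cmod w = r" using assms by (simp add: w_def norm_mult)
  have ne: "1 - w \<noteq> 0" using w assms(4) by auto
  have "Re (1 / (1 - w)) = Re (1 - w) / (cmod (1 - w))\<^sup>2"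
    by (simp add: Re_divide cmod_power2)
  then have "poisson r x y = (2 * Re (1 - w) - (cmod (1 - w))\<^sup>2) / (cmod (1 - w))\<^sup>2"
    using assms ne by (simp add: poisson_def w_def[symmetric] diff_divide_distrib)
  also have "2 * Re (1 - w) - (cmod (1 - w))\<^sup>2 = 1 - (cmod w)\<^sup>2"
    unfolding cmod_power2 by (simp add: power2_eq_square algebra_simps)
  finally show ?thesis unfolding w by (simp only: w_def)
qed

lemma poisson_nonneg: "0 \<le> r \<Longrightarrow> r < 1 \<Longrightarrow> 0 \<le> poisson r x y"
proof (cases "cmod x = 1 \<and> cmod y = 1")
  case True
  assume r: "0 \<le> r" "r < 1"
  then have "r\<^sup>2 \<le> 1" by (simp add: power_le_one)
  then show ?thesis using True r by (simp add: poisson_eq)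
next
  case False
  then show ?thesis by (auto simp: poisson_def)
qed

lemma poisson_le:
  assumes r: "0 \<le> r" "r \<le> r0" "r0 < 1"
  shows "poisson r x y \<le> 1 / (1 - r0)\<^sup>2"
proof (cases "cmod x = 1 \<and> cmod y = 1")
  case True
  have "1 - r0 \<le> cmod (1 - of_real r * (cnj x * y))"
    using norm_triangle_ineq2[of 1 "of_real r * (cnj x * y)"] True r by (simp add: norm_mult)
  then have "(1 - r0)\<^sup>2 \<le> (cmod (1 - of_real r * (cnj x * y)))\<^sup>2" using r by (intro power_mono) auto
  then have "(1 - r\<^sup>2) / (cmod (1 - of_real r * (cnj x * y)))\<^sup>2 \<le> 1 / (1 - r0)\<^sup>2"
    using r by (intro frac_le) auto
  then show ?thesis using poisson_eq[of x y r] True r by simp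
next
  case False
  then show ?thesis by (auto simp: poisson_def)
qed

text \<open>Put p = r s, so p >= r^2. The numerator 1 - p^2 is at most 1 - r^4 <= 2 (1 - r^2), and
  |1 - r c| <= 2 |1 - p c| for |c| = 1 costs a factor 4; together 8.\<close>

lemma poisson_comparison_le:
  assumes xy: "cmod x = 1" "cmod y = 1" and r: "0 \<le> r" "r \<le> s" "s < 1"
  shows "poisson (r * s) x y \<le> 8 * poisson r x y"
proof -
  define p where "p = r * s"
  have rs: "r * r \<le> r * s" "r * s \<le> r * 1" using r mult_left_mono[of s 1 r] mult_left_mono[of r s r] by simp_all
  have p: "r\<^sup>2 \<le> p" "p \<le> r" "0 \<le> p" "p < 1"
    using r rs by (auto simp: p_def power2_eq_square intro: le_less_trans)
  let ?c = "cnj x * y"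
  have c1: "cmod ?c = 1" using xy by (simp add: norm_mult)
  have pos: "0 < cmod (1 - of_real p * ?c)" "0 < cmod (1 - of_real r * ?c)"
    using norm_triangle_ineq2[of 1 "of_real p * ?c"] norm_triangle_ineq2[of 1 "of_real r * ?c"] c1 p r
    by (auto simp: norm_mult)
  have "cmod (1 - of_real r * ?c) = cmod ((1 - of_real p * ?c) - of_real (r - p) * ?c)"
    by (simp add: algebra_simps)
  also have "\<dots> \<le> cmod (1 - of_real p * ?c) + cmod (of_real (r - p) * ?c)" by (rule norm_triangle_ineq4)
  also have "cmod (of_real (r - p) * ?c) = r - p" using p c1 by (simp only: norm_mult norm_of_real) simp
  also have "r - p \<le> 1 - p" using r by simp
  also have "1 - p \<le> cmod (1 - of_real p * ?c)"
    using norm_triangle_ineq2[of 1 "of_real p * ?c"] c1 p by (simp add: norm_mult)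
  finally have "cmod (1 - of_real r * ?c) \<le> 2 * cmod (1 - of_real p * ?c)" by simp
  then have d: "(cmod (1 - of_real r * ?c))\<^sup>2 \<le> 4 * (cmod (1 - of_real p * ?c))\<^sup>2"
    using power_mono[of "cmod (1 - of_real r * ?c)" "2 * cmod (1 - of_real p * ?c)" 2] by (simp add: power_mult_distrib)
  have "p\<^sup>2 \<ge> (r\<^sup>2)\<^sup>2" using p by (intro power_mono) auto
  then have n: "1 - p\<^sup>2 \<le> (1 - r\<^sup>2) * (1 + r\<^sup>2)" by (simp add: algebra_simps power2_eq_square)
  also have "\<dots> \<le> (1 - r\<^sup>2) * 2" using r by (intro mult_left_mono) (auto simp: power_le_one)
  finally have n: "1 - p\<^sup>2 \<le> 2 * (1 - r\<^sup>2)" by simp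
  have "poisson p x y = (1 - p\<^sup>2) / (cmod (1 - of_real p * ?c))\<^sup>2"
    using poisson_eq[OF xy] p by simp
  also have "\<dots> \<le> (2 * (1 - r\<^sup>2)) / ((cmod (1 - of_real r * ?c))\<^sup>2 / 4)"
    using n d pos r by (intro frac_le) (auto simp: power_le_one)
  also have "\<dots> = 8 * poisson r x y"
    using poisson_eq[OF xy] r by simp
  finally show ?thesis by (simp add: p_def)
qed

text \<open>Together with the semigroup law this becomes the hypothesis \<open>p_comp\<close> of the
  maximal inequality, with constant 8.\<close>

lemma poisson_comparison:
  assumes "0 \<le> r" "r < 1" "0 \<le> s" "s < 1"
  shows "poisson (r * s) x y \<le> 8 * (poisson r x y + poisson s x y)"
proof (cases "cmod x = 1 \<and> cmod y = 1")
  case True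
  show ?thesis
  proof (cases "r \<le> s")
    case le: True
    then show ?thesis
      using poisson_comparison_le[of x y r s] poisson_nonneg[of s x y] True assms by simp
  next
    case False
    then show ?thesis
      using poisson_comparison_le[of x y s r] poisson_nonneg[of r x y] True assms by (simp add: mult.commute)
  qed
next
  case False
  then show ?thesis by (auto simp: poisson_def)
qed

lemma poisson_measurable [measurable]: "poisson r x \<in> borel_measurable borel"
  unfolding poisson_def by measurable

text \<open>Splitting the kernel as g + cnj g - 1 with a Szego kernel \<open>g\<close> gives three
  means: f 0, f (r s x) and - f 0.\<close>

lemma poisson_integral_szego:
  assumes x: "cmod x = 1" and r: "0 \<le> r" "r < 1" and f: "disc_hol f" and s: "0 \<le> s" "s < 1"
  shows "(LINT y|arc_measure. of_real (poisson r x y) * f (of_real s * y)) = f (of_real (r * s) * x)"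
proof -
  let ?g = "\<lambda>y. szego x (of_real r * y)" and ?f = "\<lambda>y. f (of_real s * y)"
  have sx: "disc_hol (szego x)" using x by (intro szego_disc_hol) simp
  obtain B where B: "0 \<le> B" "\<And>\<zeta>. cmod \<zeta> = 1 \<Longrightarrow> cmod (?f \<zeta>) \<le> B"
    using disc_hol_circle_bounded[OF f s] by blast
  obtain G where G: "0 \<le> G" "\<And>\<zeta>. cmod \<zeta> = 1 \<Longrightarrow> cmod (?g \<zeta>) \<le> G"
    using disc_hol_circle_bounded[OF sx r] by blast
  have [measurable]: "?f \<in> borel_measurable borel" "?g \<in> borel_measurable borel" using f sx by simp_all
  have i1: "integrable arc_measure (\<lambda>y. ?f y * ?g y)" and i2: "integrable arc_measure (\<lambda>y. ?f y * cnj (?g y))"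
    by (intro integrable_arc_bounded[where B = "B * G"]; use B G in \<open>auto simp: norm_mult intro!: mult_mono\<close>)+
  have i3: "integrable arc_measure ?f"
    by (rule integrable_arc_bounded[where B = B]) (use B in auto)
  have "(LINT y|arc_measure. of_real (poisson r x y) * ?f y) = (LINT y|arc_measure. ?f y * ?g y + ?f y * cnj (?g y) - ?f y)"
  proof (rule integral_arc_cong)
    show "of_real (poisson r x y) * ?f y = ?f y * ?g y + ?f y * cnj (?g y) - ?f y" if "cmod y = 1" for y
      unfolding poisson_szego[OF x that r] by (simp add: algebra_simps)
  qed measurable
  also have "\<dots> = (LINT y|arc_measure. ?f y * ?g y) + (LINT y|arc_measure. ?f y * cnj (?g y)) - (LINT y|arc_measure. ?f y)"
    using i1 i2 i3 by simp
  also have "(LINT y|arc_measure. ?f y * ?g y) = f 0"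
    using circle_product_mean[OF f sx s r] by (simp add: szego_def)
  also have "(LINT y|arc_measure. ?f y) = f 0"
    using circle_coefficient'[OF f s, of 0] by simp
  also have "(LINT y|arc_measure. ?f y * cnj (?g y)) = f (of_real (r * s) * x)"
  proof -
    have "(\<lambda>n. tc f n * (of_real (r * s) * x) ^ n) sums f (of_real (r * s) * x)"
      using x r s mult_left_le_one_le[of s r] by (intro tc_sums[OF f]) (auto simp: norm_mult)
    moreover have "(\<lambda>n. tc f n * cnj (tc (szego x) n) * of_real (s * r) ^ n) = (\<lambda>n. tc f n * (of_real (r * s) * x) ^ n)"
      using x by (simp add: tc_szego power_mult_distrib mult_ac)
    ultimately show ?thesis using circle_parseval[OF f sx s r] sums_unique2 by metis
  qed
  finally show ?thesis by simp
qed

text \<open>The preceding formula is applied to the Szego kernel at \<open>y\<close>; adding the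
  conjugate and subtracting 1 rebuilds the Poisson kernel.\<close>

lemma poisson_semigroup:
  assumes r: "0 \<le> r" "r < 1" and s: "0 \<le> s" "s < 1"
  shows "(LINT z|arc_measure. poisson r x z * poisson s y z) = poisson (r * s) x y"
proof (cases "cmod x = 1 \<and> cmod y = 1")
  case True
  then have x: "cmod x = 1" and y: "cmod y = 1" by auto
  let ?g = "\<lambda>z. szego y (of_real s * z)"
  have sy: "disc_hol (szego y)" using y by (intro szego_disc_hol) simp
  obtain G where G: "0 \<le> G" "\<And>\<zeta>. cmod \<zeta> = 1 \<Longrightarrow> cmod (?g \<zeta>) \<le> G"
    using disc_hol_circle_bounded[OF sy s] by blast
  have [measurable]: "?g \<in> borel_measurable borel" using sy by simp
  have P: "\<bar>poisson r x z\<bar> \<le> 1 / (1 - r)\<^sup>2" for z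
    using poisson_le[of r r x z] poisson_nonneg[of r x z] r by simp
  let ?h = "\<lambda>z. of_real (poisson r x z) * ?g z"
  have h: "cmod (?h z) \<le> 1 / (1 - r)\<^sup>2 * G" if "cmod z = 1" for z
    unfolding norm_mult norm_of_real using P G that by (intro mult_mono) auto
  have i1: "integrable arc_measure ?h"
    by (rule integrable_arc_bounded[OF _ h]) measurable
  have i2: "integrable arc_measure (\<lambda>z. cnj (?h z))"
    by (rule integrable_arc_bounded[where B = "1 / (1 - r)\<^sup>2 * G"])
      (measurable, simp only: complex_mod_cnj h)
  have i3: "integrable arc_measure (\<lambda>z. complex_of_real (poisson r x z))"
    by (rule integrable_arc_bounded[where B = "1 / (1 - r)\<^sup>2"]) (use P in auto)
  have H: "(LINT z|arc_measure. ?h z) = szego y (of_real (r * s) * x)"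
    by (rule poisson_integral_szego[OF x r sy s])
  have one: "(LINT z|arc_measure. complex_of_real (poisson r x z)) = 1"
    using poisson_integral_szego[OF x r szego_disc_hol[of 0], of 0] by (simp add: szego_def)
  have rs: "0 \<le> r * s" "r * s < 1" using r s mult_left_le_one_le[of s r] by auto
  have "complex_of_real (LINT z|arc_measure. poisson r x z * poisson s y z) =
      (LINT z|arc_measure. complex_of_real (poisson r x z * poisson s y z))"
    by (rule integral_complex_of_real[symmetric])
  also have "\<dots> = (LINT z|arc_measure. ?h z + cnj (?h z) - complex_of_real (poisson r x z))"
  proof (rule integral_arc_cong)
    show "complex_of_real (poisson r x z * poisson s y z) = ?h z + cnj (?h z) - complex_of_real (poisson r x z)"
      if "cmod z = 1" for z
      unfolding of_real_mult poisson_szego[OF y that s] by (simp add: algebra_simps)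
  qed measurable
  also have "\<dots> = (LINT z|arc_measure. ?h z) + (LINT z|arc_measure. cnj (?h z)) - (LINT z|arc_measure. complex_of_real (poisson r x z))"
    using i1 i2 i3 by simp
  also have "(LINT z|arc_measure. cnj (?h z)) = cnj (LINT z|arc_measure. ?h z)"
    by (rule Bochner_Integration.integral_cnj)
  finally have "complex_of_real (LINT z|arc_measure. poisson r x z * poisson s y z) = complex_of_real (poisson (r * s) y x)"
    unfolding H one poisson_szego[OF y x rs] .
  then show ?thesis using poisson_sym by (simp only: of_real_eq_iff)
next
  case False
  then have "poisson r x z * poisson s y z = 0" for z by (auto simp: poisson_def)
  then show ?thesis using False by (auto simp: poisson_def)
qed


section \<open>An L^2 bound for radial maximal functions\<close>

section \<open>The radial maximal inequality\<close>

text \<open>The choice t = b/c gives the claim; for c = 0 the expression is affine in t, which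
  forces b = 0.\<close>

lemma discriminant_le:
  fixes a b c :: real
  assumes "\<And>t. 0 \<le> a - 2 * t * b + t\<^sup>2 * c" and "0 \<le> c"
  shows "b\<^sup>2 \<le> a * c"
proof (cases "c = 0")
  case True
  have "b = 0"
  proof (rule ccontr)
    assume "b \<noteq> 0"
    then show False using assms(1)[of "(a + 1) / (2 * b)"] True by simp
  qed
  then show ?thesis using True by simp
next
  case False
  then have c: "c > 0" using assms by simp
  have "0 \<le> a - 2 * (b / c) * b + (b / c)\<^sup>2 * c" by (rule assms(1))
  also have "\<dots> = a - b\<^sup>2 / c" using c by (simp add: power2_eq_square field_simps)
  finally show ?thesis using c by (simp add: field_simps)
qed

lemma integral_Cauchy_Schwarz:
  fixes f g :: "'a \<Rightarrow> real"
  assumes "integrable M (\<lambda>x. (f x)\<^sup>2)" "integrable M (\<lambda>x. (g x)\<^sup>2)" "integrable M (\<lambda>x. f x * g x)"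
  shows "(LINT x|M. f x * g x)\<^sup>2 \<le> (LINT x|M. (f x)\<^sup>2) * (LINT x|M. (g x)\<^sup>2)"
proof (rule discriminant_le)
  fix t :: real
  have "0 \<le> (LINT x|M. (f x - t * g x)\<^sup>2)" by (rule integral_nonneg_AE) auto
  also have "(LINT x|M. (f x - t * g x)\<^sup>2) = (LINT x|M. (f x)\<^sup>2 - 2 * t * (f x * g x) + t\<^sup>2 * (g x)\<^sup>2)"
    by (intro Bochner_Integration.integral_cong) (auto simp: power2_diff power_mult_distrib)
  also have "\<dots> = (LINT x|M. (f x)\<^sup>2) - 2 * t * (LINT x|M. f x * g x) + t\<^sup>2 * (LINT x|M. (g x)\<^sup>2)"
    using assms by simp
  finally show "0 \<le> (LINT x|M. (f x)\<^sup>2) - 2 * t * (LINT x|M. f x * g x) + t\<^sup>2 * (LINT x|M. (g x)\<^sup>2)" .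
qed (auto intro: integral_nonneg_AE)

interpretation arc2: pair_sigma_finite arc_measure arc_measure ..

lemma sets_arc_pair [measurable_cong]: "sets (arc_measure \<Otimes>\<^sub>M arc_measure) = sets (borel \<Otimes>\<^sub>M borel)"
  by (intro sets_pair_measure_cong) auto

lemma arc_Fubini:
  fixes f :: "complex \<Rightarrow> complex \<Rightarrow> real"
  assumes [measurable]: "case_prod f \<in> borel_measurable (borel \<Otimes>\<^sub>M borel)" and B: "\<And>x y. \<bar>f x y\<bar> \<le> B"
  shows "(LINT x|arc_measure. LINT y|arc_measure. f x y) = (LINT y|arc_measure. LINT x|arc_measure. f x y)"
proof -
  interpret p: finite_measure "arc_measure \<Otimes>\<^sub>M arc_measure"
    by (rule finite_measure_pair_measure) unfold_locales
  have "integrable (arc_measure \<Otimes>\<^sub>M arc_measure) (case_prod f)"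
    by (rule p.integrable_const_bound[of _ B]) (use B in auto)
  from arc2.Fubini_integral[OF this] show ?thesis by simp
qed

text \<open>A \<open>T T\<^sup>*\<close> argument: if the kernel of \<open>T T\<^sup>*\<close> is dominated by \<open>C\<close> times the kernel of \<open>T + T\<^sup>*\<close>,
  then \<open>\<parallel>T\<parallel>\<^sup>2 = \<parallel>T T\<^sup>*\<parallel> \<le> 2 C \<parallel>T\<parallel>\<close>.\<close>

locale maximal_kernel =
  fixes p :: "complex \<Rightarrow> complex \<Rightarrow> real" and K C :: real
  assumes p_meas [measurable]: "case_prod p \<in> borel_measurable (borel \<Otimes>\<^sub>M borel)"
    and p_nonneg: "\<And>x y. 0 \<le> p x y" and p_le: "\<And>x y. p x y \<le> K"
    and p_comp: "\<And>x x'. (LINT y|arc_measure. p x y * p x' y) \<le> C * (p x x' + p x' x)"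
    and C_nonneg: "0 \<le> C"
begin

definition bm :: "(complex \<Rightarrow> real) \<Rightarrow> bool" where
  "bm g \<longleftrightarrow> g \<in> borel_measurable borel \<and> (\<exists>B. \<forall>x. 0 \<le> g x \<and> g x \<le> B)"

definition T :: "(complex \<Rightarrow> real) \<Rightarrow> complex \<Rightarrow> real" where
  "T g x = (LINT y|arc_measure. p x y * g y)"

definition U :: "(complex \<Rightarrow> real) \<Rightarrow> complex \<Rightarrow> real" where
  "U g y = (LINT x|arc_measure. p x y * g x)"

lemma K_nonneg: "0 \<le> K"
  using order_trans[OF p_nonneg p_le] .

lemma bm_measurable [measurable_dest]: "bm g \<Longrightarrow> g \<in> borel_measurable borel"
  by (simp add: bm_def)

lemma bm_nonneg: "bm g \<Longrightarrow> 0 \<le> g x"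
  by (auto simp: bm_def)

lemma bm_mult: "bm f \<Longrightarrow> bm g \<Longrightarrow> bm (\<lambda>x. f x * g x)"
proof -
  assume f: "bm f" and g: "bm g"
  then obtain A B where "\<And>x. 0 \<le> f x \<and> f x \<le> A" "\<And>x. 0 \<le> g x \<and> g x \<le> B" by (auto simp: bm_def)
  then have "\<forall>x. 0 \<le> f x * g x \<and> f x * g x \<le> A * B" by (meson mult_mono mult_nonneg_nonneg order_trans)
  then show ?thesis using f g unfolding bm_def by auto
qed

lemma bm_sq: "bm f \<Longrightarrow> bm (\<lambda>x. (f x)\<^sup>2)"
  using bm_mult[of f f] by (simp add: power2_eq_square)

lemma bm_add: "bm f \<Longrightarrow> bm g \<Longrightarrow> bm (\<lambda>x. f x + g x)"
proof -
  assume f: "bm f" and g: "bm g"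
  then obtain A B where "\<And>x. 0 \<le> f x \<and> f x \<le> A" "\<And>x. 0 \<le> g x \<and> g x \<le> B" by (auto simp: bm_def)
  then have "\<forall>x. 0 \<le> f x + g x \<and> f x + g x \<le> A + B" by (meson add_mono add_nonneg_nonneg)
  then show ?thesis using f g unfolding bm_def by auto
qed

lemma bm_integrable: "bm f \<Longrightarrow> integrable arc_measure f"
proof -
  assume f: "bm f"
  then obtain A where A: "\<And>x. 0 \<le> f x \<and> f x \<le> A" by (auto simp: bm_def)
  show ?thesis by (rule integrable_arc_bounded[where B = A]) (use f A in \<open>auto simp: bm_def\<close>)
qed

lemma bm_p1: "bm (p x)" and bm_p2: "bm (\<lambda>x. p x y)"
  unfolding bm_def using p_nonneg p_le by (auto intro!: exI[of _ K])

lemma integral_bm_le: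
  assumes "bm f" and "\<And>x. f x \<le> B"
  shows "(LINT x|arc_measure. f x) \<le> B"
proof -
  have "(LINT x|arc_measure. f x) \<le> (LINT x|arc_measure. B)"
    by (rule integral_mono[OF bm_integrable[OF assms(1)] arc.integrable_const assms(2)])
  then show ?thesis by simp
qed

lemma bm_T: "bm g \<Longrightarrow> bm (T g)" and bm_U: "bm g \<Longrightarrow> bm (U g)"
proof -
  assume g: "bm g"
  then obtain B where B: "\<And>x. 0 \<le> g x \<and> g x \<le> B" by (auto simp: bm_def)
  have [measurable]: "g \<in> borel_measurable borel" using g by simp
  have le: "p x y * g z \<le> K * B" for x y z
    using p_nonneg p_le B K_nonneg by (intro mult_mono) auto
  have "T g x \<le> K * B" "U g x \<le> K * B" for x
    unfolding T_def U_def by (intro integral_bm_le bm_mult bm_p1 bm_p2 g le)+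
  moreover have "0 \<le> T g x" "0 \<le> U g x" for x
    unfolding T_def U_def using p_nonneg B by (auto intro!: integral_nonneg_AE)
  moreover have "T g \<in> borel_measurable borel" "U g \<in> borel_measurable borel"
    unfolding T_def U_def by measurable
  ultimately show "bm (T g)" "bm (U g)" unfolding bm_def by blast+
qed

lemma adjoint_TU:
  assumes f: "bm f" and g: "bm g"
  shows "(LINT x|arc_measure. f x * T g x) = (LINT y|arc_measure. g y * U f y)"
proof -
  obtain A where A: "\<And>x. 0 \<le> f x \<and> f x \<le> A" using f by (auto simp: bm_def)
  obtain B where B: "\<And>x. 0 \<le> g x \<and> g x \<le> B" using g by (auto simp: bm_def)
  have [measurable]: "f \<in> borel_measurable borel" "g \<in> borel_measurable borel" using f g by simp_all
  have AB: "0 \<le> A" "0 \<le> B" using order_trans A B by blast+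
  have bnd: "\<bar>f x * p x y * g y\<bar> \<le> A * K * B" for x y
    unfolding abs_mult using A B p_nonneg p_le K_nonneg AB by (intro mult_mono) auto
  have "(LINT x|arc_measure. f x * T g x) = (LINT x|arc_measure. LINT y|arc_measure. f x * p x y * g y)"
    unfolding T_def by (simp add: mult.assoc)
  also have "\<dots> = (LINT y|arc_measure. LINT x|arc_measure. f x * p x y * g y)"
    by (rule arc_Fubini[OF _ bnd]) measurable
  also have "\<dots> = (LINT y|arc_measure. g y * U f y)"
    unfolding U_def by (simp add: mult_ac flip: integral_mult_right_zero)
  finally show ?thesis .
qed

lemma T_U_le:
  assumes S: "bm S"
  shows "T (U S) x \<le> C * (T S x + U S x)"
proof -
  obtain A where A: "\<And>x. 0 \<le> S x \<and> S x \<le> A" using S by (auto simp: bm_def)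
  have [measurable]: "S \<in> borel_measurable borel" using S by simp
  have A0: "0 \<le> A" using order_trans A by blast
  have bnd: "\<bar>p x y * p z y * S z\<bar> \<le> K * K * A" for y z
    unfolding abs_mult using A A0 p_nonneg p_le K_nonneg by (intro mult_mono) auto
  have "T (U S) x = (LINT y|arc_measure. LINT z|arc_measure. p x y * p z y * S z)"
    unfolding T_def U_def by (simp add: mult.assoc)
  also have "\<dots> = (LINT z|arc_measure. LINT y|arc_measure. p x y * p z y * S z)"
    by (rule arc_Fubini[OF _ bnd]) measurable
  also have "\<dots> = (LINT z|arc_measure. (LINT y|arc_measure. p x y * p z y) * S z)"
    by simp
  also have "\<dots> \<le> (LINT z|arc_measure. C * (p x z * S z + p z x * S z))"
  proof (rule integral_mono')
    show "integrable arc_measure (\<lambda>z. C * (p x z * S z + p z x * S z))"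
      by (intro integrable_mult_right bm_integrable bm_add bm_mult bm_p1 bm_p2 S)
    show "(LINT y|arc_measure. p x y * p z y) * S z \<le> C * (p x z * S z + p z x * S z)" for z
      using mult_right_mono[OF p_comp[of x z], of "S z"] A[of z] by (simp add: algebra_simps)
    show "0 \<le> C * (p x z * S z + p z x * S z)" for z
      using C_nonneg p_nonneg A by auto
  qed
  also have "\<dots> = C * (T S x + U S x)"
    unfolding T_def U_def using bm_integrable[OF bm_mult[OF bm_p1[of x] S]] bm_integrable[OF bm_mult[OF bm_p2[of x] S]]
    by simp
  finally show ?thesis .
qed

definition bound :: "real \<Rightarrow> bool" where
  "bound \<beta> \<longleftrightarrow> 0 \<le> \<beta> \<and> (\<forall>g. bm g \<longrightarrow> (LINT x|arc_measure. (T g x)\<^sup>2) \<le> \<beta> * (LINT x|arc_measure. (g x)\<^sup>2))"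

lemma bm_Cauchy_Schwarz:
  "bm f \<Longrightarrow> bm g \<Longrightarrow> (LINT x|arc_measure. f x * g x)\<^sup>2 \<le> (LINT x|arc_measure. (f x)\<^sup>2) * (LINT x|arc_measure. (g x)\<^sup>2)"
  by (intro integral_Cauchy_Schwarz bm_integrable bm_sq bm_mult)

lemma integral_sq_nonneg: "0 \<le> (LINT x|arc_measure. (f x)\<^sup>2)" for f :: "complex \<Rightarrow> real"
  by (rule integral_nonneg_AE) auto

text \<open>The crude constant only makes the operator norm finite, so that it can be absorbed
  later; it does not enter the final bound.\<close>

lemma bound_initial: "bound (K\<^sup>2)"
  unfolding bound_def
proof (intro conjI allI impI)
  fix g assume g: "bm g"
  have one: "bm (\<lambda>_. 1)" unfolding bm_def by auto
  have "(LINT x|arc_measure. (T g x)\<^sup>2) \<le> K\<^sup>2 * (LINT x|arc_measure. (g x)\<^sup>2)"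
  proof (rule integral_bm_le[OF bm_sq[OF bm_T[OF g]]])
    fix x
    have "T g x \<le> (LINT y|arc_measure. K * g y)"
      unfolding T_def using p_le bm_nonneg[OF g]
      by (intro integral_mono bm_integrable bm_mult bm_p1 g integrable_mult_right mult_right_mono)
    then have "(T g x)\<^sup>2 \<le> (K * (LINT y|arc_measure. g y))\<^sup>2"
      using bm_nonneg[OF bm_T[OF g]] by (intro power_mono) auto
    also have "\<dots> \<le> K\<^sup>2 * (LINT y|arc_measure. (g y)\<^sup>2)"
      using bm_Cauchy_Schwarz[OF g one] by (simp add: power_mult_distrib mult_left_mono)
    finally show "(T g x)\<^sup>2 \<le> K\<^sup>2 * (LINT x|arc_measure. (g x)\<^sup>2)" .
  qed
  then show "(LINT x|arc_measure. (T g x)\<^sup>2) \<le> K\<^sup>2 * (LINT x|arc_measure. (g x)\<^sup>2)" .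
qed simp

text \<open>With S = T g one has |S|^2 = <g, U S> and |U S|^2 = <S, T U S> <= 2 C <S, T S> <= 2 C
  sqrt \<beta> |S|^2. Cauchy-Schwarz in the first identity then lets one factor |S|^2
  cancel.\<close>

lemma bound_improve:
  assumes \<beta>: "bound \<beta>"
  shows "bound (2 * C * sqrt \<beta>)"
  unfolding bound_def
proof (intro conjI allI impI)
  show "0 \<le> 2 * C * sqrt \<beta>" using C_nonneg \<beta> by (auto simp: bound_def)
  fix g assume g: "bm g"
  define S where "S = T g"
  have S: "bm S" using bm_T[OF g] by (simp add: S_def)
  let ?I = "\<lambda>f. (LINT x|arc_measure. (f x)\<^sup>2)"
  let ?a = "(LINT x|arc_measure. S x * T S x)"
  have "?I S = (LINT y|arc_measure. g y * U S y)"
    using adjoint_TU[OF S g] by (simp add: S_def power2_eq_square)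
  then have 1: "(?I S)\<^sup>2 \<le> ?I g * ?I (U S)"
    using bm_Cauchy_Schwarz[OF g bm_U[OF S]] by simp
  have "?I (U S) = (LINT x|arc_measure. S x * T (U S) x)"
    using adjoint_TU[OF S bm_U[OF S]] by (simp add: power2_eq_square)
  also have "\<dots> \<le> (LINT x|arc_measure. C * (S x * T S x + S x * U S x))"
  proof (rule integral_mono)
    show "S x * T (U S) x \<le> C * (S x * T S x + S x * U S x)" for x
      using mult_left_mono[OF T_U_le[OF S] bm_nonneg[OF S], of x x] by (simp add: algebra_simps)
  qed (intro integrable_mult_right bm_integrable bm_add bm_mult bm_T bm_U S)+
  also have "\<dots> = C * (?a + (LINT x|arc_measure. S x * U S x))"
    using bm_integrable[OF bm_mult[OF S bm_T[OF S]]] bm_integrable[OF bm_mult[OF S bm_U[OF S]]] by simp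
  also have "(LINT x|arc_measure. S x * U S x) = ?a" using adjoint_TU[OF S S] by simp
  finally have 2: "?I (U S) \<le> 2 * C * ?a" by simp
  have "?a\<^sup>2 \<le> ?I S * ?I (T S)" by (rule bm_Cauchy_Schwarz[OF S bm_T[OF S]])
  also have "\<dots> \<le> ?I S * (\<beta> * ?I S)"
    using \<beta> S integral_sq_nonneg by (intro mult_left_mono) (auto simp: bound_def)
  also have "\<dots> = (sqrt \<beta> * ?I S)\<^sup>2"
    using \<beta> by (simp add: bound_def power2_eq_square power_mult_distrib)
  finally have 3: "?a \<le> sqrt \<beta> * ?I S"
    by (rule power2_le_imp_le) (use \<beta> integral_sq_nonneg[of S] in \<open>simp add: bound_def\<close>)
  have "(?I S)\<^sup>2 \<le> ?I g * (2 * C * (sqrt \<beta> * ?I S))"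
  proof -
    have "2 * C * ?a \<le> 2 * C * (sqrt \<beta> * ?I S)" using 3 C_nonneg by (intro mult_left_mono) auto
    then have "?I (U S) \<le> 2 * C * (sqrt \<beta> * ?I S)" using 2 by linarith
    from mult_left_mono[OF this integral_sq_nonneg[of g]] show ?thesis using 1 by linarith
  qed
  then have *: "?I S * ?I S \<le> (2 * C * sqrt \<beta> * ?I g) * ?I S" by (simp add: power2_eq_square mult_ac)
  show "(LINT x|arc_measure. (T g x)\<^sup>2) \<le> 2 * C * sqrt \<beta> * ?I g"
  proof (cases "?I S = 0")
    case True
    then show ?thesis using C_nonneg \<beta> integral_sq_nonneg[of g] by (simp add: S_def bound_def)
  next
    case False
    then have "?I S > 0" using integral_sq_nonneg[of S] by linarith
    then show ?thesis using * by (simp add: S_def)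
  qed
qed

text \<open>The least admissible \<beta> is itself admissible and cannot be improved, so \<beta> <=
  2 C sqrt \<beta>, that is \<beta> <= 4 C^2.\<close>

lemma maximal_inequality:
  assumes g: "bm g"
  shows "(LINT x|arc_measure. (T g x)\<^sup>2) \<le> 4 * C\<^sup>2 * (LINT x|arc_measure. (g x)\<^sup>2)"
proof -
  define \<beta> where "\<beta> = Inf {b. bound b}"
  have ne: "{b. bound b} \<noteq> {}" using bound_initial by blast
  have bdd: "bdd_below {b. bound b}" by (rule bdd_belowI[of _ 0]) (auto simp: bound_def)
  have \<beta>0: "0 \<le> \<beta>" unfolding \<beta>_def by (rule cInf_greatest[OF ne]) (auto simp: bound_def)
  have "bound \<beta>"
    unfolding bound_def
  proof (intro conjI allI impI \<beta>0)
    fix g assume g: "bm g"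
    let ?a = "LINT x|arc_measure. (g x)\<^sup>2" and ?b = "LINT x|arc_measure. (T g x)\<^sup>2"
    have b: "?b \<le> c * ?a" if "bound c" for c using that g by (simp add: bound_def)
    show "?b \<le> \<beta> * ?a"
    proof (cases "?a = 0")
      case True
      then show ?thesis using b[OF bound_initial] by simp
    next
      case False
      then have a: "?a > 0" using integral_sq_nonneg[of g] by linarith
      have "?b / ?a \<le> \<beta>" unfolding \<beta>_def
        by (rule cInf_greatest[OF ne]) (use b a in \<open>auto simp: field_simps\<close>)
      then show ?thesis using a by (simp add: field_simps)
    qed
  qed
  then have "bound (2 * C * sqrt \<beta>)" by (rule bound_improve)
  then have "\<beta> \<le> 2 * C * sqrt \<beta>" unfolding \<beta>_def by (intro cInf_lower bdd) (simp add: \<beta>_def)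
  then have "sqrt \<beta> * sqrt \<beta> \<le> 2 * C * sqrt \<beta>" using \<beta>0 by simp
  then have "sqrt \<beta> \<le> 2 * C"
    using C_nonneg \<beta>0 mult_le_cancel_right_pos[of "sqrt \<beta>" "sqrt \<beta>" "2 * C"] by (cases "\<beta> = 0") auto
  then have "(sqrt \<beta>)\<^sup>2 \<le> (2 * C)\<^sup>2" using \<beta>0 by (intro power_mono) auto
  then have "\<beta> \<le> 4 * C\<^sup>2" using \<beta>0 by (simp add: power_mult_distrib)
  then have "\<beta> * (LINT x|arc_measure. (g x)\<^sup>2) \<le> 4 * C\<^sup>2 * (LINT x|arc_measure. (g x)\<^sup>2)"
    using integral_sq_nonneg by (intro mult_right_mono) auto
  then show ?thesis using \<open>bound \<beta>\<close> g unfolding bound_def by (meson order_trans)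
qed

end

subsection \<open>Application to the Poisson kernel\<close>

text \<open>Enumerates the rationals in (0,1): suprema over all radii become countable ones, hence
  measurable.\<close>

definition radii :: "nat \<Rightarrow> real" where
  "radii = from_nat_into (\<rat> \<inter> {0<..<1})"

lemma range_radii: "range radii = \<rat> \<inter> {0<..<1}"
proof -
  obtain q :: real where "q \<in> \<rat>" "0 < q" "q < 1" using Rats_dense_in_real[of 0 1] by auto
  then have "\<rat> \<inter> {0<..<1 :: real} \<noteq> {}" by auto
  then show ?thesis unfolding radii_def
    by (intro range_from_nat_into) (auto intro: countable_Int1 countable_rat)
qed

lemma radii: "0 < radii i" "radii i < 1"
  using range_radii by (auto simp: set_eq_iff image_iff)

text \<open>If \<open>h\<close> exceeded \<open>c\<close> somewhere, it would do so on an interval,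
  which contains a rational.\<close>

lemma radii_le_imp_le:
  fixes h :: "real \<Rightarrow> real"
  assumes cont: "continuous_on {a<..<1} h" and "0 \<le> a" and le: "\<And>i. a < radii i \<Longrightarrow> h (radii i) \<le> c"
    and r: "a < r" "r < 1"
  shows "h r \<le> c"
proof (rule ccontr)
  assume "\<not> h r \<le> c"
  then have gt: "h r > c" by simp
  have "isCont h r" using cont r by (simp add: continuous_on_eq_continuous_at)
  then have "\<forall>\<^sub>F x in at r. h x > c" using gt by (intro order_tendstoD(1)[of h "h r"]) (simp_all add: isCont_def)
  then obtain d where d: "d > 0" "\<And>x. x \<noteq> r \<Longrightarrow> dist x r < d \<Longrightarrow> h x > c"
    by (auto simp: eventually_at)
  have "max a (r - d) < r" using r d by simp
  then obtain q where q: "q \<in> \<rat>" "max a (r - d) < q" "q < r" using Rats_dense_in_real by blast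
  then have "q \<in> range radii" using range_radii \<open>0 \<le> a\<close> r by auto
  then obtain i where "q = radii i" by blast
  then show False using le[of i] d(2)[of q] q by (auto simp: dist_real_def)
qed

lemma radial_continuous:
  assumes f: "disc_hol f" and \<zeta>: "cmod \<zeta> = 1"
  shows "continuous_on {0<..<1} (\<lambda>r. f (of_real r * \<zeta>))"
proof -
  have "continuous_on (ball 0 1) f" using f by (auto simp: disc_hol_def intro: holomorphic_on_imp_continuous_on)
  then show ?thesis
    by (rule continuous_on_compose2[of _ f]) (use \<zeta> in \<open>auto intro!: continuous_intros simp: norm_mult\<close>)
qed

text \<open>The squared \<open>H2\<close> norm in terms of coefficients, available before the inner
  product is understood.\<close>

definition energy :: "cfun \<Rightarrow> real" where
  "energy f = (\<Sum>n. (cmod (tc f n))\<^sup>2)"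

lemma circle_mean_sq_sums:
  assumes f: "disc_hol f" and r: "0 \<le> r" "r < 1"
  shows "(\<lambda>n. (cmod (tc f n))\<^sup>2 * (r\<^sup>2) ^ n) sums (LINT \<zeta>|arc_measure. (cmod (f (of_real r * \<zeta>)))\<^sup>2)"
proof -
  have "(\<lambda>n. tc f n * cnj (tc f n) * of_real (r * r) ^ n) sums
      (LINT \<zeta>|arc_measure. f (of_real r * \<zeta>) * cnj (f (of_real r * \<zeta>)))"
    by (rule circle_parseval[OF f f r r])
  also have "(LINT \<zeta>|arc_measure. f (of_real r * \<zeta>) * cnj (f (of_real r * \<zeta>))) =
      complex_of_real (LINT \<zeta>|arc_measure. (cmod (f (of_real r * \<zeta>)))\<^sup>2)"
    by (simp only: complex_norm_square[symmetric] of_real_power[symmetric] integral_complex_of_real)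
  also have "(\<lambda>n. tc f n * cnj (tc f n) * of_real (r * r) ^ n) = (\<lambda>n. complex_of_real ((cmod (tc f n))\<^sup>2 * (r\<^sup>2) ^ n))"
    by (simp only: complex_norm_square[symmetric] of_real_mult of_real_power power2_eq_square[of r])
  finally show ?thesis by (simp only: sums_of_real_iff)
qed

lemma circle_mean_sq_le_energy:
  assumes f: "disc_hol f" and sm: "summable (\<lambda>n. (cmod (tc f n))\<^sup>2)" and r: "0 \<le> r" "r < 1"
  shows "(LINT \<zeta>|arc_measure. (cmod (f (of_real r * \<zeta>)))\<^sup>2) \<le> energy f"
  unfolding energy_def
proof (rule sums_le[OF _ circle_mean_sq_sums[OF f r] summable_sums[OF sm]])
  show "(cmod (tc f n))\<^sup>2 * (r\<^sup>2) ^ n \<le> (cmod (tc f n))\<^sup>2" for n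
    using r by (intro mult_left_le) (auto intro!: power_le_one)
qed

text \<open>The maximum is linearized: at each point a maximizing radius is selected, and the values
  there are a Poisson integral with variable radius. The constant 256 is four times 8^2.\<close>

lemma finite_maximal:
  assumes f: "disc_hol f" and sm: "summable (\<lambda>n. (cmod (tc f n))\<^sup>2)"
  shows "(LINT \<zeta>|arc_measure. (MAX i\<in>{..n}. cmod (f (of_real (radii i) * \<zeta>)))\<^sup>2) \<le> 256 * energy f"
proof -
  define \<phi> where "\<phi> i \<zeta> = cmod (f (of_real (radii i) * \<zeta>))" for i \<zeta>
  have [measurable]: "\<phi> i \<in> borel_measurable borel" for i
    unfolding \<phi>_def using f by simp
  \<comment> \<open>\<open>R\<close> lies strictly between the finitely many radii and 1, so
    \<open>f\<close> is bounded on the circle of radius \<open>R\<close> and its Poisson integral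
    reproduces the values at the smaller radii.\<close>
  define R where "R = (MAX i\<in>{..n}. radii i) / 2 + 1/2"
  have Rm: "radii i < R" "0 < R" "R < 1" if "i \<le> n" for i
  proof -
    have le: "radii i \<le> (MAX i\<in>{..n}. radii i)" using that by (intro Max_ge) auto
    have lt: "(MAX i\<in>{..n}. radii i) < 1" using radii by (subst Max_less_iff) auto
    show "radii i < R" "0 < R" "R < 1" unfolding R_def using le lt radii(1)[of i] by linarith+
  qed
  have R: "0 < R" "R < 1" using Rm[of 0] by auto
  \<comment> \<open>Taking the least maximizing index makes the selection measurable.\<close>
  define idx where "idx \<zeta> = (LEAST i. i \<le> n \<and> (\<forall>j\<le>n. \<phi> j \<zeta> \<le> \<phi> i \<zeta>))" for \<zeta>
  have idx: "idx \<zeta> \<le> n" "\<And>j. j \<le> n \<Longrightarrow> \<phi> j \<zeta> \<le> \<phi> (idx \<zeta>) \<zeta>" for \<zeta>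
  proof -
    have "(MAX j\<in>{..n}. \<phi> j \<zeta>) \<in> (\<lambda>j. \<phi> j \<zeta>) ` {..n}" by (intro Max_in) auto
    then obtain i where "i \<in> {..n}" and i2: "(MAX j\<in>{..n}. \<phi> j \<zeta>) = \<phi> i \<zeta>" by (rule imageE)
    then have i: "i \<le> n" by simp
    have "\<phi> j \<zeta> \<le> (MAX j\<in>{..n}. \<phi> j \<zeta>)" if "j \<le> n" for j using that by (intro Max_ge) auto
    then have "\<exists>i. i \<le> n \<and> (\<forall>j\<le>n. \<phi> j \<zeta> \<le> \<phi> i \<zeta>)" unfolding i2 using i by blast
    from LeastI_ex[OF this] show "idx \<zeta> \<le> n" "\<And>j. j \<le> n \<Longrightarrow> \<phi> j \<zeta> \<le> \<phi> (idx \<zeta>) \<zeta>"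
      by (auto simp: idx_def)
  qed
  have [measurable]: "idx \<in> measurable borel (count_space UNIV)"
    unfolding idx_def by measurable
  define \<rho> where "\<rho> \<zeta> = radii (idx \<zeta>) / R" for \<zeta>
  have [measurable]: "\<rho> \<in> borel_measurable borel"
    unfolding \<rho>_def by measurable
  define r0 where "r0 = (MAX i\<in>{..n}. radii i / R)"
  have r0: "r0 < 1" unfolding r0_def using Rm R by (subst Max_less_iff) auto
  have \<rho>: "0 \<le> \<rho> \<zeta>" "\<rho> \<zeta> \<le> r0" "\<rho> \<zeta> < 1" for \<zeta>
  proof -
    show "0 \<le> \<rho> \<zeta>" using radii(1)[of "idx \<zeta>"] R by (simp add: \<rho>_def)
    show "\<rho> \<zeta> \<le> r0" unfolding \<rho>_def r0_def using idx by (intro Max_ge) auto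
    then show "\<rho> \<zeta> < 1" using r0 by simp
  qed
  \<comment> \<open>The sup bound 1 / (1 - r0)^2 depends on \<open>n\<close>, but the maximal
    inequality retains only the constant 8.\<close>
  interpret mk: maximal_kernel "\<lambda>x. poisson (\<rho> x) x" "1 / (1 - r0)\<^sup>2" 8
  proof
    show "(\<lambda>(x, y). poisson (\<rho> x) x y) \<in> borel_measurable (borel \<Otimes>\<^sub>M borel)"
      unfolding poisson_def by measurable
    fix x x' y
    show "0 \<le> poisson (\<rho> x) x y" by (intro poisson_nonneg \<rho>)
    show "poisson (\<rho> x) x y \<le> 1 / (1 - r0)\<^sup>2" by (intro poisson_le \<rho> r0)
    show "(LINT y|arc_measure. poisson (\<rho> x) x y * poisson (\<rho> x') x' y) \<le> 8 * (poisson (\<rho> x) x x' + poisson (\<rho> x') x' x)"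
      using poisson_comparison[of "\<rho> x" "\<rho> x'" x x'] \<rho> poisson_sym[of "\<rho> x'" x x']
      by (simp add: poisson_semigroup)
  qed simp
  define g where "g y = (if cmod y = 1 then cmod (f (of_real R * y)) else 0)" for y
  obtain B where B: "B \<ge> 0" "\<And>\<zeta>. cmod \<zeta> = 1 \<Longrightarrow> cmod (f (of_real R * \<zeta>)) \<le> B"
    using disc_hol_circle_bounded[OF f, of R] R by auto
  have gm [measurable]: "g \<in> borel_measurable borel" unfolding g_def using f by simp
  have g: "mk.bm g" unfolding mk.bm_def using B gm by (auto simp: g_def intro!: exI[of _ B])
  have le: "\<phi> (idx \<zeta>) \<zeta> \<le> mk.T g \<zeta>" if \<zeta>: "cmod \<zeta> = 1" for \<zeta>
  proof -
    have "f (of_real (radii (idx \<zeta>)) * \<zeta>) = (LINT y|arc_measure. of_real (poisson (\<rho> \<zeta>) \<zeta> y) * f (of_real R * y))"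
      using poisson_integral_szego[OF \<zeta> \<rho>(1) \<rho>(3) f, of R \<zeta>] R by (simp add: \<rho>_def)
    then have "\<phi> (idx \<zeta>) \<zeta> \<le> (LINT y|arc_measure. cmod (of_real (poisson (\<rho> \<zeta>) \<zeta> y) * f (of_real R * y)))"
      unfolding \<phi>_def by (simp only: integral_norm_bound)
    also have "\<dots> = mk.T g \<zeta>" unfolding mk.T_def
    proof (rule integral_arc_cong)
      show "cmod (of_real (poisson (\<rho> \<zeta>) \<zeta> y) * f (of_real R * y)) = poisson (\<rho> \<zeta>) \<zeta> y * g y" if "cmod y = 1" for y
        using that poisson_nonneg[OF \<rho>(1) \<rho>(3), of \<zeta> \<zeta> y] by (simp add: g_def norm_mult)
    qed (use f in measurable)
    finally show ?thesis .
  qed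
  have "(LINT \<zeta>|arc_measure. (MAX i\<in>{..n}. \<phi> i \<zeta>)\<^sup>2) \<le> (LINT \<zeta>|arc_measure. (mk.T g \<zeta>)\<^sup>2)"
  proof (rule integral_mono_AE')
    show "integrable arc_measure (\<lambda>\<zeta>. (mk.T g \<zeta>)\<^sup>2)" by (intro mk.bm_integrable mk.bm_sq mk.bm_T g)
    show "AE \<zeta> in arc_measure. (MAX i\<in>{..n}. \<phi> i \<zeta>)\<^sup>2 \<le> (mk.T g \<zeta>)\<^sup>2"
    proof (rule AE_arc)
      fix \<zeta> :: complex assume \<zeta>: "cmod \<zeta> = 1"
      have "(MAX i\<in>{..n}. \<phi> i \<zeta>) \<le> \<phi> (idx \<zeta>) \<zeta>" using idx by (subst Max_le_iff) auto
      then have "(MAX i\<in>{..n}. \<phi> i \<zeta>) \<le> mk.T g \<zeta>" using le[OF \<zeta>] by linarith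
      moreover have "0 \<le> \<phi> 0 \<zeta>" by (simp add: \<phi>_def)
      then have "0 \<le> (MAX i\<in>{..n}. \<phi> i \<zeta>)" by (rule order_trans) (intro Max_ge; auto)
      ultimately show "(MAX i\<in>{..n}. \<phi> i \<zeta>)\<^sup>2 \<le> (mk.T g \<zeta>)\<^sup>2" by (intro power_mono)
    qed
  qed simp
  also have "\<dots> \<le> 4 * 8\<^sup>2 * (LINT x|arc_measure. (g x)\<^sup>2)" by (rule mk.maximal_inequality[OF g])
  also have "(LINT x|arc_measure. (g x)\<^sup>2) = (LINT \<zeta>|arc_measure. (cmod (f (of_real R * \<zeta>)))\<^sup>2)"
    by (rule integral_arc_cong) (use f in \<open>auto simp: g_def\<close>)
  also have "\<dots> \<le> energy f" using circle_mean_sq_le_energy[OF f sm, of R] R by simp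
  finally show ?thesis by (simp add: \<phi>_def)
qed

text \<open>Monotone convergence over the enumerated radii; the remaining radii follow by
  continuity. \<open>enn2real\<close> turns an infinite supremum into 0, so the majorization is
  stated almost everywhere.\<close>

lemma radial_maximal:
  assumes f: "disc_hol f" and sm: "summable (\<lambda>n. (cmod (tc f n))\<^sup>2)"
  shows "\<exists>m. m \<in> borel_measurable borel \<and> (\<forall>\<zeta>. 0 \<le> m \<zeta>) \<and> integrable arc_measure (\<lambda>\<zeta>. (m \<zeta>)\<^sup>2) \<and>
     (LINT \<zeta>|arc_measure. (m \<zeta>)\<^sup>2) \<le> 256 * energy f \<and>
     (AE \<zeta> in arc_measure. \<forall>r. 0 < r \<and> r < 1 \<longrightarrow> cmod (f (of_real r * \<zeta>)) \<le> m \<zeta>)"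
proof -
  define \<phi> where "\<phi> n \<zeta> = (MAX i\<in>{..n}. cmod (f (of_real (radii i) * \<zeta>)))" for n \<zeta>
  have [measurable]: "\<phi> n \<in> borel_measurable borel" for n
    unfolding \<phi>_def using f by (intro borel_measurable_Max) auto
  have ge: "cmod (f (of_real (radii i) * \<zeta>)) \<le> \<phi> n \<zeta>" if "i \<le> n" for i n \<zeta>
    unfolding \<phi>_def using that by (intro Max_ge) auto
  have \<phi>0: "0 \<le> \<phi> n \<zeta>" for n \<zeta> using ge[of 0 n \<zeta>] norm_ge_zero order_trans by blast
  have mono: "\<phi> m \<zeta> \<le> \<phi> n \<zeta>" if "m \<le> n" for m n \<zeta>
    unfolding \<phi>_def using that by (intro Max_mono) auto
  have E0: "0 \<le> energy f" unfolding energy_def by (rule suminf_nonneg[OF sm]) simp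
  define F where "F \<zeta> = (SUP n. ennreal ((\<phi> n \<zeta>)\<^sup>2))" for \<zeta>
  have Fm [measurable]: "F \<in> borel_measurable borel" unfolding F_def by measurable
  have "(\<integral>\<^sup>+\<zeta>. F \<zeta> \<partial>arc_measure) = (SUP n. \<integral>\<^sup>+\<zeta>. ennreal ((\<phi> n \<zeta>)\<^sup>2) \<partial>arc_measure)"
    unfolding F_def
    by (intro nn_integral_monotone_convergence_SUP)
      (auto simp: incseq_def le_fun_def mono \<phi>0 intro!: ennreal_leI power_mono)
  also have "\<dots> \<le> ennreal (256 * energy f)"
  proof (rule SUP_least)
    fix n
    have "\<exists>B. \<forall>\<zeta>. cmod \<zeta> = 1 \<longrightarrow> (\<phi> n \<zeta>)\<^sup>2 \<le> B"
    proof -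
      have "\<exists>B\<ge>0. \<forall>\<zeta>. cmod \<zeta> = 1 \<longrightarrow> cmod (f (of_real (radii i) * \<zeta>)) \<le> B" for i
        using disc_hol_circle_bounded[OF f, of "radii i"] radii[of i] by auto
      then obtain B where B: "\<And>i \<zeta>. cmod \<zeta> = 1 \<Longrightarrow> cmod (f (of_real (radii i) * \<zeta>)) \<le> B i" by metis
      have "\<phi> n \<zeta> \<le> (MAX i\<in>{..n}. B i)" if "cmod \<zeta> = 1" for \<zeta>
      proof -
        have "cmod (f (of_real (radii i) * \<zeta>)) \<le> (MAX i\<in>{..n}. B i)" if "i \<le> n" for i
          by (rule order_trans[OF B[OF \<open>cmod \<zeta> = 1\<close>] Max_ge]) (use that in auto)
        then show ?thesis unfolding \<phi>_def by (subst Max_le_iff) auto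
      qed
      then have "\<forall>\<zeta>. cmod \<zeta> = 1 \<longrightarrow> (\<phi> n \<zeta>)\<^sup>2 \<le> (MAX i\<in>{..n}. B i)\<^sup>2"
        using \<phi>0 by (auto intro: power_mono)
      then show ?thesis by blast
    qed
    then obtain B where "\<And>\<zeta>. cmod \<zeta> = 1 \<Longrightarrow> (\<phi> n \<zeta>)\<^sup>2 \<le> B" by blast
    then have "integrable arc_measure (\<lambda>\<zeta>. (\<phi> n \<zeta>)\<^sup>2)"
      by (intro integrable_arc_bounded[where B = B]) auto
    then have "(\<integral>\<^sup>+\<zeta>. ennreal ((\<phi> n \<zeta>)\<^sup>2) \<partial>arc_measure) = ennreal (LINT \<zeta>|arc_measure. (\<phi> n \<zeta>)\<^sup>2)"
      by (intro nn_integral_eq_integral) auto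
    also have "\<dots> \<le> ennreal (256 * energy f)"
      using finite_maximal[OF f sm, of n] by (intro ennreal_leI) (simp add: \<phi>_def)
    finally show "(\<integral>\<^sup>+\<zeta>. ennreal ((\<phi> n \<zeta>)\<^sup>2) \<partial>arc_measure) \<le> ennreal (256 * energy f)" .
  qed
  finally have FI: "(\<integral>\<^sup>+\<zeta>. F \<zeta> \<partial>arc_measure) \<le> ennreal (256 * energy f)" .
  then have "(\<integral>\<^sup>+\<zeta>. F \<zeta> \<partial>arc_measure) \<noteq> \<infinity>" by (auto simp: top_unique)
  then have Ffin: "AE \<zeta> in arc_measure. F \<zeta> \<noteq> \<infinity>" by (intro nn_integral_noteq_infinite) auto
  define m where "m \<zeta> = sqrt (enn2real (F \<zeta>))" for \<zeta>
  have m2: "(m \<zeta>)\<^sup>2 = enn2real (F \<zeta>)" for \<zeta> by (simp add: m_def)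
  have mm: "m \<in> borel_measurable borel" unfolding m_def by measurable
  have "(\<integral>\<^sup>+\<zeta>. ennreal ((m \<zeta>)\<^sup>2) \<partial>arc_measure) = (\<integral>\<^sup>+\<zeta>. F \<zeta> \<partial>arc_measure)"
    by (intro nn_integral_cong_AE, use Ffin in eventually_elim) (auto simp: m2 less_top[symmetric])
  with FI have nn: "(\<integral>\<^sup>+\<zeta>. ennreal ((m \<zeta>)\<^sup>2) \<partial>arc_measure) \<le> ennreal (256 * energy f)" by simp
  have int: "integrable arc_measure (\<lambda>\<zeta>. (m \<zeta>)\<^sup>2)"
    using nn mm by (intro integrableI_bounded) (auto simp: less_top[symmetric] top_unique)
  have le: "(LINT \<zeta>|arc_measure. (m \<zeta>)\<^sup>2) \<le> 256 * energy f"
    using nn nn_integral_eq_integral[OF int] E0 by (simp add: ennreal_le_iff)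
  have "AE \<zeta> in arc_measure. \<forall>r. 0 < r \<and> r < 1 \<longrightarrow> cmod (f (of_real r * \<zeta>)) \<le> m \<zeta>"
    using Ffin AE_arc_norm
  proof eventually_elim
    fix \<zeta> assume fin: "F \<zeta> \<noteq> \<infinity>" and \<zeta>: "cmod \<zeta> = 1"
    have "cmod (f (of_real (radii i) * \<zeta>)) \<le> m \<zeta>" for i
    proof -
      have "ennreal ((\<phi> i \<zeta>)\<^sup>2) \<le> F \<zeta>" unfolding F_def by (rule SUP_upper) simp
      also have "F \<zeta> = ennreal ((m \<zeta>)\<^sup>2)" using fin by (simp add: m2 less_top[symmetric])
      finally have "(\<phi> i \<zeta>)\<^sup>2 \<le> (m \<zeta>)\<^sup>2" by (simp add: ennreal_le_iff)
      then have "\<phi> i \<zeta> \<le> m \<zeta>" by (rule power2_le_imp_le) (simp add: m_def)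
      then show ?thesis using ge[of i i \<zeta>] by simp
    qed
    note le' = this
    show "\<forall>r. 0 < r \<and> r < 1 \<longrightarrow> cmod (f (of_real r * \<zeta>)) \<le> m \<zeta>"
    proof (intro allI impI)
      fix r :: real assume r: "0 < r \<and> r < 1"
      show "cmod (f (of_real r * \<zeta>)) \<le> m \<zeta>"
      proof (rule radii_le_imp_le[of 0 "\<lambda>r. cmod (f (of_real r * \<zeta>))"])
        show "continuous_on {0<..<1} (\<lambda>r. cmod (f (of_real r * \<zeta>)))"
          by (intro continuous_on_norm radial_continuous f \<zeta>)
      qed (use le' r in auto)
    qed
  qed
  moreover have "0 \<le> m \<zeta>" for \<zeta> by (simp add: m_def)
  ultimately show ?thesis using mm int le by blast
qed


section \<open>Existence and measurability of boundary functions\<close>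

section \<open>Radial limits\<close>

lemma tc_add: "disc_hol f \<Longrightarrow> disc_hol g \<Longrightarrow> disc_hol (\<lambda>z. f z + g z)"
  and tc_add': "disc_hol f \<Longrightarrow> disc_hol g \<Longrightarrow> tc (\<lambda>z. f z + g z) n = tc f n + tc g n"
proof -
  assume f: "disc_hol f" and g: "disc_hol g"
  then show h: "disc_hol (\<lambda>z. f z + g z)" unfolding disc_hol_def by (auto intro!: holomorphic_intros)
  show "tc (\<lambda>z. f z + g z) n = tc f n + tc g n"
    by (rule tc_unique[OF h]) (use sums_add[OF tc_sums[OF f] tc_sums[OF g]] in \<open>simp add: distrib_right\<close>)
qed

lemma disc_hol_mult: "disc_hol f \<Longrightarrow> g holomorphic_on ball 0 1 \<Longrightarrow> disc_hol (\<lambda>z. f z * g z)"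
  unfolding disc_hol_def by (auto intro!: holomorphic_intros)

lemma disc_hol_scale: "disc_hol f \<Longrightarrow> disc_hol (\<lambda>z. c * f z)"
  unfolding disc_hol_def by (auto intro!: holomorphic_intros)

lemma tc_scale: "disc_hol f \<Longrightarrow> tc (\<lambda>z. c * f z) n = c * tc f n"
  by (rule tc_unique[OF disc_hol_scale]) (use sums_mult[OF tc_sums] in \<open>simp_all add: mult.assoc\<close>)

definition taylor_tail :: "cfun \<Rightarrow> nat \<Rightarrow> cfun" where
  "taylor_tail f N = cut (\<lambda>z. f z - (\<Sum>n<N. tc f n * z ^ n))"

lemma taylor_tail_disc_hol: "disc_hol f \<Longrightarrow> disc_hol (taylor_tail f N)"
  unfolding taylor_tail_def by (rule disc_hol_cut) (auto simp: disc_hol_def intro!: holomorphic_intros)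

lemma tc_taylor_tail: "disc_hol f \<Longrightarrow> tc (taylor_tail f N) n = (if n < N then 0 else tc f n)"
proof (rule tc_unique)
  fix z assume f: "disc_hol f" and z: "cmod z < 1"
  have "(\<lambda>n. tc f n * z ^ n - (if n \<in> {..<N} then tc f n * z ^ n else 0)) sums (f z - (\<Sum>n<N. tc f n * z ^ n))"
    by (intro sums_diff tc_sums f z sums_If_finite_set) auto
  then show "(\<lambda>n. (if n < N then 0 else tc f n) * z ^ n) sums taylor_tail f N z"
    using z by (simp add: taylor_tail_def cut_def if_distrib[of "\<lambda>x. x * _"] if_distrib[of "\<lambda>x. _ - x"] cong: if_cong)
qed (rule taylor_tail_disc_hol)

lemma energy_taylor_tail:
  assumes f: "disc_hol f" and sm: "summable (\<lambda>n. (cmod (tc f n))\<^sup>2)"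
  shows "summable (\<lambda>n. (cmod (tc (taylor_tail f N) n))\<^sup>2)"
    and "energy (taylor_tail f N) = energy f - (\<Sum>n<N. (cmod (tc f n))\<^sup>2)"
proof -
  have "(\<lambda>n. (cmod (tc f n))\<^sup>2 - (if n \<in> {..<N} then (cmod (tc f n))\<^sup>2 else 0)) sums (energy f - (\<Sum>n<N. (cmod (tc f n))\<^sup>2))"
    unfolding energy_def by (intro sums_diff summable_sums sm sums_If_finite_set) auto
  then have *: "(\<lambda>n. (cmod (tc (taylor_tail f N) n))\<^sup>2) sums (energy f - (\<Sum>n<N. (cmod (tc f n))\<^sup>2))"
    by (rule sums_cong[THEN iffD1, rotated]) (simp add: tc_taylor_tail[OF f])
  then show "summable (\<lambda>n. (cmod (tc (taylor_tail f N) n))\<^sup>2)" by (rule sums_summable)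
  show "energy (taylor_tail f N) = energy f - (\<Sum>n<N. (cmod (tc f n))\<^sup>2)"
    using * unfolding energy_def by (rule sums_unique[symmetric])
qed

text \<open>A sequence of radii increasing to 1 along which limits are taken; the 2 keeps
  \<open>rad 0\<close> positive.\<close>

definition rad :: "nat \<Rightarrow> real" where
  "rad n = 1 - 1 / (real n + 2)"

lemma rad: "0 < rad n" "rad n < 1" "0 \<le> rad n"
  by (auto simp: rad_def field_simps)

lemma rad_tendsto: "rad \<longlonglongrightarrow> 1"
proof -
  have "(\<lambda>n. 1 - 1 / (real n + 2)) \<longlonglongrightarrow> 1 - 0"
    using LIMSEQ_ignore_initial_segment[OF lim_1_over_n, of 2] by (intro tendsto_intros) (simp add: add.commute)
  then show ?thesis by (simp add: rad_def[abs_def])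
qed

lemma rad_at_left: "filterlim rad (at_left 1) sequentially"
  using rad_tendsto rad by (auto simp: filterlim_at less_imp_neq intro!: always_eventually)

text \<open>A criterion that does not mention the limit; both the existence proof and the
  measurability of \<open>bdry\<close> depend on it.\<close>

lemma at_left_limit_iff_Cauchy:
  fixes g :: "real \<Rightarrow> complex"
  shows "(\<exists>l. (g \<longlongrightarrow> l) (at_left 1)) \<longleftrightarrow>
    (\<forall>e>0. \<exists>a<1. \<forall>r r'. a < r \<and> r < 1 \<and> a < r' \<and> r' < 1 \<longrightarrow> dist (g r) (g r') < e)"
proof
  assume "\<exists>l. (g \<longlongrightarrow> l) (at_left 1)"
  then obtain l where l: "(g \<longlongrightarrow> l) (at_left 1)" by blast
  show "\<forall>e>0. \<exists>a<1. \<forall>r r'. a < r \<and> r < 1 \<and> a < r' \<and> r' < 1 \<longrightarrow> dist (g r) (g r') < e"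
  proof (intro allI impI)
    fix e :: real assume "e > 0"
    then have "\<forall>\<^sub>F r in at_left 1. dist (g r) l < e / 2" using l by (intro tendstoD) auto
    then obtain a where a: "a < 1" "\<And>r. a < r \<Longrightarrow> r < 1 \<Longrightarrow> dist (g r) l < e / 2"
      by (auto simp: eventually_at_left_field)
    have "dist (g r) (g r') < e" if "a < r" "r < 1" "a < r'" "r' < 1" for r r'
      using dist_triangle_half_l[OF a(2) a(2)] that by blast
    then show "\<exists>a<1. \<forall>r r'. a < r \<and> r < 1 \<and> a < r' \<and> r' < 1 \<longrightarrow> dist (g r) (g r') < e"
      using a(1) by blast
  qed
next
  assume *: "\<forall>e>0. \<exists>a<1. \<forall>r r'. a < r \<and> r < 1 \<and> a < r' \<and> r' < 1 \<longrightarrow> dist (g r) (g r') < e"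
  have ev: "\<exists>M. \<forall>n\<ge>M. a < rad n" if "a < 1" for a
    using order_tendstoD(1)[OF rad_tendsto that] by (simp add: eventually_sequentially)
  have "Cauchy (\<lambda>n. g (rad n))"
    unfolding Cauchy_def using * ev rad(2) by metis
  then obtain l where l: "(\<lambda>n. g (rad n)) \<longlonglongrightarrow> l" by (auto simp: Cauchy_convergent_iff convergent_def)
  have "(g \<longlongrightarrow> l) (at_left 1)"
  proof (rule tendstoI)
    fix e :: real assume "e > 0"
    then obtain a where a: "a < 1" "\<And>r r'. a < r \<Longrightarrow> r < 1 \<Longrightarrow> a < r' \<Longrightarrow> r' < 1 \<Longrightarrow> dist (g r) (g r') < e/2"
      using *[rule_format, of "e/2"] by auto
    have "dist (g r) l \<le> e/2" if r: "a < r" "r < 1" for r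
    proof (rule LIMSEQ_le_const2)
      show "(\<lambda>n. dist (g r) (g (rad n))) \<longlonglongrightarrow> dist (g r) l" by (intro tendsto_intros l)
      show "\<exists>N. \<forall>n\<ge>N. dist (g r) (g (rad n)) \<le> e/2" using ev[OF a(1)] a(2)[OF r] rad(2) by (meson less_imp_le)
    qed
    then have "dist (g r) l < e" if "a < r" "r < 1" for r using that \<open>e > 0\<close> by fastforce
    then show "\<forall>\<^sub>F r in at_left 1. dist (g r) l < e"
      using a(1) by (auto simp: eventually_at_left_field)
  qed
  then show "\<exists>l. (g \<longlongrightarrow> l) (at_left 1)" by blast
qed

text \<open>A Taylor polynomial does not oscillate at the boundary, so only the tail matters. The
  maximal functions of the tails tend to 0 in L^2, hence almost everywhere along a
  subsequence.\<close>

lemma radial_limit_exists: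
  assumes f: "disc_hol f" and sm: "summable (\<lambda>n. (cmod (tc f n))\<^sup>2)"
  shows "AE \<zeta> in arc_measure. \<exists>l. ((\<lambda>r. f (of_real r * \<zeta>)) \<longlongrightarrow> l) (at_left 1)"
proof -
  have "\<exists>m. \<forall>N. m N \<in> borel_measurable borel \<and> (\<forall>\<zeta>. 0 \<le> m N \<zeta>) \<and> integrable arc_measure (\<lambda>\<zeta>. (m N \<zeta>)\<^sup>2) \<and>
     (LINT \<zeta>|arc_measure. (m N \<zeta>)\<^sup>2) \<le> 256 * energy (taylor_tail f N) \<and>
     (AE \<zeta> in arc_measure. \<forall>r. 0 < r \<and> r < 1 \<longrightarrow> cmod (taylor_tail f N (of_real r * \<zeta>)) \<le> m N \<zeta>)"
    by (rule choice, rule allI, rule radial_maximal[OF taylor_tail_disc_hol[OF f] energy_taylor_tail(1)[OF f sm]])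
  then obtain m where m: "\<forall>N. m N \<in> borel_measurable borel \<and> (\<forall>\<zeta>. 0 \<le> m N \<zeta>) \<and> integrable arc_measure (\<lambda>\<zeta>. (m N \<zeta>)\<^sup>2) \<and>
     (LINT \<zeta>|arc_measure. (m N \<zeta>)\<^sup>2) \<le> 256 * energy (taylor_tail f N) \<and>
     (AE \<zeta> in arc_measure. \<forall>r. 0 < r \<and> r < 1 \<longrightarrow> cmod (taylor_tail f N (of_real r * \<zeta>)) \<le> m N \<zeta>)" ..
  have mint: "\<And>N. integrable arc_measure (\<lambda>\<zeta>. (m N \<zeta>)\<^sup>2)"
    and mle: "\<And>N. (LINT \<zeta>|arc_measure. (m N \<zeta>)\<^sup>2) \<le> 256 * energy (taylor_tail f N)"
    and mb: "\<And>N. AE \<zeta> in arc_measure. \<forall>r. 0 < r \<and> r < 1 \<longrightarrow> cmod (taylor_tail f N (of_real r * \<zeta>)) \<le> m N \<zeta>"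
    using m by blast+
  have "(\<lambda>N. 256 * energy (taylor_tail f N)) \<longlonglongrightarrow> 256 * (energy f - energy f)"
    unfolding energy_taylor_tail(2)[OF f sm]
    by (intro tendsto_intros) (simp add: energy_def summable_LIMSEQ[OF sm])
  then have E: "(\<lambda>N. 256 * energy (taylor_tail f N)) \<longlonglongrightarrow> 0" by simp
  have "(\<lambda>N. LINT \<zeta>|arc_measure. norm ((m N \<zeta>)\<^sup>2)) \<longlonglongrightarrow> 0"
  proof (rule Lim_null_comparison[OF always_eventually[rule_format] E])
    show "norm (LINT \<zeta>|arc_measure. norm ((m N \<zeta>)\<^sup>2)) \<le> 256 * energy (taylor_tail f N)" for N
    proof -
      have "0 \<le> (LINT \<zeta>|arc_measure. (m N \<zeta>)\<^sup>2)" by (rule integral_nonneg_AE) auto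
      then show ?thesis using mle[of N] by simp
    qed
  qed
  from tendsto_L1_AE_subseq[OF mint this] obtain s where s: "AE \<zeta> in arc_measure. (\<lambda>n. (m (s n) \<zeta>)\<^sup>2) \<longlonglongrightarrow> 0"
    by blast
  have mball: "AE \<zeta> in arc_measure. \<forall>N. \<forall>r. 0 < r \<and> r < 1 \<longrightarrow> cmod (taylor_tail f N (of_real r * \<zeta>)) \<le> m N \<zeta>"
    using mb by (subst AE_all_countable) blast
  show ?thesis
    using s mball AE_arc_norm
  proof eventually_elim
    fix \<zeta> assume lim: "(\<lambda>n. (m (s n) \<zeta>)\<^sup>2) \<longlonglongrightarrow> 0" and \<zeta>: "cmod \<zeta> = 1"
      and b: "\<forall>N. \<forall>r. 0 < r \<and> r < 1 \<longrightarrow> cmod (taylor_tail f N (of_real r * \<zeta>)) \<le> m N \<zeta>"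
    show "\<exists>l. ((\<lambda>r. f (of_real r * \<zeta>)) \<longlongrightarrow> l) (at_left 1)"
      unfolding at_left_limit_iff_Cauchy
    proof (intro allI impI)
      fix e :: real assume e: "e > 0"
      have "\<forall>\<^sub>F n in sequentially. (m (s n) \<zeta>)\<^sup>2 < (e/4)\<^sup>2"
        using e by (intro order_tendstoD(2)[OF lim]) simp
      then obtain n where "(m (s n) \<zeta>)\<^sup>2 < (e/4)\<^sup>2" by (auto simp: eventually_sequentially)
      then have mn: "m (s n) \<zeta> < e/4" by (rule power2_less_imp_less) (use e in simp)
      define P where "P z = (\<Sum>k<s n. tc f k * z ^ k)" for z
      have "((\<lambda>r. P (of_real r * \<zeta>)) \<longlongrightarrow> P (of_real 1 * \<zeta>)) (at_left 1)"
        unfolding P_def by (intro tendsto_intros)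
      then have "\<forall>\<^sub>F r in at_left 1. dist (P (of_real r * \<zeta>)) (P \<zeta>) < e/4"
        using e by (intro tendstoD) auto
      then obtain a where a: "a < 1" "\<And>r. a < r \<Longrightarrow> r < 1 \<Longrightarrow> dist (P (of_real r * \<zeta>)) (P \<zeta>) < e/4"
        by (auto simp: eventually_at_left_field)
      have d: "dist (f (of_real r * \<zeta>)) (P \<zeta>) < e/2" if "max 0 a < r" "r < 1" for r
      proof -
        have "taylor_tail f (s n) (of_real r * \<zeta>) = f (of_real r * \<zeta>) - P (of_real r * \<zeta>)"
          using that \<zeta> by (simp add: taylor_tail_def cut_def P_def norm_mult)
        then have "dist (f (of_real r * \<zeta>)) (P (of_real r * \<zeta>)) < e/4"
          using b[rule_format, of r "s n"] that mn by (simp add: dist_norm)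
        then show ?thesis using a(2)[of r] that dist_triangle[of "f (of_real r * \<zeta>)" "P \<zeta>" "P (of_real r * \<zeta>)"]
          by simp
      qed
      have "dist (f (of_real r * \<zeta>)) (f (of_real r' * \<zeta>)) < e"
        if "max 0 a < r" "r < 1" "max 0 a < r'" "r' < 1" for r r'
        using dist_triangle_half_l[OF d d] that by blast
      then show "\<exists>a<1. \<forall>r r'. a < r \<and> r < 1 \<and> a < r' \<and> r' < 1 \<longrightarrow> dist (f (of_real r * \<zeta>)) (f (of_real r' * \<zeta>)) < e"
        using a(1) by (intro exI[of _ "max 0 a"]) auto
    qed
  qed
qed

text \<open>Existence of the limit is a Cauchy condition over rational radii, hence a Borel
  condition. Where it holds, \<open>bdry f\<close> is a sequential limit; elsewhere on the circle
  \<open>Lim\<close> takes the constant default value \<open>THE l. False\<close>.\<close>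

lemma bdry_measurable [measurable_dest]:
  assumes f: "disc_hol f"
  shows "bdry f \<in> borel_measurable borel"
proof -
  define a where "a m = 1 - 1 / (real m + 1)" for m
  have a: "0 \<le> a m" "a m < 1" for m by (auto simp: a_def field_simps)
  define g where "g n \<zeta> = f (of_real (radii n) * \<zeta>)" for n \<zeta>
  define h where "h n \<zeta> = f (of_real (rad n) * \<zeta>)" for n \<zeta>
  have [measurable]: "g n \<in> borel_measurable borel" "h n \<in> borel_measurable borel" for n
    unfolding g_def h_def using f by simp_all
  define crit where "crit \<zeta> \<longleftrightarrow> (\<forall>k::nat. \<exists>m::nat. \<forall>i j. a m < radii i \<longrightarrow> a m < radii j \<longrightarrow>
      cmod (g i \<zeta> - g j \<zeta>) \<le> 1 / (real k + 1))" for \<zeta>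
  have crit: "crit \<zeta> \<longleftrightarrow> (\<exists>l. ((\<lambda>r. f (of_real r * \<zeta>)) \<longlongrightarrow> l) (at_left 1))" if \<zeta>: "cmod \<zeta> = 1" for \<zeta>
  proof -
    define F where "F r = f (of_real r * \<zeta>)" for r
    have contF: "continuous_on {0<..<1} F" unfolding F_def by (rule radial_continuous[OF f \<zeta>])
    have "crit \<zeta> \<longleftrightarrow> (\<forall>e>0. \<exists>b<1. \<forall>r r'. b < r \<and> r < 1 \<and> b < r' \<and> r' < 1 \<longrightarrow> dist (F r) (F r') < e)"
    proof
      assume cr: "crit \<zeta>"
      show "\<forall>e>0. \<exists>b<1. \<forall>r r'. b < r \<and> r < 1 \<and> b < r' \<and> r' < 1 \<longrightarrow> dist (F r) (F r') < e"
      proof (intro allI impI)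
        fix e :: real assume "e > 0"
        then obtain k where k: "1 / real (Suc k) < e" using nat_approx_posE by blast
        from cr obtain m where m: "\<And>i j. a m < radii i \<Longrightarrow> a m < radii j \<Longrightarrow> cmod (F (radii i) - F (radii j)) \<le> 1 / (real k + 1)"
          unfolding crit_def g_def F_def by blast
        have c: "continuous_on {a m<..<1} F" by (rule continuous_on_subset[OF contF]) (use a[of m] in auto)
        have 1: "cmod (F r - F (radii j)) \<le> 1 / (real k + 1)" if "a m < radii j" "a m < r" "r < 1" for r j
          by (rule radii_le_imp_le[of "a m" "\<lambda>r. cmod (F r - F (radii j))"])
            (use m that a c in \<open>auto intro!: continuous_on_norm continuous_on_diff continuous_on_const\<close>)
        have 2: "cmod (F r - F r') \<le> 1 / (real k + 1)" if "a m < r'" "r' < 1" "a m < r" "r < 1" for r r'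
          by (rule radii_le_imp_le[of "a m" "\<lambda>r'. cmod (F r - F r')"])
            (use 1 that a c in \<open>auto intro!: continuous_on_norm continuous_on_diff continuous_on_const\<close>)
        have "dist (F r) (F r') < e" if "a m < r'" "r' < 1" "a m < r" "r < 1" for r r'
          using 2[OF that] k by (simp add: dist_norm add.commute)
        then show "\<exists>b<1. \<forall>r r'. b < r \<and> r < 1 \<and> b < r' \<and> r' < 1 \<longrightarrow> dist (F r) (F r') < e"
          using a(2) by blast
      qed
    next
      assume *: "\<forall>e>0. \<exists>b<1. \<forall>r r'. b < r \<and> r < 1 \<and> b < r' \<and> r' < 1 \<longrightarrow> dist (F r) (F r') < e"
      show "crit \<zeta>"
        unfolding crit_def
      proof
        fix k :: nat
        obtain b where b: "b < 1" "\<And>r r'. b < r \<Longrightarrow> r < 1 \<Longrightarrow> b < r' \<Longrightarrow> r' < 1 \<Longrightarrow> dist (F r) (F r') < 1 / (real k + 1)"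
          using *[rule_format, of "1 / (real k + 1)"] by auto
        obtain m where m: "1 / real (Suc m) < 1 - b" using nat_approx_posE[of "1 - b"] b(1) by auto
        have bm: "b < a m" using m by (simp add: a_def add.commute)
        show "\<exists>m. \<forall>i j. a m < radii i \<longrightarrow> a m < radii j \<longrightarrow> cmod (g i \<zeta> - g j \<zeta>) \<le> 1 / (real k + 1)"
        proof (intro exI[of _ m] allI impI)
          fix i j assume ij: "a m < radii i" "a m < radii j"
          have "dist (F (radii i)) (F (radii j)) < 1 / (real k + 1)"
            using ij bm radii(2) by (intro b(2)) (auto intro: less_trans)
          then show "cmod (g i \<zeta> - g j \<zeta>) \<le> 1 / (real k + 1)"
            by (simp add: g_def F_def dist_norm)
        qed
      qed
    qed
    then show ?thesis unfolding at_left_limit_iff_Cauchy F_def .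
  qed
  have "bdry f = (\<lambda>\<zeta>. if cmod \<zeta> = 1 then (if crit \<zeta> then lim (\<lambda>n. h n \<zeta>) else (THE l. False)) else 0)"
  proof
    fix \<zeta> :: complex
    show "bdry f \<zeta> = (if cmod \<zeta> = 1 then (if crit \<zeta> then lim (\<lambda>n. h n \<zeta>) else (THE l. False)) else 0)"
    proof (cases "cmod \<zeta> = 1 \<and> crit \<zeta>")
      case True
      then obtain l where l: "((\<lambda>r. f (of_real r * \<zeta>)) \<longlongrightarrow> l) (at_left 1)" using crit by blast
      have "(\<lambda>n. h n \<zeta>) \<longlonglongrightarrow> l" unfolding h_def by (rule filterlim_compose[OF l rad_at_left])
      then have "lim (\<lambda>n. h n \<zeta>) = l" by (rule limI)
      moreover have "Lim (at_left (1::real)) (\<lambda>r. f (of_real r * \<zeta>)) = l" by (rule tendsto_Lim[OF _ l]) simp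
      ultimately show ?thesis using True by (simp add: bdry_def)
    next
      case False
      have "Lim (at_left (1::real)) (\<lambda>r. f (of_real r * \<zeta>)) = (THE l. False)" if "cmod \<zeta> = 1"
        unfolding t2_space_class.Lim_def using False crit[OF that] that by (intro arg_cong[where f = The]) auto
      then show ?thesis using False by (simp add: bdry_def)
    qed
  qed
  also have "\<dots> \<in> borel_measurable borel" unfolding crit_def by measurable
  finally show ?thesis .
qed

lemma bdry_tendsto:
  assumes f: "disc_hol f" and sm: "summable (\<lambda>n. (cmod (tc f n))\<^sup>2)"
  shows "AE \<zeta> in arc_measure. ((\<lambda>r. f (of_real r * \<zeta>)) \<longlongrightarrow> bdry f \<zeta>) (at_left 1)"
  using radial_limit_exists[OF f sm] AE_arc_norm
proof eventually_elim
  fix \<zeta> assume "\<exists>l. ((\<lambda>r. f (of_real r * \<zeta>)) \<longlongrightarrow> l) (at_left 1)" and \<zeta>: "cmod \<zeta> = 1"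
  then obtain l where l: "((\<lambda>r. f (of_real r * \<zeta>)) \<longlongrightarrow> l) (at_left 1)" by blast
  moreover have "Lim (at_left (1::real)) (\<lambda>r. f (of_real r * \<zeta>)) = l" by (rule tendsto_Lim[OF _ l]) simp
  ultimately show "((\<lambda>r. f (of_real r * \<zeta>)) \<longlongrightarrow> bdry f \<zeta>) (at_left 1)" using \<zeta> by (simp add: bdry_def)
qed

lemma bdry_eqI: "cmod \<zeta> = 1 \<Longrightarrow> ((\<lambda>r. f (of_real r * \<zeta>)) \<longlongrightarrow> l) (at_left 1) \<Longrightarrow> bdry f \<zeta> = l"
  by (auto simp: bdry_def intro!: tendsto_Lim)

section \<open>\<open>H2\<close> as the space of square summable Taylor coefficients\<close>

section \<open>The Hardy space as a Hilbert space\<close>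

text \<open>The mean over the circle of radius r is the sum of |tc f n|^2 r^(2n). Letting r tend to
  1 in its partial sums gives summability; the converse is termwise comparison.\<close>

lemma H2_iff: "f \<in> H2 \<longleftrightarrow> disc_hol f \<and> summable (\<lambda>n. (cmod (tc f n))\<^sup>2)"
proof
  assume fH: "f \<in> H2"
  then have f: "disc_hol f" by (auto simp: H2_def disc_hol_def)
  obtain C where C: "\<And>r. 0 \<le> r \<Longrightarrow> r < 1 \<Longrightarrow> (LINT \<zeta>|arc_measure. (cmod (f (of_real r * \<zeta>)))\<^sup>2) \<le> C"
    using fH by (auto simp: H2_def)
  have "summable (\<lambda>n. (cmod (tc f n))\<^sup>2)"
  proof (rule summableI_nonneg_bounded)
    fix N
    show "(\<Sum>n<N. (cmod (tc f n))\<^sup>2) \<le> C"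
    proof (rule LIMSEQ_le_const2)
      have "(\<lambda>i. \<Sum>n<N. (cmod (tc f n))\<^sup>2 * ((rad i)\<^sup>2) ^ n) \<longlonglongrightarrow> (\<Sum>n<N. (cmod (tc f n))\<^sup>2 * (1\<^sup>2) ^ n)"
        by (intro tendsto_intros rad_tendsto)
      then show "(\<lambda>i. \<Sum>n<N. (cmod (tc f n))\<^sup>2 * ((rad i)\<^sup>2) ^ n) \<longlonglongrightarrow> (\<Sum>n<N. (cmod (tc f n))\<^sup>2)" by simp
      have "(\<Sum>n<N. (cmod (tc f n))\<^sup>2 * ((rad i)\<^sup>2) ^ n) \<le> C" for i
        using sum_le_suminf[OF sums_summable[OF circle_mean_sq_sums[OF f rad(3) rad(2)]], of "{..<N}" i]
          sums_unique[OF circle_mean_sq_sums[OF f rad(3) rad(2)], of i] C[OF rad(3) rad(2), of i]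
        by simp
      then show "\<exists>M. \<forall>i\<ge>M. (\<Sum>n<N. (cmod (tc f n))\<^sup>2 * ((rad i)\<^sup>2) ^ n) \<le> C" by blast
    qed
  qed simp
  then show "disc_hol f \<and> summable (\<lambda>n. (cmod (tc f n))\<^sup>2)" using f by blast
next
  assume "disc_hol f \<and> summable (\<lambda>n. (cmod (tc f n))\<^sup>2)"
  then show "f \<in> H2" using circle_mean_sq_le_energy[of f]
    by (auto simp: H2_def disc_hol_def)
qed

lemma H2_disc_hol: "f \<in> H2 \<Longrightarrow> disc_hol f" and H2_summable: "f \<in> H2 \<Longrightarrow> summable (\<lambda>n. (cmod (tc f n))\<^sup>2)"
  by (simp_all add: H2_iff)

lemma bdry_H2_measurable [measurable_dest]: "f \<in> H2 \<Longrightarrow> bdry f \<in> borel_measurable borel"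
  by (intro bdry_measurable H2_disc_hol)

text \<open>Dominated convergence, with the squares of the two radial maximal functions as majorant.
  The inner product, defined by boundary values, becomes a limit over interior circles.\<close>

lemma H2_pair_limit:
  assumes f: "f \<in> H2" and g: "g \<in> H2"
  shows bdry_product_integrable: "integrable arc_measure (\<lambda>\<zeta>. bdry f \<zeta> * cnj (bdry g \<zeta>))"
    and circle_inner_tendsto: "(\<lambda>n. LINT \<zeta>|arc_measure. f (of_real (rad n) * \<zeta>) * cnj (g (of_real (rad n) * \<zeta>)))
      \<longlonglongrightarrow> H2_inner f g"
proof -
  note fd = H2_disc_hol[OF f] and gd = H2_disc_hol[OF g]
  have [measurable]: "bdry f \<in> borel_measurable borel" "bdry g \<in> borel_measurable borel"
    "(\<lambda>\<zeta>. f (of_real (rad n) * \<zeta>)) \<in> borel_measurable borel" "(\<lambda>\<zeta>. g (of_real (rad n) * \<zeta>)) \<in> borel_measurable borel" for n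
    using f g fd gd by simp_all
  obtain mf where mf [measurable]: "mf \<in> borel_measurable borel" and mf0: "\<And>\<zeta>. 0 \<le> mf \<zeta>"
    and mfi: "integrable arc_measure (\<lambda>\<zeta>. (mf \<zeta>)\<^sup>2)"
    and mfb: "AE \<zeta> in arc_measure. \<forall>r. 0 < r \<and> r < 1 \<longrightarrow> cmod (f (of_real r * \<zeta>)) \<le> mf \<zeta>"
    using radial_maximal[OF fd H2_summable[OF f]] by blast
  obtain mg where mg [measurable]: "mg \<in> borel_measurable borel" and mg0: "\<And>\<zeta>. 0 \<le> mg \<zeta>"
    and mgi: "integrable arc_measure (\<lambda>\<zeta>. (mg \<zeta>)\<^sup>2)"
    and mgb: "AE \<zeta> in arc_measure. \<forall>r. 0 < r \<and> r < 1 \<longrightarrow> cmod (g (of_real r * \<zeta>)) \<le> mg \<zeta>"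
    using radial_maximal[OF gd H2_summable[OF g]] by blast
  let ?w = "\<lambda>\<zeta>. (mf \<zeta>)\<^sup>2 + (mg \<zeta>)\<^sup>2"
  have w: "integrable arc_measure ?w" by (intro Bochner_Integration.integrable_add mfi mgi)
  have lim: "AE \<zeta> in arc_measure. (\<lambda>n. f (of_real (rad n) * \<zeta>) * cnj (g (of_real (rad n) * \<zeta>))) \<longlonglongrightarrow> bdry f \<zeta> * cnj (bdry g \<zeta>)"
    using bdry_tendsto[OF fd H2_summable[OF f]] bdry_tendsto[OF gd H2_summable[OF g]]
  proof eventually_elim
    fix \<zeta> assume 1: "((\<lambda>r. f (of_real r * \<zeta>)) \<longlongrightarrow> bdry f \<zeta>) (at_left 1)" and 2: "((\<lambda>r. g (of_real r * \<zeta>)) \<longlongrightarrow> bdry g \<zeta>) (at_left 1)"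
    show "(\<lambda>n. f (of_real (rad n) * \<zeta>) * cnj (g (of_real (rad n) * \<zeta>))) \<longlonglongrightarrow> bdry f \<zeta> * cnj (bdry g \<zeta>)"
      by (intro tendsto_intros filterlim_compose[OF 1 rad_at_left] filterlim_compose[OF 2 rad_at_left])
  qed
  have dom: "AE \<zeta> in arc_measure. norm (f (of_real (rad n) * \<zeta>) * cnj (g (of_real (rad n) * \<zeta>))) \<le> ?w \<zeta>" for n
    using mfb mgb
  proof eventually_elim
    fix \<zeta> assume 1: "\<forall>r. 0 < r \<and> r < 1 \<longrightarrow> cmod (f (of_real r * \<zeta>)) \<le> mf \<zeta>" and 2: "\<forall>r. 0 < r \<and> r < 1 \<longrightarrow> cmod (g (of_real r * \<zeta>)) \<le> mg \<zeta>"
    have "norm (f (of_real (rad n) * \<zeta>) * cnj (g (of_real (rad n) * \<zeta>))) \<le> mf \<zeta> * mg \<zeta>"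
      unfolding norm_mult complex_mod_cnj using 1 2 rad mf0 by (intro mult_mono) auto
    also have "\<dots> \<le> ?w \<zeta>"
      using sum_squares_bound[of "mf \<zeta>" "mg \<zeta>"] mult_nonneg_nonneg[OF mf0[of \<zeta>] mg0[of \<zeta>]] by linarith
    finally show "norm (f (of_real (rad n) * \<zeta>) * cnj (g (of_real (rad n) * \<zeta>))) \<le> ?w \<zeta>" .
  qed
  show "integrable arc_measure (\<lambda>\<zeta>. bdry f \<zeta> * cnj (bdry g \<zeta>))"
    by (rule integrable_dominated_convergence[OF _ _ w lim dom]) measurable
  show "(\<lambda>n. LINT \<zeta>|arc_measure. f (of_real (rad n) * \<zeta>) * cnj (g (of_real (rad n) * \<zeta>))) \<longlonglongrightarrow> H2_inner f g"
    unfolding H2_inner_def L2_inner_def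
    by (rule integral_dominated_convergence[OF _ _ w lim dom]) measurable
qed

lemma summable_tc_product:
  assumes f: "f \<in> H2" and g: "g \<in> H2"
  shows "summable (\<lambda>n. cmod (tc f n) * cmod (tc g n))"
proof (rule summable_comparison_test_ev[OF _ summable_add[OF H2_summable[OF f] H2_summable[OF g]]], intro always_eventually allI)
  fix n
  show "norm (cmod (tc f n) * cmod (tc g n)) \<le> (cmod (tc f n))\<^sup>2 + (cmod (tc g n))\<^sup>2"
  proof -
    have nn: "0 \<le> cmod (tc f n) * cmod (tc g n)" by simp
    show ?thesis
      using nn sum_squares_bound[of "cmod (tc f n)" "cmod (tc g n)"]
      unfolding real_norm_def abs_of_nonneg[OF nn] by linarith
  qed
qed

text \<open>The circle integrals converge to the inner product and, by Tannery's theorem, to the sum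
  over coefficients.\<close>

lemma H2_inner_sums:
  assumes f: "f \<in> H2" and g: "g \<in> H2"
  shows "(\<lambda>n. tc f n * cnj (tc g n)) sums H2_inner f g"
proof -
  note fd = H2_disc_hol[OF f] and gd = H2_disc_hol[OF g]
  let ?b = "\<lambda>k. tc f k * cnj (tc g k)"
  let ?a = "\<lambda>k n. ?b k * of_real (rad n * rad n) ^ k"
  have T: "summable (\<lambda>k. norm (?b k)) \<and> (\<lambda>n. \<Sum>k. ?a k n) \<longlonglongrightarrow> (\<Sum>k. ?b k)"
  proof -
    have "(\<lambda>n. ?a k n) \<longlonglongrightarrow> ?b k * of_real (1 * 1) ^ k" for k
      by (intro tendsto_intros rad_tendsto)
    moreover have "norm (?a k n) \<le> cmod (tc f k) * cmod (tc g k)" for k n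
    proof -
      have "norm (?a k n) = cmod (tc f k) * cmod (tc g k) * (rad n * rad n) ^ k"
        using rad(3)[of n] by (simp add: norm_mult norm_power power_mult_distrib)
      also have "\<dots> \<le> cmod (tc f k) * cmod (tc g k) * 1"
        using rad[of n] by (intro mult_left_mono power_le_one mult_le_one) auto
      finally show ?thesis by simp
    qed
    ultimately show ?thesis
      using tannerys_theorem[of ?a ?b sequentially "\<lambda>k. cmod (tc f k) * cmod (tc g k)"] summable_tc_product[OF f g]
      by (simp add: case_prod_unfold)
  qed
  have "(\<Sum>k. ?a k n) = (LINT \<zeta>|arc_measure. f (of_real (rad n) * \<zeta>) * cnj (g (of_real (rad n) * \<zeta>)))" for n
    by (rule sums_unique[OF circle_parseval[OF fd gd rad(3) rad(2) rad(3) rad(2)], symmetric])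
  then have "(\<Sum>k. ?b k) = H2_inner f g" using T circle_inner_tendsto[OF f g] LIMSEQ_unique by auto
  moreover have "summable ?b" by (rule summable_norm_cancel[OF conjunct1[OF T]])
  ultimately show ?thesis by (simp add: sums_iff)
qed

lemma coefficients_to_H2:
  assumes a: "summable (\<lambda>n. (cmod (a n))\<^sup>2)"
  shows "\<exists>f\<in>H2. \<forall>n. tc f n = a n"
proof -
  have "(\<lambda>n. (cmod (a n))\<^sup>2) \<longlonglongrightarrow> 0" by (rule summable_LIMSEQ_zero[OF a])
  then have "Bseq (\<lambda>n. (cmod (a n))\<^sup>2)" by (rule convergent_imp_Bseq[OF convergentI])
  then obtain B where B: "\<And>n. (cmod (a n))\<^sup>2 \<le> B" by (auto simp: Bseq_def)
  \<comment> \<open>From 2 x <= x^2 + 1.\<close>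
  have le: "cmod (a n) \<le> 1 + B" for n
    using B[of n] sum_squares_bound[of "cmod (a n)" 1] norm_ge_zero[of "a n"] by (simp only: mult_1_right power_one)
  have sm: "(\<lambda>n. a n * (z - 0) ^ n) sums (\<Sum>n. a n * z ^ n)" if z: "z \<in> ball 0 1" for z
  proof -
    have "summable (\<lambda>n. (1 + B) * cmod z ^ n)" using z by (intro summable_mult summable_geometric) simp
    then have "summable (\<lambda>n. a n * z ^ n)"
      by (rule summable_comparison_test_ev[rotated]) (auto intro!: always_eventually mult_right_mono le simp: norm_mult norm_power)
    then show ?thesis by (simp add: summable_sums)
  qed
  define f where "f = cut (\<lambda>z. \<Sum>n. a n * z ^ n)"
  have f: "disc_hol f" unfolding f_def
    by (rule disc_hol_cut, rule power_series_holomorphic[of 0 1 a]) (use sm in auto)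
  have tc: "tc f n = a n" for n
    by (rule tc_unique[OF f]) (use sm in \<open>auto simp: f_def cut_def\<close>)
  then have "f \<in> H2" using f a by (simp add: H2_iff)
  then show ?thesis using tc by blast
qed

lemma H2_eqI: "f \<in> H2 \<Longrightarrow> g \<in> H2 \<Longrightarrow> (\<And>n. tc f n = tc g n) \<Longrightarrow> f = g"
proof -
  assume f: "f \<in> H2" and g: "g \<in> H2" and eq: "\<And>n. tc f n = tc g n"
  show "f = g"
  proof (rule disc_hol_eqI)
    fix z :: complex assume "cmod z < 1"
    then show "f z = g z"
      using tc_sums[OF H2_disc_hol[OF f], of z] tc_sums[OF H2_disc_hol[OF g], of z] eq sums_unique2 by auto
  qed (use f g H2_disc_hol in auto)
qed

lemma tc_plus: "f \<in> H2 \<Longrightarrow> g \<in> H2 \<Longrightarrow> tc (f + g) n = tc f n + tc g n"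
  using tc_add'[OF H2_disc_hol H2_disc_hol] by (simp add: plus_fun_def)

lemma tc_cs: "f \<in> H2 \<Longrightarrow> tc (cs c f) n = c * tc f n"
  using tc_scale[OF H2_disc_hol] by (simp add: cs_def)

lemma H2_add: "f \<in> H2 \<Longrightarrow> g \<in> H2 \<Longrightarrow> f + g \<in> H2"
proof -
  assume f: "f \<in> H2" and g: "g \<in> H2"
  have "summable (\<lambda>n. (cmod (tc (f + g) n))\<^sup>2)"
  proof (rule summable_comparison_test_ev, intro always_eventually allI)
    show "summable (\<lambda>n. 2 * (cmod (tc f n))\<^sup>2 + 2 * (cmod (tc g n))\<^sup>2)"
      by (intro summable_add summable_mult H2_summable f g)
    fix n
    have "(cmod (tc f n + tc g n))\<^sup>2 \<le> (cmod (tc f n) + cmod (tc g n))\<^sup>2"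
      by (intro power_mono norm_triangle_ineq) simp
    also have "\<dots> \<le> 2 * (cmod (tc f n))\<^sup>2 + 2 * (cmod (tc g n))\<^sup>2"
      using sum_squares_bound[of "cmod (tc f n)" "cmod (tc g n)"] by (simp add: power2_sum)
    finally show "norm ((cmod (tc (f + g) n))\<^sup>2) \<le> 2 * (cmod (tc f n))\<^sup>2 + 2 * (cmod (tc g n))\<^sup>2"
      using f g by (simp add: tc_plus)
  qed
  moreover have "disc_hol (f + g)" using tc_add H2_disc_hol[OF f] H2_disc_hol[OF g] by (simp add: plus_fun_def)
  ultimately show ?thesis by (simp add: H2_iff)
qed

lemma H2_cs: "f \<in> H2 \<Longrightarrow> cs c f \<in> H2"
proof -
  assume f: "f \<in> H2"
  have "summable (\<lambda>n. (cmod c)\<^sup>2 * (cmod (tc f n))\<^sup>2)" by (intro summable_mult H2_summable f)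
  then have "summable (\<lambda>n. (cmod (tc (cs c f) n))\<^sup>2)" using f by (simp add: tc_cs norm_mult power_mult_distrib)
  then show ?thesis using disc_hol_scale[OF H2_disc_hol[OF f], of c] by (simp add: H2_iff cs_def)
qed

lemma H2_zero: "0 \<in> H2"
  using H2_cs[of _ 0] coefficients_to_H2[of "\<lambda>n. 0"] by (auto simp: cs_zero)

lemma H2_inner_self: "f \<in> H2 \<Longrightarrow> H2_inner f f = of_real (energy f)"
proof -
  assume f: "f \<in> H2"
  have "(\<lambda>n. complex_of_real ((cmod (tc f n))\<^sup>2)) sums of_real (energy f)"
    unfolding energy_def by (intro sums_of_real summable_sums H2_summable f)
  moreover have "(\<lambda>n. complex_of_real ((cmod (tc f n))\<^sup>2)) sums H2_inner f f"
    using H2_inner_sums[OF f f] by (simp only: complex_norm_square)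
  ultimately show ?thesis by (rule sums_unique2[symmetric])
qed

lemma H2_hnorm_sq: "f \<in> H2 \<Longrightarrow> (hnorm H2_inner f)\<^sup>2 = energy f"
  using suminf_nonneg[OF H2_summable] by (simp add: hnorm_def H2_inner_self energy_def)

lemma H2_coefficient_le: "f \<in> H2 \<Longrightarrow> (\<Sum>n<N. (cmod (tc f n))\<^sup>2) \<le> (hnorm H2_inner f)\<^sup>2"
  unfolding H2_hnorm_sq energy_def by (intro sum_le_suminf H2_summable) auto

lemma H2_complete:
  assumes s: "\<And>n. s n \<in> H2" and C: "\<And>e. e > 0 \<Longrightarrow> \<exists>M. \<forall>m\<ge>M. \<forall>n\<ge>M. hnorm H2_inner (s m - s n) < e"
  shows "\<exists>l\<in>H2. (\<lambda>n::nat. hnorm H2_inner (s n - l)) \<longlonglongrightarrow> 0"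
proof -
  have minus: "f - g = f + cs (-1) g" for f g by (simp add: cs_minus_one)
  have diff: "f - g \<in> H2" "tc (f - g) k = tc f k - tc g k" if "f \<in> H2" "g \<in> H2" for f g k
    using that unfolding minus by (auto simp: H2_add H2_cs tc_plus tc_cs)
  have hn0: "0 \<le> hnorm H2_inner f" if "f \<in> H2" for f
    using that suminf_nonneg[OF H2_summable[OF that]] by (simp add: hnorm_def H2_inner_self energy_def)
  have conv: "convergent (\<lambda>n. tc (s n) k)" for k
  proof -
    have "Cauchy (\<lambda>n. tc (s n) k)"
      unfolding Cauchy_def
    proof (intro allI impI)
      fix e :: real assume e: "e > 0"
      obtain M where M: "\<And>m n. m \<ge> M \<Longrightarrow> n \<ge> M \<Longrightarrow> hnorm H2_inner (s m - s n) < e" using C[OF e] by blast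
      have "dist (tc (s m) k) (tc (s n) k) < e" if "m \<ge> M" "n \<ge> M" for m n
      proof -
        have "(cmod (tc (s m - s n) k))\<^sup>2 \<le> (\<Sum>i<Suc k. (cmod (tc (s m - s n) i))\<^sup>2)"
          by (rule member_le_sum) auto
        also have "\<dots> \<le> (hnorm H2_inner (s m - s n))\<^sup>2" by (intro H2_coefficient_le diff s)
        finally have "cmod (tc (s m - s n) k) \<le> hnorm H2_inner (s m - s n)"
          by (rule power2_le_imp_le) (intro hn0 diff s)
        then show ?thesis using M[OF that] s by (simp add: dist_norm diff)
      qed
      then show "\<exists>M. \<forall>m\<ge>M. \<forall>n\<ge>M. dist (tc (s m) k) (tc (s n) k) < e" by blast
    qed
    then show ?thesis by (simp add: Cauchy_convergent_iff)
  qed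
  define a where "a k = lim (\<lambda>n. tc (s n) k)" for k
  have a: "(\<lambda>n. tc (s n) k) \<longlonglongrightarrow> a k" for k
    using conv unfolding a_def by (simp add: convergent_LIMSEQ_iff)
  have part: "(\<Sum>k<N. (cmod (tc (s m) k - a k))\<^sup>2) \<le> e\<^sup>2"
    if M: "\<And>n. n \<ge> M \<Longrightarrow> hnorm H2_inner (s m - s n) < e" for m N e M
  proof (rule LIMSEQ_le_const2)
    show "(\<lambda>n. \<Sum>k<N. (cmod (tc (s m) k - tc (s n) k))\<^sup>2) \<longlonglongrightarrow> (\<Sum>k<N. (cmod (tc (s m) k - a k))\<^sup>2)"
      by (intro tendsto_intros a)
    have "(\<Sum>k<N. (cmod (tc (s m) k - tc (s n) k))\<^sup>2) \<le> e\<^sup>2" if "n \<ge> M" for n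
    proof -
      have "(\<Sum>k<N. (cmod (tc (s m) k - tc (s n) k))\<^sup>2) \<le> (hnorm H2_inner (s m - s n))\<^sup>2"
        using H2_coefficient_le[OF diff(1)[OF s s], where N = N] by (simp add: diff s)
      also have "\<dots> \<le> e\<^sup>2" using M[OF that] by (intro power_mono hn0 diff s) auto
      finally show ?thesis .
    qed
    then show "\<exists>M. \<forall>n\<ge>M. (\<Sum>k<N. (cmod (tc (s m) k - tc (s n) k))\<^sup>2) \<le> e\<^sup>2" by blast
  qed
  obtain M1 where M1: "\<And>m n. m \<ge> M1 \<Longrightarrow> n \<ge> M1 \<Longrightarrow> hnorm H2_inner (s m - s n) < 1" using C[of 1] by auto
  \<comment> \<open>Not the limit coefficients but their differences from those of
    \<open>s M1\<close> are bounded by partial sums; so the limit is built as \<open>s M1\<close>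
    minus an element of \<open>H2\<close>.\<close>
  have "summable (\<lambda>k. (cmod (tc (s M1) k - a k))\<^sup>2)"
    by (rule summableI_nonneg_bounded[of _ "1\<^sup>2"]) (use part[OF M1[of M1]] in auto)
  from coefficients_to_H2[OF this] obtain d where d: "d \<in> H2" "\<forall>k. tc d k = tc (s M1) k - a k" ..
  define l where "l = s M1 - d"
  have l: "l \<in> H2" "\<And>k. tc l k = a k" unfolding l_def using d s by (auto simp: diff)
  have "(\<lambda>n. hnorm H2_inner (s n - l)) \<longlonglongrightarrow> 0"
  proof (rule LIMSEQ_I)
    fix e :: real assume e: "e > 0"
    obtain M where M: "\<And>m n. m \<ge> M \<Longrightarrow> n \<ge> M \<Longrightarrow> hnorm H2_inner (s m - s n) < e/2" using C[of "e/2"] e by auto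
    have "norm (hnorm H2_inner (s m - l) - 0) < e" if m: "m \<ge> M" for m
    proof -
      have "(hnorm H2_inner (s m - l))\<^sup>2 \<le> (e/2)\<^sup>2"
        unfolding H2_hnorm_sq[OF diff(1)[OF s l(1)]] energy_def
        using part[OF M[OF m]] H2_summable[OF diff(1)[OF s l(1)]]
        by (intro suminf_le_const) (auto simp: diff s l)
      then have "hnorm H2_inner (s m - l) \<le> e/2" by (rule power2_le_imp_le) (use e in simp)
      then show ?thesis using e hn0[OF diff(1)[OF s l(1)], of m] by simp
    qed
    then show "\<exists>M. \<forall>n\<ge>M. norm (hnorm H2_inner (s n - l) - 0) < e" by blast
  qed
  then show ?thesis using l(1) by blast
qed

interpretation H2: hilbert H2 H2_inner
proof
  fix f g h :: cfun and c :: complex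
  assume f: "f \<in> H2"
  show "cs c f \<in> H2" by (rule H2_cs[OF f])
  show "0 \<le> Re (H2_inner f f)" using f suminf_nonneg[OF H2_summable[OF f]] by (simp add: H2_inner_self energy_def)
  show "f = 0" if "H2_inner f f = 0"
  proof (rule H2_eqI[OF f H2_zero])
    fix n
    have "energy f = 0" using that H2_inner_self[OF f] by simp
    then have "(cmod (tc f n))\<^sup>2 = 0" using suminf_eq_zero_iff[OF H2_summable[OF f]] by (simp add: energy_def)
    moreover have "tc 0 n = 0" using tc_cs[OF H2_zero, of 0 n] by (simp add: cs_zero)
    ultimately show "tc f n = tc 0 n" by simp
  qed
  assume h: "h \<in> H2"
  show "H2_inner (cs c f) h = c * H2_inner f h"
    by (rule sums_unique2[OF H2_inner_sums[OF H2_cs[OF f] h]])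
      (use sums_mult[OF H2_inner_sums[OF f h], of c] f in \<open>simp add: tc_cs mult.assoc\<close>)
  show "H2_inner h f = cnj (H2_inner f h)"
    by (rule sums_unique2[OF H2_inner_sums[OF h f]])
      (use sums_cnj[THEN iffD2, OF H2_inner_sums[OF f h]] in \<open>simp add: mult.commute\<close>)
  assume g: "g \<in> H2"
  show "f + g \<in> H2" by (rule H2_add[OF f g])
  show "H2_inner (f + g) h = H2_inner f h + H2_inner g h"
    by (rule sums_unique2[OF H2_inner_sums[OF H2_add[OF f g] h]])
      (use sums_add[OF H2_inner_sums[OF f h] H2_inner_sums[OF g h]] f g in \<open>simp add: tc_plus distrib_right\<close>)
qed (use H2_zero H2_complete in auto)


section \<open>The range of a self-adjoint operator with the transported inner product\<close>

section \<open>Operator ranges\<close>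

text \<open>Abstract form of the construction of the space: \<open>R\<close> stands for
  \<open>defect_sqrt b\<close>, \<open>lift\<close> for \<open>Hb_lift b\<close> and
  \<open>rip\<close> for \<open>Hb_inner b\<close>.\<close>

locale operator_range = hilbert +
  fixes R
  assumes R: "linop R" and R_bounded: "\<exists>C. \<forall>f\<in>V. nrm (R f) \<le> C * nrm f"
    and R_sym: "\<And>f g. f \<in> V \<Longrightarrow> g \<in> V \<Longrightarrow> ip (R f) g = ip f (R g)"
begin

definition lift :: "cfun \<Rightarrow> cfun" where
  "lift u = (THE f. f \<in> V \<and> R f = u \<and> (\<forall>k\<in>V. R k = 0 \<longrightarrow> ip f k = 0))"

definition rip :: "cfun \<Rightarrow> cfun \<Rightarrow> complex" where
  "rip u v = ip (lift u) (lift v)"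

lemma R_in: "f \<in> V \<Longrightarrow> R f \<in> V"
  and R_add: "f \<in> V \<Longrightarrow> g \<in> V \<Longrightarrow> R (f + g) = R f + R g"
  and R_cs: "f \<in> V \<Longrightarrow> R (cs c f) = cs c (R f)"
  using R by (auto simp: linop_def)

lemma R_diff: "f \<in> V \<Longrightarrow> g \<in> V \<Longrightarrow> R (f - g) = R f - R g"
  by (rule linop_diff[OF R])

lemma tends_R: "tends s l \<Longrightarrow> tends (\<lambda>n. R (s n)) (R l)"
proof -
  obtain C where "\<And>f. f \<in> V \<Longrightarrow> nrm (R f) \<le> C * nrm f" using R_bounded by blast
  then show "tends s l \<Longrightarrow> tends (\<lambda>n. R (s n)) (R l)" using tends_bounded_op[OF R] by blast
qed

lemma lift_unique:
  assumes f: "f \<in> V" and orth: "\<And>k. k \<in> V \<Longrightarrow> R k = 0 \<Longrightarrow> ip f k = 0"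
  shows "lift (R f) = f"
  unfolding lift_def
proof (rule the_equality)
  show "f \<in> V \<and> R f = R f \<and> (\<forall>k\<in>V. R k = 0 \<longrightarrow> ip f k = 0)" using assms by blast
  fix g assume g: "g \<in> V \<and> R g = R f \<and> (\<forall>k\<in>V. R k = 0 \<longrightarrow> ip g k = 0)"
  then have d: "g - f \<in> V" "R (g - f) = 0" using f by (auto simp: V_diff R_diff)
  then have "ip g (g - f) = 0" "ip f (g - f) = 0" using g orth by blast+
  then have "ip (g - f) (g - f) = 0" using g f d by (simp add: ip_diff_left)
  then have "g - f = 0" by (rule ip_definite[OF d(1)])
  then show "g = f" by simp
qed

text \<open>The projection of \<open>f\<close> onto the kernel is subtracted; it stays in the kernel
  because \<open>R\<close> is continuous.\<close>

lemma lift_exists: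
  assumes f: "f \<in> V"
  shows "\<exists>g\<in>V. R g = R f \<and> (\<forall>k\<in>V. R k = 0 \<longrightarrow> ip g k = 0)"
proof -
  let ?W = "{k \<in> V. R k = 0}"
  have W: "subsp ?W"
    unfolding subsp_def using V_closed R_add R_cs linop_zero[OF R] by (auto simp: cs_zero_right)
  have "\<exists>g s. tends s g \<and> (\<forall>n. s n \<in> ?W) \<and> (\<forall>w\<in>?W. ip w f = ip w g) \<and> nrm g \<le> max 0 (nrm f)"
    using f Cauchy_Schwarz by (intro riesz_subspace[OF W]) (auto simp: ip_simps mult.commute[of "nrm f"])
  then obtain g s where g: "tends s g" "\<And>n. s n \<in> ?W" "\<And>w. w \<in> ?W \<Longrightarrow> ip w f = ip w g" by blast
  have gV: "g \<in> V" using g(1) by (simp add: tends_def)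
  have "tends (\<lambda>n. R (s n)) (R g)" by (rule tends_R[OF g(1)])
  moreover have "(\<lambda>n. R (s n)) = (\<lambda>n. 0)" using g(2) by auto
  ultimately have "R g = 0" using tends_unique[of "\<lambda>n. 0" "R g" 0] tends_const[OF V_zero] by simp
  then have "R (f - g) = R f" using f gV by (simp add: R_diff)
  moreover have "ip (f - g) k = 0" if k: "k \<in> V" "R k = 0" for k
  proof -
    have "ip k (f - g) = 0" using g(3)[of k] k f gV by (simp add: ip_diff_right)
    then show ?thesis using ip_commute[OF k(1) V_diff[OF f gV]] by simp
  qed
  ultimately show ?thesis using V_diff[OF f gV] by blast
qed

lemma lift:
  assumes u: "u \<in> R ` V"
  shows lift_in: "lift u \<in> V" and R_lift: "R (lift u) = u"
    and lift_orth: "\<And>k. k \<in> V \<Longrightarrow> R k = 0 \<Longrightarrow> ip (lift u) k = 0"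
proof -
  obtain f where f: "f \<in> V" "u = R f" using u by blast
  obtain g where g: "g \<in> V" "R g = R f" "\<And>k. k \<in> V \<Longrightarrow> R k = 0 \<Longrightarrow> ip g k = 0"
    using lift_exists[OF f(1)] by blast
  have "lift u = g" using lift_unique[OF g(1,3)] g(2) f(2) by simp
  then show "lift u \<in> V" "R (lift u) = u" "\<And>k. k \<in> V \<Longrightarrow> R k = 0 \<Longrightarrow> ip (lift u) k = 0"
    using g f by auto
qed

text \<open>By symmetry \<open>R h\<close> is orthogonal to the kernel. Hence on the range of the
  square of \<open>R\<close> the lift, and with it the inner product, is explicit.\<close>

lemma lift_RR: "h \<in> V \<Longrightarrow> lift (R (R h)) = R h"
  by (rule lift_unique) (auto simp: R_in R_sym ip_zero_right)

lemma range_add: "u \<in> R ` V \<Longrightarrow> v \<in> R ` V \<Longrightarrow> u + v \<in> R ` V"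
  using V_add R_add by (metis (no_types, lifting) imageE image_eqI)

lemma range_cs: "u \<in> R ` V \<Longrightarrow> cs c u \<in> R ` V"
  using V_cs R_cs by (metis (no_types, lifting) imageE image_eqI)

lemma lift_add:
  assumes u: "u \<in> R ` V" and v: "v \<in> R ` V"
  shows "lift (u + v) = lift u + lift v"
  using lift_unique[of "lift u + lift v"] u v
  by (simp add: V_add R_add lift_in R_lift lift_orth ip_add_left)

lemma lift_cs:
  assumes u: "u \<in> R ` V"
  shows "lift (cs c u) = cs c (lift u)"
  using lift_unique[of "cs c (lift u)"] u
  by (simp add: V_cs R_cs lift_in R_lift lift_orth ip_cs_left)

lemma hnorm_rip: "hnorm rip u = nrm (lift u)"
  by (simp add: hnorm_def rip_def)

lemma range_subset: "R ` V \<subseteq> V"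
  using R_in by auto

lemma hilbert_range: "hilbert (R ` V) rip"
proof
  have z: "R 0 = 0" by (rule linop_zero[OF R])
  show zero: "0 \<in> R ` V" using z V_zero by (metis image_eqI)
  fix f g h :: cfun and c :: complex
  assume f: "f \<in> R ` V"
  show "cs c f \<in> R ` V" by (rule range_cs[OF f])
  show "0 \<le> Re (rip f f)" using ip_pos[OF lift_in[OF f]] by (simp add: rip_def)
  show "f = 0" if "rip f f = 0"
    using ip_definite[OF lift_in[OF f]] that R_lift[OF f] z by (simp add: rip_def)
  assume h: "h \<in> R ` V"
  show "rip (cs c f) h = c * rip f h"
    using f h by (simp add: rip_def lift_cs ip_cs_left lift_in)
  show "rip h f = cnj (rip f h)"
    unfolding rip_def by (rule ip_commute[OF lift_in[OF f] lift_in[OF h]])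
  assume g: "g \<in> R ` V"
  show "f + g \<in> R ` V" by (rule range_add[OF f g])
  show "rip (f + g) h = rip f h + rip g h"
    using f g h by (simp add: rip_def lift_add ip_add_left lift_in)
next
  fix s :: "nat \<Rightarrow> cfun"
  assume s: "\<And>n. s n \<in> R ` V" and C: "\<And>e. e > 0 \<Longrightarrow> \<exists>M. \<forall>m\<ge>M. \<forall>n\<ge>M. hnorm rip (s m - s n) < e"
  have ld: "lift (u - v) = lift u - lift v" "u - v \<in> R ` V" if u: "u \<in> R ` V" and v: "v \<in> R ` V" for u v
  proof -
    have "u - v = u + cs (-1) v" by (simp add: cs_minus_one)
    then show "lift (u - v) = lift u - lift v" "u - v \<in> R ` V"
      using lift_add[OF u range_cs[OF v, of "-1"]] lift_cs[OF v, of "-1"] range_add[OF u range_cs[OF v, of "-1"]]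
      by (simp_all add: cs_minus_one)
  qed
  have "\<exists>l. tends (\<lambda>n. lift (s n)) l"
    by (rule Cauchy_tends) (use C s in \<open>simp_all add: lift_in hnorm_rip ld\<close>)
  then obtain l where l: "tends (\<lambda>n. lift (s n)) l" by blast
  then have lV: "l \<in> V" by (simp add: tends_def)
  \<comment> \<open>Orthogonality to the kernel survives the limit, so the limit of the lifts is
    again a lift.\<close>
  have "ip l k = 0" if k: "k \<in> V" "R k = 0" for k
  proof -
    have "(\<lambda>n. ip (lift (s n)) k) \<longlonglongrightarrow> ip l k" by (rule tends_ip_left[OF l k(1)])
    moreover have "(\<lambda>n. ip (lift (s n)) k) = (\<lambda>n. 0)" using lift_orth[OF s k] by auto
    ultimately show ?thesis by (simp add: LIMSEQ_const_iff)
  qed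
  then have ll: "lift (R l) = l" by (intro lift_unique lV)
  have "(\<lambda>n. hnorm rip (s n - R l)) \<longlonglongrightarrow> 0"
    using l lV s by (simp add: hnorm_rip ld ll tends_def)
  then show "\<exists>l\<in>R ` V. (\<lambda>n. hnorm rip (s n - l)) \<longlonglongrightarrow> 0" using lV by blast
qed

lemma rip_RR:
  assumes u: "u \<in> R ` V" and h: "h \<in> V"
  shows "rip u (R (R h)) = ip u h"
  using R_sym[OF lift_in[OF u] h] R_lift[OF u] by (simp add: rip_def lift_RR h)

lemma hnorm_rip_RR: "h \<in> V \<Longrightarrow> hnorm rip (R (R h)) = nrm (R h)"
  by (simp add: hnorm_rip lift_RR)

text \<open>A range criterion in the style of Douglas: R h -> <h, u> is a bounded functional on the
  range, and its Riesz vector \<open>g\<close> satisfies u = R g.\<close>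

lemma range_if_bounded:
  assumes u: "u \<in> V" and C: "0 \<le> C" and bnd: "\<And>h. h \<in> V \<Longrightarrow> cmod (ip u h) \<le> C * nrm (R h)"
  shows "u \<in> R ` V" and "hnorm rip u \<le> C"
proof -
  have W: "subsp (R ` V)"
    unfolding subsp_def using range_subset range_add range_cs hilbert.V_zero[OF hilbert_range] by blast
  \<comment> \<open>\<open>lift\<close> expresses the functional in terms of \<open>R h\<close>. By
    the bound \<open>u\<close> is orthogonal to the kernel, so the choice of preimage is
    immaterial.\<close>
  have phi: "ip (lift (R h)) u = ip h u" if h: "h \<in> V" for h
  proof -
    have RhV: "R h \<in> R ` V" using h by blast
    have d: "lift (R h) - h \<in> V" "R (lift (R h) - h) = 0"
      using lift_in[OF RhV] R_lift[OF RhV] h by (auto simp: V_diff R_diff)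
    then have "ip u (lift (R h) - h) = 0" using bnd[OF d(1)] by simp
    then have "ip (lift (R h) - h) u = 0" using ip_commute[OF u d(1)] by simp
    then show ?thesis using lift_in[OF RhV] h u by (simp add: ip_diff_left)
  qed
  have "\<exists>g s. tends s g \<and> (\<forall>n. s n \<in> R ` V) \<and> (\<forall>w\<in>R ` V. ip (lift w) u = ip w g) \<and> nrm g \<le> max 0 C"
  proof (rule riesz_subspace[OF W])
    fix f g c assume f: "f \<in> R ` V"
    show "ip (lift (cs c f)) u = c * ip (lift f) u" using f u by (simp add: lift_cs ip_cs_left lift_in)
    have "cmod (ip (lift f) u) = cmod (ip u (lift f))"
      by (subst ip_commute[OF u lift_in[OF f]]) simp
    also have "\<dots> \<le> C * nrm f" using bnd[OF lift_in[OF f]] R_lift[OF f] by simp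
    finally show "cmod (ip (lift f) u) \<le> C * nrm f" .
    assume g: "g \<in> R ` V"
    show "ip (lift (f + g)) u = ip (lift f) u + ip (lift g) u"
      using f g u by (simp add: lift_add ip_add_left lift_in)
  qed
  then obtain g s where s: "tends s g" "\<And>n. s n \<in> R ` V" and g: "\<And>w. w \<in> R ` V \<Longrightarrow> ip (lift w) u = ip w g"
    and ng: "nrm g \<le> max 0 C" by blast
  have gV: "g \<in> V" using s(1) by (simp add: tends_def)
  have "u = R g"
  proof (rule ip_eq_all_imp_eq[OF u R_in[OF gV]])
    fix h assume h: "h \<in> V"
    have "ip h u = ip (R h) g" using phi[OF h] g[of "R h"] h by simp
    then show "ip h u = ip h (R g)" using R_sym[OF h gV] by simp
  qed
  \<comment> \<open>\<open>g\<close> is a limit of range vectors, hence orthogonal to the kernel, so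
    it is the lift of \<open>u\<close> and its norm is that of \<open>u\<close> in the
    range.\<close>
  have "ip g k = 0" if k: "k \<in> V" "R k = 0" for k
  proof -
    have "ip (s n) k = 0" for n
    proof -
      obtain f where f: "f \<in> V" "s n = R f" using s(2) by blast
      then show ?thesis using R_sym[OF f(1) k(1)] k(2) by (simp add: ip_zero_right)
    qed
    then show ?thesis using tends_ip_left[OF s(1) k(1)] by (simp add: LIMSEQ_const_iff)
  qed
  then have "lift u = g" using lift_unique[OF gV] \<open>u = R g\<close> by simp
  then show "u \<in> R ` V" "hnorm rip u \<le> C" using \<open>u = R g\<close> gV ng C by (auto simp: hnorm_rip)
qed

end

section \<open>Kernels, shifts and monomials in the Hardy space\<close>

lemma szego_H2: "cmod w < 1 \<Longrightarrow> szego w \<in> H2"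
proof -
  assume w: "cmod w < 1"
  have "summable (\<lambda>n. ((cmod w)\<^sup>2) ^ n)" using w by (intro summable_geometric) (simp add: power_less_one_iff)
  then show ?thesis using w szego_disc_hol[of w]
    by (simp add: H2_iff tc_szego norm_power power_mult[symmetric] mult.commute)
qed

lemma H2_inner_szego:
  assumes f: "f \<in> H2" and w: "cmod w < 1"
  shows "H2_inner f (szego w) = f w"
proof (rule sums_unique2)
  show "(\<lambda>n. tc f n * cnj (tc (szego w) n)) sums H2_inner f (szego w)"
    by (rule H2_inner_sums[OF f szego_H2[OF w]])
  show "(\<lambda>n. tc f n * cnj (tc (szego w) n)) sums f w"
    using tc_sums[OF H2_disc_hol[OF f] w] w by (simp add: tc_szego)
qed

lemma circle_mean_tendsto:
  assumes f: "f \<in> H2"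
  shows "(\<lambda>n. LINT \<zeta>|arc_measure. (cmod (f (of_real (rad n) * \<zeta>)))\<^sup>2) \<longlonglongrightarrow> (H2.nrm f)\<^sup>2"
proof -
  have "(\<lambda>n. LINT \<zeta>|arc_measure. f (of_real (rad n) * \<zeta>) * cnj (f (of_real (rad n) * \<zeta>))) \<longlonglongrightarrow> H2_inner f f"
    by (rule circle_inner_tendsto[OF f f])
  also have "(\<lambda>n. LINT \<zeta>|arc_measure. f (of_real (rad n) * \<zeta>) * cnj (f (of_real (rad n) * \<zeta>))) =
      (\<lambda>n. complex_of_real (LINT \<zeta>|arc_measure. (cmod (f (of_real (rad n) * \<zeta>)))\<^sup>2))"
    by (simp only: complex_norm_square[symmetric] integral_complex_of_real)
  also have "H2_inner f f = complex_of_real ((H2.nrm f)\<^sup>2)" by (rule H2.ip_self[OF f])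
  finally show ?thesis by (simp only: tendsto_of_real_iff)
qed

lemma energy_le_if_means_le:
  assumes f: "f \<in> H2" and C: "\<And>n. (LINT \<zeta>|arc_measure. (cmod (f (of_real (rad n) * \<zeta>)))\<^sup>2) \<le> C"
  shows "(H2.nrm f)\<^sup>2 \<le> C"
  by (rule LIMSEQ_le_const2[OF circle_mean_tendsto[OF f]]) (use C in blast)

definition forward_shift :: "cfun \<Rightarrow> cfun" where
  "forward_shift f = (\<lambda>z. z * f z)"

lemma summable_shift_sq: "f \<in> H2 \<Longrightarrow> summable (\<lambda>n. (cmod (tc f (Suc n)))\<^sup>2)"
  using H2_summable summable_Suc_iff[of "\<lambda>n. (cmod (tc f n))\<^sup>2"] by simp

text \<open>The function with the shifted coefficients is compared with the quotient formula; at 0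
  its value is the first coefficient, the derivative.\<close>

lemma backward_shift_H2:
  assumes f: "f \<in> H2"
  shows "backward_shift f \<in> H2" and "tc (backward_shift f) n = tc f (Suc n)"
proof -
  obtain g where g: "g \<in> H2" "\<And>n. tc g n = tc f (Suc n)"
    using coefficients_to_H2[OF summable_shift_sq[OF f]] by blast
  have "backward_shift f z = g z" for z
  proof (cases "cmod z < 1")
    case True
    have gs: "(\<lambda>n. tc f (Suc n) * z ^ n) sums g z"
      using tc_sums[OF H2_disc_hol[OF g(1)] True] g(2) by simp
    show ?thesis
    proof (cases "z = 0")
      case z: True
      have "(\<lambda>n. tc g n * 0 ^ n) sums g 0" using tc_sums[OF H2_disc_hol[OF g(1)], of 0] by simp
      then have "g 0 = tc g 0" by (rule sums_unique2[OF _ powser_sums_zero])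
      moreover have "tc f (Suc 0) = deriv f 0" by (simp add: tc_def)
      ultimately have "g 0 = deriv f 0" using g(2)[of 0] by simp
      then show ?thesis using z by (simp add: backward_shift_def)
    next
      case z: False
      have "(\<lambda>n. tc f n * z ^ n) sums f z" by (rule tc_sums[OF H2_disc_hol[OF f] True])
      then have "(\<lambda>n. tc f (Suc n) * z ^ Suc n) sums (f z - tc f 0 * z ^ 0)"
        by (subst sums_Suc_iff) simp
      moreover have "(\<lambda>n. tc f (Suc n) * z ^ Suc n) sums (g z * z)"
        using sums_mult2[OF gs, of z] by (simp add: mult_ac)
      ultimately have "g z * z = f z - tc f 0 * z ^ 0" by (rule sums_unique2[rotated])
      then have "g z * z = f z - f 0" by (simp add: tc_def)
      then show ?thesis using z True by (simp add: backward_shift_def field_simps)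
    qed
  next
    case False
    then show ?thesis using H2_disc_hol[OF g(1)] by (simp add: backward_shift_def disc_hol_def)
  qed
  then have eq: "backward_shift f = g" by (simp add: fun_eq_iff)
  show "backward_shift f \<in> H2" "tc (backward_shift f) n = tc f (Suc n)" using g unfolding eq by auto
qed

lemma forward_shift_H2:
  assumes f: "f \<in> H2"
  shows "forward_shift f \<in> H2" and "tc (forward_shift f) 0 = 0" and "tc (forward_shift f) (Suc n) = tc f n"
proof -
  have d: "disc_hol (forward_shift f)"
    using disc_hol_mult[OF H2_disc_hol[OF f], of "\<lambda>z. z"] by (simp add: forward_shift_def mult.commute)
  have tc: "tc (forward_shift f) n = (case n of 0 \<Rightarrow> 0 | Suc m \<Rightarrow> tc f m)" for n
  proof (rule tc_unique[OF d])
    fix z :: complex assume z: "cmod z < 1"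
    have "(\<lambda>n. tc f n * z ^ Suc n) sums (f z * z)"
      using sums_mult2[OF tc_sums[OF H2_disc_hol[OF f] z], of z] by (simp add: mult_ac)
    then have "(\<lambda>n. (case Suc n of 0 \<Rightarrow> 0 | Suc m \<Rightarrow> tc f m) * z ^ Suc n) sums (f z * z)" by simp
    then have "(\<lambda>n. (case n of 0 \<Rightarrow> 0 | Suc m \<Rightarrow> tc f m) * z ^ n) sums (f z * z + 0)"
      by (subst (asm) sums_Suc_iff) simp
    then show "(\<lambda>n. (case n of 0 \<Rightarrow> 0 | Suc m \<Rightarrow> tc f m) * z ^ n) sums forward_shift f z"
      by (simp add: forward_shift_def mult.commute)
  qed
  show "tc (forward_shift f) 0 = 0" "tc (forward_shift f) (Suc n) = tc f n" using tc by auto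
  have "summable (\<lambda>n. (cmod (tc (forward_shift f) (Suc n)))\<^sup>2)" using H2_summable[OF f] tc by simp
  then have "summable (\<lambda>n. (cmod (tc (forward_shift f) n))\<^sup>2)"
    using summable_Suc_iff[of "\<lambda>n. (cmod (tc (forward_shift f) n))\<^sup>2"] by simp
  then show "forward_shift f \<in> H2" using d by (simp add: H2_iff)
qed

lemma H2_inner_shift:
  assumes f: "f \<in> H2" and g: "g \<in> H2"
  shows "H2_inner (backward_shift f) g = H2_inner f (forward_shift g)"
proof (rule sums_unique2)
  show "(\<lambda>n. tc f (Suc n) * cnj (tc g n)) sums H2_inner (backward_shift f) g"
    using H2_inner_sums[OF backward_shift_H2(1)[OF f] g] by (simp add: backward_shift_H2(2)[OF f])
  have "(\<lambda>n. tc f n * cnj (tc (forward_shift g) n)) sums H2_inner f (forward_shift g)"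
    by (rule H2_inner_sums[OF f forward_shift_H2(1)[OF g]])
  then show "(\<lambda>n. tc f (Suc n) * cnj (tc g n)) sums H2_inner f (forward_shift g)"
    using sums_Suc_iff[of "\<lambda>n. tc f n * cnj (tc (forward_shift g) n)"] forward_shift_H2(2,3)[OF g] by simp
qed

lemma backward_forward: "f \<in> H2 \<Longrightarrow> backward_shift (forward_shift f) = f"
  by (rule H2_eqI) (simp_all add: backward_shift_H2 forward_shift_H2)

lemma hnorm_backward_shift_le: "f \<in> H2 \<Longrightarrow> H2.nrm (backward_shift f) \<le> H2.nrm f"
proof -
  assume f: "f \<in> H2"
  have "energy (backward_shift f) \<le> energy f"
    unfolding energy_def backward_shift_H2(2)[OF f]
    using suminf_split_head[OF H2_summable[OF f]] by simp
  then have "(H2.nrm (backward_shift f))\<^sup>2 \<le> (H2.nrm f)\<^sup>2"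
    using f backward_shift_H2(1)[OF f] by (simp add: H2_hnorm_sq)
  then show ?thesis using H2.nrm_nonneg[OF f] by (rule power2_le_imp_le)
qed

definition monomial :: "nat \<Rightarrow> cfun" where
  "monomial n = cut (\<lambda>z. z ^ n)"

lemma monomial_H2: "monomial n \<in> H2" and tc_monomial: "tc (monomial n) k = (if k = n then 1 else 0)"
proof -
  have d: "disc_hol (monomial n)" unfolding monomial_def by (intro disc_hol_cut holomorphic_intros)
  have tc: "tc (monomial n) k = (if k = n then 1 else 0)" for k
  proof (rule tc_unique[OF d])
    fix z :: complex assume z: "cmod z < 1"
    have "(\<lambda>k. (if k = n then 1 else 0) * z ^ k) = (\<lambda>k. if k = n then z ^ k else 0)" by auto
    then show "(\<lambda>k. (if k = n then 1 else 0) * z ^ k) sums monomial n z"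
      using sums_single[of n "\<lambda>k. z ^ k"] z by (simp add: monomial_def cut_def)
  qed
  have "summable (\<lambda>k. (cmod (tc (monomial n) k))\<^sup>2)"
    by (rule summable_finite[of "{n}"]) (auto simp: tc)
  then show "monomial n \<in> H2" using d by (simp add: H2_iff)
  show "tc (monomial n) k = (if k = n then 1 else 0)" by (rule tc)
qed

lemma H2_inner_monomial:
  assumes f: "f \<in> H2"
  shows "H2_inner f (monomial n) = tc f n"
proof (rule sums_unique2[OF H2_inner_sums[OF f monomial_H2]])
  have "(\<lambda>k. tc f k * cnj (tc (monomial n) k)) = (\<lambda>k. if k = n then tc f k else 0)"
    by (auto simp: tc_monomial)
  then show "(\<lambda>k. tc f k * cnj (tc (monomial n) k)) sums tc f n"
    using sums_single[of n "\<lambda>k. tc f k"] by simp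
qed


section \<open>Toeplitz operators as multiplication by \<open>b\<close> and its adjoint\<close>

section \<open>Toeplitz operators with bounded analytic symbol\<close>

lemma integrable_circle_sq:
  assumes f: "disc_hol f" and r: "0 \<le> r" "r < 1"
  shows "integrable arc_measure (\<lambda>\<zeta>. (cmod (f (of_real r * \<zeta>)))\<^sup>2)"
proof -
  obtain B where B: "B \<ge> 0" "\<And>\<zeta>. cmod \<zeta> = 1 \<Longrightarrow> cmod (f (of_real r * \<zeta>)) \<le> B"
    using disc_hol_circle_bounded[OF f r] by blast
  have [measurable]: "(\<lambda>\<zeta>. f (of_real r * \<zeta>)) \<in> borel_measurable borel" using f by simp
  show ?thesis
    by (rule integrable_arc_bounded[where B = "B\<^sup>2"]) (use B in \<open>auto intro: power_mono\<close>)
qed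

text \<open>Uniqueness holds because an element of \<open>H2\<close> is determined by its inner
  products. Integrability is assumed so that the integral of the difference may be split.\<close>

lemma P_plus_eqI:
  assumes h: "h \<in> H2" and int: "\<And>k. k \<in> H2 \<Longrightarrow> integrable arc_measure (\<lambda>\<zeta>. g \<zeta> * cnj (bdry k \<zeta>))"
    and eq: "\<And>k. k \<in> H2 \<Longrightarrow> L2_inner g (bdry k) = H2_inner h k"
  shows "P_plus g = h"
  unfolding P_plus_def
proof (rule the_equality)
  have diff: "L2_inner (\<lambda>\<zeta>. g \<zeta> - bdry f \<zeta>) (bdry k) = H2_inner h k - H2_inner f k" if "f \<in> H2" "k \<in> H2" for f k
  proof -
    have "L2_inner (\<lambda>\<zeta>. g \<zeta> - bdry f \<zeta>) (bdry k) =
        (LINT \<zeta>|arc_measure. g \<zeta> * cnj (bdry k \<zeta>) - bdry f \<zeta> * cnj (bdry k \<zeta>))"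
      by (simp add: L2_inner_def left_diff_distrib)
    also have "\<dots> = L2_inner g (bdry k) - H2_inner f k"
      using int[OF that(2)] bdry_product_integrable[OF that] by (simp add: L2_inner_def H2_inner_def)
    finally show ?thesis using eq[OF that(2)] by simp
  qed
  show "h \<in> H2 \<and> (\<forall>k\<in>H2. L2_inner (\<lambda>\<zeta>. g \<zeta> - bdry h \<zeta>) (bdry k) = 0)"
    using h diff by simp
  fix f assume f: "f \<in> H2 \<and> (\<forall>k\<in>H2. L2_inner (\<lambda>\<zeta>. g \<zeta> - bdry f \<zeta>) (bdry k) = 0)"
  show "f = h"
  proof (rule H2.ip_eq_all_imp_eq)
    fix k assume k: "k \<in> H2"
    have "H2_inner f k = H2_inner h k" using diff[of f k] f k by auto
    then show "H2_inner k f = H2_inner k h"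
      using H2.ip_commute[of f k] H2.ip_commute[of h k] f h k by auto
  qed (use f h in auto)
qed

locale schur =
  fixes b :: cfun
  assumes hol: "b holomorphic_on ball 0 1" and le1: "\<And>z. cmod z < 1 \<Longrightarrow> cmod (b z) \<le> 1"
begin

definition M :: "cfun \<Rightarrow> cfun" where
  "M f = (\<lambda>z. b z * f z)"

lemma M_disc_hol: "disc_hol f \<Longrightarrow> disc_hol (M f)"
  using disc_hol_mult[OF _ hol, of f] by (simp add: M_def mult.commute)

lemma M_mean_le:
  assumes f: "disc_hol f" and r: "0 \<le> r" "r < 1"
  shows "(LINT \<zeta>|arc_measure. (cmod (M f (of_real r * \<zeta>)))\<^sup>2) \<le> (LINT \<zeta>|arc_measure. (cmod (f (of_real r * \<zeta>)))\<^sup>2)"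
proof (rule integral_mono_AE[OF integrable_circle_sq[OF M_disc_hol[OF f] r] integrable_circle_sq[OF f r]], rule AE_arc)
  fix \<zeta> :: complex assume \<zeta>: "cmod \<zeta> = 1"
  have "cmod (b (of_real r * \<zeta>)) \<le> 1" using \<zeta> r by (intro le1) (simp add: norm_mult)
  then have "cmod (M f (of_real r * \<zeta>)) \<le> cmod (f (of_real r * \<zeta>))"
    by (simp add: M_def norm_mult mult_left_le_one_le)
  then show "(cmod (M f (of_real r * \<zeta>)))\<^sup>2 \<le> (cmod (f (of_real r * \<zeta>)))\<^sup>2" by (intro power_mono) auto
qed

lemma M_H2: "f \<in> H2 \<Longrightarrow> M f \<in> H2"
proof -
  assume f: "f \<in> H2"
  have "(LINT \<zeta>|arc_measure. (cmod (M f (of_real r * \<zeta>)))\<^sup>2) \<le> energy f" if "0 \<le> r \<and> r < 1" for r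
    using M_mean_le[OF H2_disc_hol[OF f]] circle_mean_sq_le_energy[OF H2_disc_hol[OF f] H2_summable[OF f]] that
    by (meson order_trans)
  then show ?thesis using M_disc_hol[OF H2_disc_hol[OF f]] unfolding H2_def disc_hol_def by blast
qed

lemma M_le: "f \<in> H2 \<Longrightarrow> H2.nrm (M f) \<le> 1 * H2.nrm f"
proof -
  assume f: "f \<in> H2"
  have "(H2.nrm (M f))\<^sup>2 \<le> (H2.nrm f)\<^sup>2"
    unfolding H2_hnorm_sq[OF f]
    using M_mean_le[OF H2_disc_hol[OF f] rad(3) rad(2)]
      circle_mean_sq_le_energy[OF H2_disc_hol[OF f] H2_summable[OF f] rad(3) rad(2)]
    by (intro energy_le_if_means_le[OF M_H2[OF f]]) (meson order_trans)
  then show ?thesis using H2.nrm_nonneg[OF f] power2_le_imp_le by fastforce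
qed

lemma linop_M: "H2.linop M"
  unfolding H2.linop_def by (auto simp: M_H2) (auto simp: M_def fun_eq_iff cs_apply algebra_simps)

text \<open>Introduced as an abstract adjoint; \<open>toeplitz_cnj_b\<close> identifies it with the
  Toeplitz operator of the conjugate symbol.\<close>

definition Ms :: "cfun \<Rightarrow> cfun" where
  "Ms = op_adjoint H2 H2_inner M"

lemma linop_Ms: "H2.linop Ms"
  and M_adjoint: "f \<in> H2 \<Longrightarrow> g \<in> H2 \<Longrightarrow> H2_inner (M f) g = H2_inner f (Ms g)"
  and Ms_le: "f \<in> H2 \<Longrightarrow> H2.nrm (Ms f) \<le> H2.nrm f"
  unfolding Ms_def using H2.op_adjoint_props[OF linop_M M_le] by auto

lemma Ms_H2: "f \<in> H2 \<Longrightarrow> Ms f \<in> H2"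
  using linop_Ms by (simp add: H2.linop_def)

lemma Ms_adjoint: "f \<in> H2 \<Longrightarrow> g \<in> H2 \<Longrightarrow> H2_inner (Ms f) g = H2_inner f (M g)"
  using H2.ip_commute[of "M g" f] H2.ip_commute[of g "Ms f"] M_adjoint[of g f] by (simp add: M_H2 Ms_H2)

lemma cut_b: "cut b = M (cut (\<lambda>z. 1))"
  by (auto simp: cut_def M_def)

lemma one_H2: "cut (\<lambda>z. 1) \<in> H2"
  using monomial_H2[of 0] by (simp add: monomial_def)

text \<open>\<open>b\<close> may be arbitrary outside the disc, but radial limits see only the
  disc.\<close>

lemma bdry_cut: "bdry (cut b) = bdry b"
proof
  fix \<zeta> :: complex
  show "bdry (cut b) \<zeta> = bdry b \<zeta>"
  proof (cases "cmod \<zeta> = 1")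
    case True
    have "\<forall>\<^sub>F r in at_left (1::real). cut b (of_real r * \<zeta>) = b (of_real r * \<zeta>)"
      using True by (intro eventually_at_leftI[of 0]) (auto simp: cut_def norm_mult)
    then have "Lim (at_left (1::real)) (\<lambda>r. cut b (of_real r * \<zeta>)) = Lim (at_left (1::real)) (\<lambda>r. b (of_real r * \<zeta>))"
      by (intro Lim_cong) auto
    then show ?thesis by (simp add: bdry_def)
  qed (simp add: bdry_def)
qed

lemma bdry_b_measurable [measurable]: "bdry b \<in> borel_measurable borel"
  unfolding bdry_cut[symmetric] by (intro bdry_measurable disc_hol_cut hol)

lemma bdry_M: "f \<in> H2 \<Longrightarrow> AE \<zeta> in arc_measure. bdry (M f) \<zeta> = bdry b \<zeta> * bdry f \<zeta>"
proof -
  assume f: "f \<in> H2"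
  have c: "cut b \<in> H2" unfolding cut_b by (intro M_H2 one_H2)
  show ?thesis
    using bdry_tendsto[OF H2_disc_hol[OF f] H2_summable[OF f]] bdry_tendsto[OF H2_disc_hol[OF c] H2_summable[OF c]] AE_arc_norm
  proof eventually_elim
    fix \<zeta> assume 1: "((\<lambda>r. f (of_real r * \<zeta>)) \<longlongrightarrow> bdry f \<zeta>) (at_left 1)"
      and 2: "((\<lambda>r. cut b (of_real r * \<zeta>)) \<longlongrightarrow> bdry (cut b) \<zeta>) (at_left 1)" and \<zeta>: "cmod \<zeta> = 1"
    have "((\<lambda>r. cut b (of_real r * \<zeta>) * f (of_real r * \<zeta>)) \<longlongrightarrow> bdry b \<zeta> * bdry f \<zeta>) (at_left 1)"
      using tendsto_mult[OF 2 1] by (simp add: bdry_cut)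
    moreover have "(\<lambda>r. cut b (of_real r * \<zeta>) * f (of_real r * \<zeta>)) = (\<lambda>r. M f (of_real r * \<zeta>))"
      using H2_disc_hol[OF f] by (auto simp: cut_def M_def disc_hol_def)
    ultimately show "bdry (M f) \<zeta> = bdry b \<zeta> * bdry f \<zeta>" by (intro bdry_eqI \<zeta>) simp
  qed
qed

text \<open>The boundary function of the product is almost everywhere the product of the boundary
  functions, so the projection has nothing to remove.\<close>

lemma toeplitz_b:
  assumes f: "f \<in> H2"
  shows "toeplitz (bdry b) f = M f"
  unfolding toeplitz_def
proof (rule P_plus_eqI[OF M_H2[OF f]])
  fix k assume k: "k \<in> H2"
  have [measurable]: "bdry f \<in> borel_measurable borel" "bdry k \<in> borel_measurable borel" "bdry (M f) \<in> borel_measurable borel"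
    using f k M_H2[OF f] by simp_all
  have ae: "AE \<zeta> in arc_measure. bdry (M f) \<zeta> * cnj (bdry k \<zeta>) = bdry b \<zeta> * bdry f \<zeta> * cnj (bdry k \<zeta>)"
    using bdry_M[OF f] by eventually_elim simp
  show "integrable arc_measure (\<lambda>\<zeta>. bdry b \<zeta> * bdry f \<zeta> * cnj (bdry k \<zeta>))"
    by (rule integrable_cong_AE_imp[OF bdry_product_integrable[OF M_H2[OF f] k] _ ae]) measurable
  show "L2_inner (\<lambda>\<zeta>. bdry b \<zeta> * bdry f \<zeta>) (bdry k) = H2_inner (M f) k"
    unfolding L2_inner_def H2_inner_def by (rule integral_cong_AE[symmetric, OF _ _ ae]) measurable
qed

text \<open>Under the integral the conjugated symbol moves to the other factor, where it is
  multiplication by \<open>b\<close>.\<close>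

lemma toeplitz_cnj_b:
  assumes f: "f \<in> H2"
  shows "toeplitz (\<lambda>\<zeta>. cnj (bdry b \<zeta>)) f = Ms f"
  unfolding toeplitz_def
proof (rule P_plus_eqI[OF Ms_H2[OF f]])
  fix k assume k: "k \<in> H2"
  have [measurable]: "bdry f \<in> borel_measurable borel" "bdry k \<in> borel_measurable borel" "bdry (M k) \<in> borel_measurable borel"
    using f k M_H2[OF k] by simp_all
  have ae: "AE \<zeta> in arc_measure. bdry f \<zeta> * cnj (bdry (M k) \<zeta>) = cnj (bdry b \<zeta>) * bdry f \<zeta> * cnj (bdry k \<zeta>)"
    using bdry_M[OF k] by eventually_elim simp
  show "integrable arc_measure (\<lambda>\<zeta>. cnj (bdry b \<zeta>) * bdry f \<zeta> * cnj (bdry k \<zeta>))"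
    by (rule integrable_cong_AE_imp[OF bdry_product_integrable[OF f M_H2[OF k]] _ ae]) measurable
  have "L2_inner (\<lambda>\<zeta>. cnj (bdry b \<zeta>) * bdry f \<zeta>) (bdry k) = H2_inner f (M k)"
    unfolding L2_inner_def H2_inner_def by (rule integral_cong_AE[symmetric, OF _ _ ae]) measurable
  then show "L2_inner (\<lambda>\<zeta>. cnj (bdry b \<zeta>) * bdry f \<zeta>) (bdry k) = H2_inner (Ms f) k"
    using Ms_adjoint[OF f k] by simp
qed

section \<open>The space of \<open>b\<close>: inner product, shift and reproducing kernels\<close>

section \<open>The de Branges--Rovnyak space\<close>

definition A :: "cfun \<Rightarrow> cfun" where
  "A f = f - M (Ms f)"

lemma A_H2: "f \<in> H2 \<Longrightarrow> A f \<in> H2"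
  by (simp add: A_def H2.V_diff M_H2 Ms_H2)

lemma contraction: "hilbert_contraction H2 H2_inner (\<lambda>f. M (Ms f))"
proof
  show "H2.linop (\<lambda>f. M (Ms f))" using linop_M linop_Ms by (simp add: H2.linop_def)
  fix f g assume f: "f \<in> H2"
  show "H2.nrm (M (Ms f)) \<le> H2.nrm f"
    using M_le[OF Ms_H2[OF f]] Ms_le[OF f] by simp
  assume g: "g \<in> H2"
  show "H2_inner (M (Ms f)) g = H2_inner f (M (Ms g))"
    using f g by (simp add: M_adjoint Ms_adjoint[symmetric] Ms_H2)
qed

lemma defect_sqrt_props:
  shows defect_positive: "positive_op H2 H2_inner (defect_sqrt b)"
    and defect_sq: "f \<in> H2 \<Longrightarrow> defect_sqrt b (defect_sqrt b f) = A f"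
proof -
  interpret hilbert_contraction H2 H2_inner "\<lambda>f. M (Ms f)" by (rule contraction)
  let ?A = "\<lambda>f z. f z - toeplitz (bdry b) (toeplitz (\<lambda>\<zeta>. cnj (bdry b \<zeta>)) f) z"
  have eq: "?A f = f - M (Ms f)" if "f \<in> H2" for f
    using that by (simp add: toeplitz_cnj_b toeplitz_b Ms_H2 fun_eq_iff)
  have d: "defect_sqrt b = op_sqrt H2 H2_inner ?A" by (simp add: defect_sqrt_def)
  show "positive_op H2 H2_inner (defect_sqrt b)" unfolding d by (rule op_sqrt_props(1)[OF eq])
  show "f \<in> H2 \<Longrightarrow> defect_sqrt b (defect_sqrt b f) = A f"
    unfolding d by (subst op_sqrt_props(2)[OF eq]) (simp_all add: eq A_def)
qed

sublocale R: operator_range H2 H2_inner "defect_sqrt b"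
proof
  show lin: "H2.linop (defect_sqrt b)" and "\<exists>C. \<forall>f\<in>H2. H2.nrm (defect_sqrt b f) \<le> C * H2.nrm f"
    using defect_positive unfolding positive_op_def H2.bounded_op_iff by auto
  show "H2_inner (defect_sqrt b f) g = H2_inner f (defect_sqrt b g)" if "f \<in> H2" "g \<in> H2" for f g
    using defect_positive that by (intro H2.symmetric_if_real lin) (auto simp: positive_op_def)
qed

lemma Hb_eq: "Hb b = defect_sqrt b ` H2" by (simp add: Hb_def)

lemma Hb_inner_eq: "Hb_inner b = R.rip"
  by (simp add: fun_eq_iff Hb_inner_def R.rip_def Hb_lift_def R.lift_def)

sublocale hb: hilbert "Hb b" "Hb_inner b"
  unfolding Hb_eq Hb_inner_eq by (rule R.hilbert_range)

lemma Hb_H2: "u \<in> Hb b \<Longrightarrow> u \<in> H2"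
  using R.range_subset by (auto simp: Hb_eq)

lemma A_Hb: "h \<in> H2 \<Longrightarrow> A h \<in> Hb b"
  unfolding Hb_eq by (subst defect_sq[symmetric]) (auto intro: R.R_in)

text \<open>The square root drops out: one copy is absorbed by the lift of \<open>A h\<close>, and
  symmetry moves the other onto the lift of \<open>u\<close>.\<close>

lemma Hb_inner_A: "u \<in> Hb b \<Longrightarrow> h \<in> H2 \<Longrightarrow> Hb_inner b u (A h) = H2_inner u h"
  unfolding Hb_eq Hb_inner_eq by (subst defect_sq[symmetric]) (auto simp: R.rip_RR)

lemma nrm_R_sq: "h \<in> H2 \<Longrightarrow> (H2.nrm (defect_sqrt b h))\<^sup>2 = (H2.nrm h)\<^sup>2 - (H2.nrm (Ms h))\<^sup>2"
proof -
  assume h: "h \<in> H2"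
  have "(H2.nrm (defect_sqrt b h))\<^sup>2 = Re (H2_inner (A h) h)"
    using R.R_sym[OF R.R_in[OF h] h] defect_sq[OF h] by (simp add: H2.nrm_sq R.R_in h)
  also have "\<dots> = Re (H2_inner h h) - Re (H2_inner (Ms h) (Ms h))"
    using h by (simp add: A_def H2.ip_simps M_H2 Ms_H2 M_adjoint)
  finally show ?thesis using h by (simp add: H2.nrm_sq Ms_H2)
qed

lemma hb_nrm_A_sq: "h \<in> H2 \<Longrightarrow> (hb.nrm (A h))\<^sup>2 = (H2.nrm h)\<^sup>2 - (H2.nrm (Ms h))\<^sup>2"
  using R.hnorm_rip_RR[of h] defect_sq[of h] nrm_R_sq[of h] by (simp add: Hb_inner_eq)

text \<open>The range criterion freed from the square root, since \<open>A h\<close> has in the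
  space the norm that the root of \<open>h\<close> has in \<open>H2\<close>.\<close>

lemma Hb_if_bounded:
  assumes "u \<in> H2" "0 \<le> C" "\<And>h. h \<in> H2 \<Longrightarrow> cmod (H2_inner u h) \<le> C * hb.nrm (A h)"
  shows "u \<in> Hb b" "hb.nrm u \<le> C"
proof -
  have "hb.nrm (A h) = H2.nrm (defect_sqrt b h)" if "h \<in> H2" for h
    using R.hnorm_rip_RR[OF that] defect_sq[OF that] by (simp add: Hb_inner_eq)
  then have "cmod (H2_inner u h) \<le> C * H2.nrm (defect_sqrt b h)" if "h \<in> H2" for h
    using assms(3)[OF that] that by simp
  from R.range_if_bounded[OF assms(1,2) this]
  show "u \<in> Hb b" "hb.nrm u \<le> C" by (simp_all add: Hb_eq Hb_inner_eq)
qed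

subsection \<open>The backward shift and its adjoint\<close>

lemma M_forward_shift: "M (forward_shift f) = forward_shift (M f)"
  by (simp add: M_def forward_shift_def fun_eq_iff)

text \<open>Seen by pairing with \<open>k\<close>: multiplication by \<open>b\<close> commutes with
  the forward shift, which is an isometry.\<close>

lemma backward_shift_Ms:
  assumes h: "h \<in> H2"
  shows "backward_shift (Ms (forward_shift h)) = Ms h"
proof (rule H2.ip_eq_all_imp_eq)
  have fh: "forward_shift h \<in> H2" by (rule forward_shift_H2(1)[OF h])
  show "backward_shift (Ms (forward_shift h)) \<in> H2" by (intro backward_shift_H2(1) Ms_H2 fh)
  show "Ms h \<in> H2" by (rule Ms_H2[OF h])
  fix k assume k: "k \<in> H2"
  have fk: "forward_shift k \<in> H2" by (rule forward_shift_H2(1)[OF k])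
  have "H2_inner (backward_shift (Ms (forward_shift h))) k = H2_inner (forward_shift h) (forward_shift (M k))"
    by (simp add: H2_inner_shift Ms_H2 fh k Ms_adjoint fk M_forward_shift)
  also have "\<dots> = H2_inner h (M k)"
    using H2_inner_shift[OF fh M_H2[OF k]] backward_forward[OF h] by simp
  finally have "H2_inner (backward_shift (Ms (forward_shift h))) k = H2_inner (Ms h) k"
    by (simp add: Ms_adjoint h k)
  then show "H2_inner k (backward_shift (Ms (forward_shift h))) = H2_inner k (Ms h)"
    using H2.ip_commute[OF _ k] backward_shift_H2(1)[OF Ms_H2[OF fh]] Ms_H2[OF h] by simp
qed

lemma hnorm_forward_shift: "h \<in> H2 \<Longrightarrow> H2.nrm (forward_shift h) = H2.nrm h"
  using H2_inner_shift[OF forward_shift_H2(1), of h h] by (simp add: hnorm_def backward_forward)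

text \<open>In |h|^2 - |Ms h|^2 the shift preserves the first term and cannot decrease the second,
  because the contractive backward shift recovers \<open>Ms h\<close>.\<close>

lemma hb_nrm_A_shift_le: "h \<in> H2 \<Longrightarrow> hb.nrm (A (forward_shift h)) \<le> hb.nrm (A h)"
proof -
  assume h: "h \<in> H2"
  have fh: "forward_shift h \<in> H2" by (rule forward_shift_H2(1)[OF h])
  have "H2.nrm (Ms h) \<le> H2.nrm (Ms (forward_shift h))"
    using hnorm_backward_shift_le[OF Ms_H2[OF fh]] backward_shift_Ms[OF h] by simp
  then have "(H2.nrm (Ms h))\<^sup>2 \<le> (H2.nrm (Ms (forward_shift h)))\<^sup>2"
    using H2.nrm_nonneg[OF Ms_H2[OF h]] by (rule power_mono)
  then have "(hb.nrm (A (forward_shift h)))\<^sup>2 \<le> (hb.nrm (A h))\<^sup>2"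
    by (simp add: hb_nrm_A_sq h fh hnorm_forward_shift)
  then show ?thesis by (rule power2_le_imp_le) (rule hb.nrm_nonneg[OF A_Hb[OF h]])
qed

text \<open>By duality: pairing with \<open>h\<close> moves the shift to
  \<open>A (forward_shift h)\<close>, whose norm is at most that of \<open>A h\<close>.\<close>

lemma backward_shift_Hb:
  assumes u: "u \<in> Hb b"
  shows "backward_shift u \<in> Hb b" and "hb.nrm (backward_shift u) \<le> 1 * hb.nrm u"
proof -
  note uH = Hb_H2[OF u]
  have "cmod (H2_inner (backward_shift u) h) \<le> hb.nrm u * hb.nrm (A h)" if h: "h \<in> H2" for h
  proof -
    have fh: "forward_shift h \<in> H2" by (rule forward_shift_H2(1)[OF h])
    have "cmod (H2_inner (backward_shift u) h) = cmod (Hb_inner b u (A (forward_shift h)))"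
      using H2_inner_shift[OF uH h] Hb_inner_A[OF u fh] by simp
    also have "\<dots> \<le> hb.nrm u * hb.nrm (A (forward_shift h))"
      by (rule hb.Cauchy_Schwarz[OF u A_Hb[OF fh]])
    also have "\<dots> \<le> hb.nrm u * hb.nrm (A h)"
      by (rule mult_left_mono[OF hb_nrm_A_shift_le[OF h] hb.nrm_nonneg[OF u]])
    finally show ?thesis .
  qed
  from Hb_if_bounded[OF backward_shift_H2(1)[OF uH] hb.nrm_nonneg[OF u] this]
  show "backward_shift u \<in> Hb b" "hb.nrm (backward_shift u) \<le> 1 * hb.nrm u" by auto
qed

lemma backward_shift_linop: "hb.linop backward_shift"
  unfolding hb.linop_def
proof (intro conjI ballI allI)
  fix f g c assume f: "f \<in> Hb b"
  note fH = Hb_H2[OF f]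
  show "backward_shift f \<in> Hb b" by (rule backward_shift_Hb(1)[OF f])
  show "backward_shift (cs c f) = cs c (backward_shift f)"
    by (rule H2_eqI) (simp_all add: backward_shift_H2 H2_cs fH tc_cs)
next
  fix f g assume f: "f \<in> Hb b" and g: "g \<in> Hb b"
  note fH = Hb_H2[OF f] and gH = Hb_H2[OF g]
  show "backward_shift (f + g) = backward_shift f + backward_shift g"
    by (rule H2_eqI) (simp_all add: backward_shift_H2 H2_add fH gH tc_plus)
qed

lemma linop_X_adj: "hb.linop (X_adj b)"
  and X_adjoint: "f \<in> Hb b \<Longrightarrow> g \<in> Hb b \<Longrightarrow> Hb_inner b (backward_shift f) g = Hb_inner b f (X_adj b g)"
  and X_adj_le: "f \<in> Hb b \<Longrightarrow> hb.nrm (X_adj b f) \<le> hb.nrm f"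
  unfolding X_adj_def
  using hb.op_adjoint_props[OF backward_shift_linop backward_shift_Hb(2)] by auto

lemma X_adj_Hb: "f \<in> Hb b \<Longrightarrow> X_adj b f \<in> Hb b"
  using linop_X_adj by (simp add: hb.linop_def)

lemma X_adj_A:
  assumes h: "h \<in> H2"
  shows "X_adj b (A h) = A (forward_shift h)"
proof (rule hb.ip_eq_all_imp_eq)
  have fh: "forward_shift h \<in> H2" by (rule forward_shift_H2(1)[OF h])
  show "X_adj b (A h) \<in> Hb b" "A (forward_shift h) \<in> Hb b" by (intro X_adj_Hb A_Hb h fh)+
  fix u assume u: "u \<in> Hb b"
  show "Hb_inner b u (X_adj b (A h)) = Hb_inner b u (A (forward_shift h))"
    using X_adjoint[OF u A_Hb[OF h]] Hb_inner_A[OF backward_shift_Hb(1)[OF u] h]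
      H2_inner_shift[OF Hb_H2[OF u] h] Hb_inner_A[OF u fh] by simp
qed

lemma linop_A: "H2.linop A"
  unfolding H2.linop_def
proof (intro conjI ballI allI)
  fix f c assume f: "f \<in> H2"
  show "A f \<in> H2" by (rule A_H2[OF f])
  show "A (cs c f) = cs c (A f)"
    using f linop_M linop_Ms by (simp add: A_def H2.linop_def cs_diff_right)
next
  fix f g assume f: "f \<in> H2" and g: "g \<in> H2"
  have "M (Ms (f + g)) = M (Ms f) + M (Ms g)"
    using f g linop_M linop_Ms by (simp add: H2.linop_def)
  then show "A (f + g) = A f + A g" unfolding A_def by (simp only: add_diff_add)
qed

subsection \<open>Reproducing kernels\<close>

text \<open>Applying \<open>A\<close> to the Szego kernel makes the reproducing property an instance
  of \<open>Hb_inner_A\<close>.\<close>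

definition kb :: "complex \<Rightarrow> cfun" where
  "kb w = A (szego w)"

lemma kb_Hb: "cmod w < 1 \<Longrightarrow> kb w \<in> Hb b"
  unfolding kb_def by (intro A_Hb szego_H2)

lemma Hb_inner_kb: "u \<in> Hb b \<Longrightarrow> cmod w < 1 \<Longrightarrow> Hb_inner b u (kb w) = u w"
  unfolding kb_def by (simp add: Hb_inner_A szego_H2 H2_inner_szego Hb_H2)

text \<open>Pairing with \<open>g\<close> evaluates b g at \<open>w\<close> on one side and gives
  b(w) g(w) on the other.\<close>

lemma Ms_szego:
  assumes w: "cmod w < 1"
  shows "Ms (szego w) = cs (cnj (b w)) (szego w)"
proof (rule H2.ip_eq_all_imp_eq)
  show "Ms (szego w) \<in> H2" "cs (cnj (b w)) (szego w) \<in> H2" by (intro Ms_H2 H2_cs szego_H2 w)+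
  fix g assume g: "g \<in> H2"
  have "H2_inner g (Ms (szego w)) = M g w"
    using M_adjoint[OF g szego_H2[OF w]] H2_inner_szego[OF M_H2[OF g] w] by simp
  then show "H2_inner g (Ms (szego w)) = H2_inner g (cs (cnj (b w)) (szego w))"
    using g w by (simp add: H2.ip_cs_right szego_H2 H2_inner_szego M_def)
qed

lemma kb_eq: "cmod w < 1 \<Longrightarrow> kb w z = (1 - cnj (b w) * b z) * szego w z"
  by (simp add: kb_def A_def Ms_szego M_def cs_apply algebra_simps)

lemma kb_nrm_sq:
  assumes w: "cmod w < 1"
  shows "(hb.nrm (kb w))\<^sup>2 = (1 - (cmod (b w))\<^sup>2) / (1 - (cmod w)\<^sup>2)"
proof -
  have "H2_inner (szego w) (szego w) = 1 / (1 - cnj w * w)"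
    using H2_inner_szego[OF szego_H2[OF w] w] w by (simp add: szego_def)
  also have "cnj w * w = complex_of_real ((cmod w)\<^sup>2)" by (simp only: complex_norm_square mult.commute)
  also have "1 / (1 - complex_of_real ((cmod w)\<^sup>2)) = complex_of_real (1 / (1 - (cmod w)\<^sup>2))" by simp
  finally have n: "(H2.nrm (szego w))\<^sup>2 = 1 / (1 - (cmod w)\<^sup>2)"
    using H2.nrm_sq[OF szego_H2[OF w]] by simp
  have "(H2.nrm (Ms (szego w)))\<^sup>2 = (cmod (b w))\<^sup>2 * (H2.nrm (szego w))\<^sup>2"
    by (simp add: Ms_szego w H2.nrm_cs szego_H2 power_mult_distrib)
  then show ?thesis unfolding kb_def hb_nrm_A_sq[OF szego_H2[OF w]] n by (simp add: diff_divide_distrib)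
qed

text \<open>The Szego kernel k at \<open>w\<close> satisfies k = cnj w z k + 1, and 1 is the Szego
  kernel at 0; applying \<open>A\<close> gives the equation.\<close>

lemma X_adj_kb:
  assumes w: "cmod w < 1"
  shows "kb w = cs (cnj w) (X_adj b (kb w)) + kb 0"
proof -
  have fH: "forward_shift (szego w) \<in> H2" by (intro forward_shift_H2(1) szego_H2 w)
  have "szego w = cs (cnj w) (forward_shift (szego w)) + szego 0"
  proof
    fix z
    show "szego w z = (cs (cnj w) (forward_shift (szego w)) + szego 0) z"
    proof (cases "cmod z < 1")
      case True
      then have "1 - cnj w * z \<noteq> 0" using one_minus_ne[of w z] w by simp
      then show ?thesis using True by (simp add: szego_def forward_shift_def cs_apply field_simps)
    qed (simp add: szego_def forward_shift_def cs_apply)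
  qed
  then have "kb w = A (cs (cnj w) (forward_shift (szego w)) + szego 0)" by (simp add: kb_def)
  also have "\<dots> = cs (cnj w) (A (forward_shift (szego w))) + kb 0"
    using linop_A fH szego_H2[of 0] by (simp add: H2.linop_def H2_cs kb_def)
  finally show ?thesis using X_adj_A[OF szego_H2[OF w]] by (simp add: kb_def)
qed

subsection \<open>Polynomials\<close>

text \<open>Polynomials cut to the disc, described by eventually vanishing coefficients.\<close>

definition polys :: "cfun set" where
  "polys = {h \<in> H2. \<exists>N. \<forall>n\<ge>N. tc h n = 0}"

lemma polys_H2: "h \<in> polys \<Longrightarrow> h \<in> H2"
  by (simp add: polys_def)

lemma monomial_polys: "monomial n \<in> polys"
  by (auto simp: polys_def monomial_H2 tc_monomial intro!: exI[of _ "Suc n"])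

lemma polys_add: "f \<in> polys \<Longrightarrow> g \<in> polys \<Longrightarrow> f + g \<in> polys"
proof -
  assume f: "f \<in> polys" and g: "g \<in> polys"
  then obtain N N' where "\<forall>n\<ge>N. tc f n = 0" "\<forall>n\<ge>N'. tc g n = 0" by (auto simp: polys_def)
  then have "\<forall>n\<ge>max N N'. tc (f + g) n = 0" using f g by (simp add: tc_plus polys_H2)
  moreover have "f + g \<in> H2" by (intro H2_add polys_H2 f g)
  ultimately show ?thesis unfolding polys_def by blast
qed

lemma polys_cs: "f \<in> polys \<Longrightarrow> cs c f \<in> polys"
  by (auto simp: polys_def H2_cs tc_cs)

lemma monomial_Suc: "monomial (Suc n) = forward_shift (monomial n)"
  by (auto simp: monomial_def cut_def forward_shift_def)

lemma tc_M_monomial: "k < n \<Longrightarrow> tc (M (monomial n)) k = 0"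
proof (induction n arbitrary: k)
  case (Suc n)
  have eq: "M (monomial (Suc n)) = forward_shift (M (monomial n))" by (simp add: monomial_Suc M_forward_shift)
  show ?case using Suc forward_shift_H2[OF M_H2[OF monomial_H2[of n]]] unfolding eq by (cases k) auto
qed simp

text \<open>The n-th coefficient of \<open>Ms h\<close> is the pairing of \<open>h\<close> with b
  z^n, which vanishes to order n at 0 and so misses polynomials of degree below n.\<close>

lemma Ms_polys: "h \<in> polys \<Longrightarrow> Ms h \<in> polys"
proof -
  assume h: "h \<in> polys"
  then obtain N where N: "\<forall>n\<ge>N. tc h n = 0" by (auto simp: polys_def)
  note hH = polys_H2[OF h]
  have "tc (Ms h) n = 0" if "n \<ge> N" for n
  proof -
    have "tc (Ms h) n = H2_inner h (M (monomial n))"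
      using H2_inner_monomial[OF Ms_H2[OF hH]] Ms_adjoint[OF hH monomial_H2] by simp
    moreover have "(\<lambda>k. tc h k * cnj (tc (M (monomial n)) k)) = (\<lambda>k. 0)"
    proof
      fix k
      show "tc h k * cnj (tc (M (monomial n)) k) = 0"
        using N tc_M_monomial[of k n] that by (cases "k < n") auto
    qed
    ultimately show ?thesis
      using H2_inner_sums[OF hH M_H2[OF monomial_H2[of n]]] sums_unique2[OF sums_zero] by simp
  qed
  then show ?thesis using Ms_H2[OF hH] unfolding polys_def by blast
qed

lemma polys_bounded:
  assumes h: "h \<in> polys"
  shows "\<exists>B\<ge>0. \<forall>z. cmod z < 1 \<longrightarrow> cmod (h z) \<le> B"
proof -
  obtain N where N: "\<forall>n\<ge>N. tc h n = 0" using h by (auto simp: polys_def)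
  have "cmod (h z) \<le> (\<Sum>n<N. cmod (tc h n))" if z: "cmod z < 1" for z
  proof -
    have "(\<lambda>n. tc h n * z ^ n) sums (\<Sum>n<N. tc h n * z ^ n)"
      by (rule sums_finite) (use N in auto)
    then have "h z = (\<Sum>n<N. tc h n * z ^ n)"
      by (rule sums_unique2[OF tc_sums[OF H2_disc_hol[OF polys_H2[OF h]] z]])
    also have "cmod \<dots> \<le> (\<Sum>n<N. cmod (tc h n * z ^ n))" by (rule norm_sum)
    also have "\<dots> \<le> (\<Sum>n<N. cmod (tc h n))"
      using z by (intro sum_mono) (auto simp: norm_mult norm_power intro!: mult_left_le power_le_one)
    finally show ?thesis .
  qed
  moreover have "0 \<le> (\<Sum>n<N. cmod (tc h n))" by (simp add: sum_nonneg)
  ultimately show ?thesis by blast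
qed

text \<open>Pairing with \<open>A (monomial n)\<close> reads off the n-th Taylor coefficient, so an
  orthogonal vector is 0.\<close>

lemma polys_dense:
  assumes u: "u \<in> Hb b"
  shows "\<exists>s. hb.tends (\<lambda>n. A (s n)) u \<and> (\<forall>n. s n \<in> polys)"
proof -
  have W: "hb.subsp (A ` polys)"
    unfolding hb.subsp_def
  proof (intro conjI ballI allI)
    show "A ` polys \<subseteq> Hb b" using A_Hb polys_H2 by auto
    have "cs 0 (monomial 0) \<in> polys" by (intro polys_cs monomial_polys)
    then show "0 \<in> A ` polys" using H2.linop_zero[OF linop_A] by (auto simp: cs_zero image_iff)
    fix f assume f: "f \<in> A ` polys"
    then obtain f' where f': "f' \<in> polys" "f = A f'" by blast
    show "cs c f \<in> A ` polys" for c
    proof -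
      have "cs c f = A (cs c f')" using f' linop_A polys_H2 by (simp add: H2.linop_def)
      then show ?thesis using polys_cs[OF f'(1)] by blast
    qed
    fix g assume "g \<in> A ` polys"
    then obtain g' where g': "g' \<in> polys" "g = A g'" by blast
    have "f + g = A (f' + g')" using f' g' linop_A polys_H2 by (simp add: H2.linop_def)
    then show "f + g \<in> A ` polys" using polys_add[OF f'(1) g'(1)] by blast
  qed
  have "\<exists>s. hb.tends s u \<and> (\<forall>n. s n \<in> A ` polys)"
  proof (rule hb.dense_if_orthogonal_trivial[OF W _ u])
    fix f assume f: "f \<in> Hb b" and orth: "\<And>w. w \<in> A ` polys \<Longrightarrow> Hb_inner b w f = 0"
    have "tc f n = tc 0 n" for n
    proof -
      have "Hb_inner b (A (monomial n)) f = 0" using orth monomial_polys by blast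
      then have "Hb_inner b f (A (monomial n)) = 0"
        using hb.ip_commute[OF A_Hb[OF monomial_H2] f] by simp
      then have "tc f n = 0"
        using Hb_inner_A[OF f monomial_H2] H2_inner_monomial[OF Hb_H2[OF f]] by simp
      then show ?thesis using tc_cs[OF H2_zero, of 0 n] by (simp add: cs_zero)
    qed
    then show "f = 0" by (intro H2_eqI Hb_H2 f H2_zero)
  qed
  then obtain t where t: "hb.tends t u" "\<forall>n. \<exists>h. h \<in> polys \<and> t n = A h" by blast
  from choice[OF t(2)] obtain s where s: "\<forall>n. s n \<in> polys \<and> t n = A (s n)" by blast
  then have "t = (\<lambda>n. A (s n))" by auto
  then show ?thesis using t(1) s by auto
qed

end


section \<open>Bounded kernels near a point put it into the resolvent set\<close>

section \<open>Small arcs\<close>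

lemma measure_arc_singleton: "measure arc_measure {l} = 0"
proof (cases "\<exists>s. cis s = l")
  case True
  then obtain s where s: "cis s = l" by blast
  have "cis -` {l} \<subseteq> range (\<lambda>n::int. s + 2 * pi * n)"
  proof
    fix t assume "t \<in> cis -` {l}"
    then have "cis t = cis s" using s by simp
    then have "sin t = sin s \<and> cos t = cos s" by (simp add: complex_eq_iff)
    then show "t \<in> range (\<lambda>n::int. s + 2 * pi * n)" using sin_cos_eq_iff[of t s] by auto
  qed
  then have "countable (cis -` {l})" by (rule countable_subset) auto
  then have "emeasure lborel (cis -` {l}) = 0" by (rule emeasure_lborel_countable)
  then have "emeasure lborel ({0..2 * pi} \<inter> cis -` {l}) \<le> 0"
    by (metis (no_types, lifting) Int_lower2 emeasure_mono measurable_cis measurable_sets_borel borel_singleton sets.empty_sets sets_lborel)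
  then have "emeasure (uniform_measure lborel {0..2 * pi}) (cis -` {l}) = 0"
    using measurable_sets_borel[OF measurable_cis, of "{l}"] by (subst emeasure_uniform_measure) auto
  then have "emeasure arc_measure {l} = 0"
    unfolding arc_measure_def by (subst emeasure_distr) auto
  then show ?thesis by (simp add: measure_def)
next
  case False
  then have "cis -` {l} = {}" by auto
  then have "emeasure arc_measure {l} = 0"
    unfolding arc_measure_def by (subst emeasure_distr) auto
  then show ?thesis by (simp add: measure_def)
qed

text \<open>Points have measure zero, so continuity from above applies to shrinking balls.\<close>

lemma small_arc:
  assumes "e > 0" "\<rho> > 0"
  shows "\<exists>\<delta>>0. \<delta> < \<rho> \<and> measure arc_measure (ball l \<delta>) < e"
proof -
  define B where "B n = ball l (1 / real (Suc n))" for n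
  have "decseq B" unfolding decseq_def B_def by (auto simp: field_simps intro!: subset_ball)
  moreover have "range B \<subseteq> sets arc_measure" by (auto simp: B_def)
  moreover have "(\<Inter>n. B n) = {l}"
  proof
    show "(\<Inter>n. B n) \<subseteq> {l}"
    proof
      fix x assume x: "x \<in> (\<Inter>n. B n)"
      show "x \<in> {l}"
      proof (rule ccontr)
        assume "x \<notin> {l}"
        then have "dist l x > 0" by auto
        then obtain n where "1 / real (Suc n) < dist l x" using nat_approx_posE by blast
        then show False using x by (auto simp: B_def dest!: spec[of _ n])
      qed
    qed
  qed (auto simp: B_def)
  ultimately have "(\<lambda>n. measure arc_measure (B n)) \<longlonglongrightarrow> 0"
    using arc.finite_Lim_measure_decseq[of B] by (simp add: measure_arc_singleton)
  then have "\<forall>\<^sub>F n in sequentially. measure arc_measure (B n) < e"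
    using \<open>e > 0\<close> by (rule order_tendstoD(2))
  moreover have "\<forall>\<^sub>F n in sequentially. 1 / real (Suc n) < \<rho>"
    using LIMSEQ_Suc[OF lim_1_over_n[where 'a = real]] \<open>\<rho> > 0\<close> by (intro order_tendstoD(2)) auto
  ultimately have "\<forall>\<^sub>F n in sequentially. measure arc_measure (B n) < e \<and> 1 / real (Suc n) < \<rho>"
    by (rule eventually_conj)
  then obtain n where "measure arc_measure (B n) < e" "1 / real (Suc n) < \<rho>"
    by (auto simp: eventually_sequentially)
  then show ?thesis unfolding B_def by (intro exI[of _ "1 / real (Suc n)"]) auto
qed

context schur
begin

section \<open>Bounded kernels imply invertibility\<close>

text \<open>The kernel function \<open>\<parallel>kb w\<parallel>\<^sup>2 = (1 - |b w|\<^sup>2) / (1 - |w|\<^sup>2)\<close> stays bounded near \<open>l\<close>.\<close>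

definition kernel_bounded_at :: "complex \<Rightarrow> bool" where
  "kernel_bounded_at l \<longleftrightarrow> (\<exists>C \<rho>. \<rho> > 0 \<and>
     (\<forall>w. cmod w < 1 \<and> cmod (w - l) < \<rho> \<longrightarrow> 1 - (cmod (b w))\<^sup>2 \<le> C * (1 - (cmod w)\<^sup>2)))"

lemma kernel_bounded_atE:
  assumes "kernel_bounded_at l"
  obtains C \<rho> where "\<rho> > 0" "C \<ge> 0"
    "\<And>w. cmod w < 1 \<Longrightarrow> cmod (w - l) < \<rho> \<Longrightarrow> 1 - (cmod (b w))\<^sup>2 \<le> C * (1 - (cmod w)\<^sup>2)"
proof -
  obtain C \<rho> where C: "\<rho> > 0"
    "\<And>w. cmod w < 1 \<Longrightarrow> cmod (w - l) < \<rho> \<Longrightarrow> 1 - (cmod (b w))\<^sup>2 \<le> C * (1 - (cmod w)\<^sup>2)"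
    using assms unfolding kernel_bounded_at_def by blast
  have "1 - (cmod (b w))\<^sup>2 \<le> \<bar>C\<bar> * (1 - (cmod w)\<^sup>2)" if w: "cmod w < 1" "cmod (w - l) < \<rho>" for w
  proof -
    have "(cmod w)\<^sup>2 \<le> 1" using w by (simp add: power_le_one)
    then have "C * (1 - (cmod w)\<^sup>2) \<le> \<bar>C\<bar> * (1 - (cmod w)\<^sup>2)" by (intro mult_right_mono) auto
    then show ?thesis using C(2)[OF w] by linarith
  qed
  then show ?thesis using that[of \<rho> "\<bar>C\<bar>"] C(1) by auto
qed

lemma rad_mult_close:
  assumes l: "cmod l = 1"
  shows "cmod (of_real (rad n) * l) < 1" "cmod (of_real (rad n) * l - l) = 1 - rad n"
proof -
  show "cmod (of_real (rad n) * l) < 1" using l rad[of n] by (simp add: norm_mult)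
  have "of_real (rad n) * l - l = of_real (rad n - 1) * l" by (simp add: algebra_simps)
  then show "cmod (of_real (rad n) * l - l) = 1 - rad n"
    using l rad[of n] by (simp only: norm_mult norm_of_real) simp
qed

lemma one_minus_rad: "(\<lambda>n. 1 - rad n) \<longlonglongrightarrow> 0"
  using tendsto_diff[OF tendsto_const rad_tendsto, of 1] by simp

lemma eventually_rad: "e > 0 \<Longrightarrow> \<forall>\<^sub>F n in sequentially. 1 - rad n < e"
  using one_minus_rad by (rule order_tendstoD(2))

lemma modulus_tendsto_1:
  assumes kb: "kernel_bounded_at l" and l: "cmod l = 1"
  shows "(\<lambda>n. cmod (b (of_real (rad n) * l))) \<longlonglongrightarrow> 1"
proof -
  obtain C \<rho> where \<rho>: "\<rho> > 0" and C: "C \<ge> 0"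
    "\<And>w. cmod w < 1 \<Longrightarrow> cmod (w - l) < \<rho> \<Longrightarrow> 1 - (cmod (b w))\<^sup>2 \<le> C * (1 - (cmod w)\<^sup>2)"
    using kernel_bounded_atE[OF kb] by blast
  have "(\<lambda>n. (cmod (b (of_real (rad n) * l)))\<^sup>2) \<longlonglongrightarrow> 1"
  proof (rule tendsto_sandwich)
    show "\<forall>\<^sub>F n in sequentially. 1 - C * (1 - (rad n)\<^sup>2) \<le> (cmod (b (of_real (rad n) * l)))\<^sup>2"
      using eventually_rad[OF \<rho>]
    proof eventually_elim
      fix n assume "1 - rad n < \<rho>"
      then have "1 - (cmod (b (of_real (rad n) * l)))\<^sup>2 \<le> C * (1 - (cmod (of_real (rad n) * l))\<^sup>2)"
        using rad_mult_close[OF l, of n] by (intro C(2)) simp_all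
      also have "cmod (of_real (rad n) * l) = rad n" using l rad[of n] by (simp add: norm_mult)
      finally show "1 - C * (1 - (rad n)\<^sup>2) \<le> (cmod (b (of_real (rad n) * l)))\<^sup>2" by linarith
    qed
    show "\<forall>\<^sub>F n in sequentially. (cmod (b (of_real (rad n) * l)))\<^sup>2 \<le> 1"
      using le1 rad_mult_close(1)[OF l] by (intro always_eventually) (auto intro!: power_le_one)
    have "(\<lambda>n. 1 - C * (1 - (rad n)\<^sup>2)) \<longlonglongrightarrow> 1 - C * (1 - 1\<^sup>2)" by (intro tendsto_intros rad_tendsto)
    then show "(\<lambda>n. 1 - C * (1 - (rad n)\<^sup>2)) \<longlonglongrightarrow> 1" by simp
  qed simp
  then have "(\<lambda>n. sqrt ((cmod (b (of_real (rad n) * l)))\<^sup>2)) \<longlonglongrightarrow> sqrt 1" by (rule tendsto_real_sqrt)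
  then show ?thesis by simp
qed

text \<open>Reproducing property and Cauchy-Schwarz; the hypothesis says that the kernel at
  \<open>w\<close> has squared norm at most \<open>C\<close>.\<close>

lemma Hb_point_bound:
  assumes C: "1 - (cmod (b w))\<^sup>2 \<le> C * (1 - (cmod w)\<^sup>2)" "0 \<le> C" and w: "cmod w < 1" and u: "u \<in> Hb b"
  shows "cmod (u w) \<le> sqrt C * hb.nrm u"
proof -
  have pos: "0 < 1 - (cmod w)\<^sup>2" using w by (simp add: power_less_one_iff)
  have "(hb.nrm (kb w))\<^sup>2 \<le> C" unfolding kb_nrm_sq[OF w] using C pos by (simp add: field_simps)
  then have k: "hb.nrm (kb w) \<le> sqrt C" by (rule real_le_rsqrt)
  have "cmod (u w) \<le> hb.nrm u * hb.nrm (kb w)"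
    using hb.Cauchy_Schwarz[OF u kb_Hb[OF w]] Hb_inner_kb[OF u w] by simp
  also have "\<dots> \<le> hb.nrm u * sqrt C" by (rule mult_left_mono[OF k hb.nrm_nonneg[OF u]])
  finally show ?thesis by (simp add: mult.commute)
qed

text \<open>Equals |A h|^2 + (1 - |b|^2) |Ms h|^2 at the point \<open>rad n\<close> times \<zeta>.
  The expanded form makes each term the squared modulus of an \<open>H2\<close> function, whose
  circle means converge.\<close>

definition density :: "nat \<Rightarrow> cfun \<Rightarrow> complex \<Rightarrow> real" where
  "density n h \<zeta> = (cmod (A h (of_real (rad n) * \<zeta>)))\<^sup>2 + (cmod (Ms h (of_real (rad n) * \<zeta>)))\<^sup>2
     - (cmod (M (Ms h) (of_real (rad n) * \<zeta>)))\<^sup>2"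

lemma density_integrable: "h \<in> H2 \<Longrightarrow> integrable arc_measure (density n h)"
  unfolding density_def
  by (intro Bochner_Integration.integrable_add Bochner_Integration.integrable_diff integrable_circle_sq H2_disc_hol A_H2 Ms_H2 M_H2 rad)

text \<open>In \<open>H2\<close> one has |A h|^2 = |h|^2 - 2 |Ms h|^2 + |M (Ms h)|^2, so the limit
  reduces to |h|^2 - |Ms h|^2, the squared norm of \<open>A h\<close> in the space.\<close>

lemma density_tendsto:
  assumes h: "h \<in> H2"
  shows "(\<lambda>n. LINT \<zeta>|arc_measure. density n h \<zeta>) \<longlonglongrightarrow> (hb.nrm (A h))\<^sup>2"
proof -
  have int: "integrable arc_measure (\<lambda>\<zeta>. (cmod (f (of_real (rad n) * \<zeta>)))\<^sup>2)" if "f \<in> H2" for f n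
    by (intro integrable_circle_sq H2_disc_hol that rad)
  have eq: "(LINT \<zeta>|arc_measure. density n h \<zeta>) = (LINT \<zeta>|arc_measure. (cmod (A h (of_real (rad n) * \<zeta>)))\<^sup>2) +
      (LINT \<zeta>|arc_measure. (cmod (Ms h (of_real (rad n) * \<zeta>)))\<^sup>2) - (LINT \<zeta>|arc_measure. (cmod (M (Ms h) (of_real (rad n) * \<zeta>)))\<^sup>2)" for n
    unfolding density_def using int[OF A_H2[OF h]] int[OF Ms_H2[OF h]] int[OF M_H2[OF Ms_H2[OF h]]] by simp
  have "H2_inner h (M (Ms h)) = H2_inner (Ms h) (Ms h)" using Ms_adjoint[OF h Ms_H2[OF h]] by simp
  then have "(H2.nrm (A h))\<^sup>2 = (H2.nrm h)\<^sup>2 - 2 * (H2.nrm (Ms h))\<^sup>2 + (H2.nrm (M (Ms h)))\<^sup>2"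
    unfolding A_def H2.nrm_diff_sq[OF h M_H2[OF Ms_H2[OF h]]] by (simp add: H2.nrm_sq Ms_H2 h)
  then have "(H2.nrm (A h))\<^sup>2 + (H2.nrm (Ms h))\<^sup>2 - (H2.nrm (M (Ms h)))\<^sup>2 = (hb.nrm (A h))\<^sup>2"
    by (simp add: hb_nrm_A_sq h)
  moreover have "(\<lambda>n. LINT \<zeta>|arc_measure. density n h \<zeta>) \<longlonglongrightarrow>
      (H2.nrm (A h))\<^sup>2 + (H2.nrm (Ms h))\<^sup>2 - (H2.nrm (M (Ms h)))\<^sup>2"
    unfolding eq by (intro tendsto_intros circle_mean_tendsto A_H2 Ms_H2 M_H2 h)
  ultimately show ?thesis by simp
qed

lemma norm_diff_sq_le: "(cmod (x - y))\<^sup>2 \<le> 2 * ((cmod x)\<^sup>2 + (cmod y)\<^sup>2)"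
proof -
  have "(cmod (x - y))\<^sup>2 \<le> (cmod x + cmod y)\<^sup>2" by (intro power_mono norm_triangle_ineq4) simp
  also have "\<dots> \<le> 2 * ((cmod x)\<^sup>2 + (cmod y)\<^sup>2)"
    using sum_squares_bound[of "cmod x" "cmod y"] by (simp add: power2_sum)
  finally show ?thesis .
qed

definition resolvent_op :: "complex \<Rightarrow> cfun \<Rightarrow> cfun" where
  "resolvent_op l f = cs l f - X_adj b f"

definition lin_mult :: "complex \<Rightarrow> cfun \<Rightarrow> cfun" where
  "lin_mult l h = cs l h - forward_shift h"

lemma lin_mult_H2: "h \<in> H2 \<Longrightarrow> lin_mult l h \<in> H2"
  unfolding lin_mult_def by (intro H2.V_diff H2_cs forward_shift_H2(1))

lemma resolvent_op_A:
  assumes h: "h \<in> H2"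
  shows "resolvent_op l (A h) = A (lin_mult l h)"
proof -
  have "A (lin_mult l h) = A (cs l h) - A (forward_shift h)"
    unfolding lin_mult_def by (rule H2.linop_diff[OF linop_A H2_cs[OF h] forward_shift_H2(1)[OF h]])
  then show ?thesis using linop_A h by (simp add: resolvent_op_def X_adj_A H2.linop_def)
qed

text \<open>The backward shift takes \<open>Ms (forward_shift h)\<close> to \<open>Ms h\<close>, so
  the former is z \<open>Ms h\<close> plus its value \<kappa> at 0. The second formula follows by
  inserting the first into the definition of \<open>A\<close>.\<close>

lemma lin_mult_values:
  assumes h: "h \<in> H2"
  obtains \<kappa> where "\<And>z. cmod z < 1 \<Longrightarrow> Ms (lin_mult l h) z = (l - z) * Ms h z - \<kappa>"
    and "\<And>z. cmod z < 1 \<Longrightarrow> A (lin_mult l h) z = (l - z) * A h z + \<kappa> * b z"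
proof -
  define \<kappa> where "\<kappa> = Ms (forward_shift h) 0"
  have fh: "forward_shift h \<in> H2" by (rule forward_shift_H2(1)[OF h])
  have s: "Ms (forward_shift h) z = z * Ms h z + \<kappa>" if "cmod z < 1" for z
  proof (cases "z = 0")
    case False
    have "backward_shift (Ms (forward_shift h)) z = Ms h z" by (simp only: backward_shift_Ms[OF h])
    then show ?thesis using False that by (simp add: backward_shift_def \<kappa>_def field_simps)
  qed (simp add: \<kappa>_def)
  have "Ms (lin_mult l h) = Ms (cs l h) - Ms (forward_shift h)"
    unfolding lin_mult_def by (rule H2.linop_diff[OF linop_Ms H2_cs[OF h] fh])
  also have "Ms (cs l h) = cs l (Ms h)" using linop_Ms h by (simp add: H2.linop_def)
  finally have 1: "Ms (lin_mult l h) z = (l - z) * Ms h z - \<kappa>" if "cmod z < 1" for z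
    using s[OF that] by (simp add: cs_apply algebra_simps)
  have 2: "A (lin_mult l h) z = (l - z) * A h z + \<kappa> * b z" if "cmod z < 1" for z
  proof -
    have "A (lin_mult l h) z = lin_mult l h z - b z * Ms (lin_mult l h) z" "A h z = h z - b z * Ms h z"
      using that by (simp_all add: A_def M_def)
    moreover have "lin_mult l h z = (l - z) * h z"
      using that by (simp add: lin_mult_def cs_apply forward_shift_def algebra_simps)
    ultimately show ?thesis using 1[OF that] by (simp only:) (simp add: algebra_simps)
  qed
  show ?thesis by (rule that[OF 1 2])
qed

text \<open>The lower bound for \<open>l - X\<^sup>*\<close>. Off a small arc around \<open>l\<close> one divides by \<open>l - z\<close>; on the arc
  the pointwise bound by the norm is absorbed, the arc having small measure.\<close>

lemma resolvent_lower_bound_polys: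
  assumes kb: "kernel_bounded_at l" and l: "cmod l = 1"
  shows "\<exists>D. \<forall>h\<in>polys. (hb.nrm (A h))\<^sup>2 \<le> D * (hb.nrm (A (lin_mult l h)))\<^sup>2"
proof -
  obtain C \<rho> where \<rho>: "\<rho> > 0" and C0: "C \<ge> 0"
    and C: "\<And>w. cmod w < 1 \<Longrightarrow> cmod (w - l) < \<rho> \<Longrightarrow> 1 - (cmod (b w))\<^sup>2 \<le> C * (1 - (cmod w)\<^sup>2)"
    using kernel_bounded_atE[OF kb] by blast
  \<comment> \<open>The measure makes \<mu> C at most 1/2, as absorption requires; \<delta> below
    \<rho> / 2 keeps points radially close to the arc inside the region of the kernel bound.\<close>
  obtain \<delta> where \<delta>: "\<delta> > 0" "\<delta> < \<rho> / 2" and m: "measure arc_measure (ball l \<delta>) < 1 / (2 * C + 1)"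
    using small_arc[of "1 / (2 * C + 1)" "\<rho> / 2" l] \<rho> C0 by auto
  define \<mu> where "\<mu> = measure arc_measure (ball l \<delta>)"
  have \<mu>: "0 \<le> \<mu>" "\<mu> * C \<le> 1/2"
  proof -
    have "\<mu> * C \<le> 1 / (2 * C + 1) * C" unfolding \<mu>_def using m C0 by (intro mult_right_mono) auto
    also have "\<dots> \<le> 1/2" using C0 by (simp add: field_simps)
    finally show "\<mu> * C \<le> 1/2" .
  qed (simp add: \<mu>_def)
  \<comment> \<open>4/\<delta>^2 from dividing by |l - w| >= \<delta>/2, and a factor 2 from
    \<open>norm_diff_sq_le\<close>.\<close>
  define E where "E = 8 / \<delta>\<^sup>2"
  have E: "0 \<le> E" by (simp add: E_def)
  have "(hb.nrm (A h))\<^sup>2 \<le> 2 * (E * (1 + 2 * C)) * (hb.nrm (A (lin_mult l h)))\<^sup>2"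
    if hp: "h \<in> polys" for h
  proof -
    note h = polys_H2[OF hp]
    define h' where "h' = lin_mult l h"
    have h': "h' \<in> H2" using lin_mult_H2[OF h] by (simp add: h'_def)
    define nf where "nf = hb.nrm (A h)"
    define ng where "ng = hb.nrm (A h')"
    have n0: "0 \<le> nf" "0 \<le> ng" unfolding nf_def ng_def using A_Hb h h' by (auto intro: hb.nrm_nonneg)
    obtain \<kappa> where K1: "\<And>z. cmod z < 1 \<Longrightarrow> Ms h' z = (l - z) * Ms h z - \<kappa>"
      and K2: "\<And>z. cmod z < 1 \<Longrightarrow> A h' z = (l - z) * A h z + \<kappa> * b z"
      using lin_mult_values[OF h] unfolding h'_def by blast
    have pt: "cmod (A k w) \<le> sqrt C * hb.nrm (A k)" if "cmod w < 1" "cmod (w - l) < \<rho>" "k \<in> H2" for k w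
      by (rule Hb_point_bound[OF C[OF that(1,2)] C0 that(1) A_Hb[OF that(3)]])
    \<comment> \<open>The relation \<kappa> b(w) = A h' w - (l - w) A h w is evaluated along the
      radius to \<open>l\<close>: the last term vanishes since \<open>A h\<close> is bounded there,
      and |b| tends to 1.\<close>
    have "cmod \<kappa> \<le> sqrt C * ng"
    proof (rule LIMSEQ_le)
      show "(\<lambda>n. cmod \<kappa> * cmod (b (of_real (rad n) * l))) \<longlonglongrightarrow> cmod \<kappa>"
        using tendsto_mult[OF tendsto_const modulus_tendsto_1[OF kb l], of "cmod \<kappa>"] by simp
      have "(\<lambda>n. sqrt C * ng + (1 - rad n) * (sqrt C * nf)) \<longlonglongrightarrow> sqrt C * ng + 0 * (sqrt C * nf)"
        by (intro tendsto_intros one_minus_rad)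
      then show "(\<lambda>n. sqrt C * ng + (1 - rad n) * (sqrt C * nf)) \<longlonglongrightarrow> sqrt C * ng" by simp
      have "\<forall>\<^sub>F n in sequentially. cmod \<kappa> * cmod (b (of_real (rad n) * l)) \<le> sqrt C * ng + (1 - rad n) * (sqrt C * nf)"
        using eventually_rad[OF \<rho>]
      proof eventually_elim
        fix n assume n: "1 - rad n < \<rho>"
        define w where "w = of_real (rad n) * l"
        have w: "cmod w < 1" "cmod (w - l) = 1 - rad n" unfolding w_def by (rule rad_mult_close[OF l])+
        have "\<kappa> * b w = A h' w - (l - w) * A h w" using K2[OF w(1)] by simp
        then have "cmod \<kappa> * cmod (b w) = cmod (A h' w - (l - w) * A h w)" by (metis norm_mult)
        also have "\<dots> \<le> cmod (A h' w) + cmod (l - w) * cmod (A h w)"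
          using norm_triangle_ineq4[of "A h' w" "(l - w) * A h w"] by (simp add: norm_mult)
        also have "\<dots> \<le> sqrt C * ng + (1 - rad n) * (sqrt C * nf)"
          unfolding nf_def ng_def using w n pt[of w] h h' rad[of n]
          by (intro add_mono mult_mono) (auto simp: norm_minus_commute)
        finally show "cmod \<kappa> * cmod (b (of_real (rad n) * l)) \<le> sqrt C * ng + (1 - rad n) * (sqrt C * nf)"
          by (simp add: w_def)
      qed
      then show "\<exists>N. \<forall>n\<ge>N. cmod \<kappa> * cmod (b (of_real (rad n) * l)) \<le> sqrt C * ng + (1 - rad n) * (sqrt C * nf)"
        by (simp add: eventually_sequentially)
    qed
    then have "(cmod \<kappa>)\<^sup>2 \<le> (sqrt C * ng)\<^sup>2" by (intro power_mono) auto
    then have \<kappa>: "(cmod \<kappa>)\<^sup>2 \<le> C * ng\<^sup>2" using C0 by (simp add: power_mult_distrib)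
    obtain B where B: "B \<ge> 0" "\<And>z. cmod z < 1 \<Longrightarrow> cmod (Ms h z) \<le> B"
      using polys_bounded[OF Ms_polys[OF hp]] by blast
    \<comment> \<open>Bounds the density over the arc. The second summand involves the bound
      \<open>B\<close> of the polynomial \<open>Ms h\<close>, but its factor tends to 0, so the
      final constant does not depend on \<open>h\<close>.\<close>
    define J where "J n = C * nf\<^sup>2 + C * (1 - (rad n)\<^sup>2) * B\<^sup>2" for n
    have J0: "0 \<le> J n" for n
    proof -
      have "(rad n)\<^sup>2 \<le> 1" using rad[of n] by (simp add: power_le_one)
      then show ?thesis unfolding J_def using C0 by simp
    qed
    have pointwise: "density n h \<zeta> \<le> indicator (ball l \<delta>) \<zeta> * J n + E * (density n h' \<zeta> + 2 * (cmod \<kappa>)\<^sup>2)"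
      if \<zeta>: "cmod \<zeta> = 1" and n: "1 - rad n < \<delta> / 2" for n \<zeta>
    proof -
      define w where "w = of_real (rad n) * \<zeta>"
      have w: "cmod w < 1" "cmod w = rad n" using \<zeta> rad[of n] by (auto simp: w_def norm_mult)
      have wz: "cmod (w - \<zeta>) = 1 - rad n" unfolding w_def by (rule rad_mult_close(2)[OF \<zeta>])
      define \<beta> where "\<beta> = 1 - (cmod (b w))\<^sup>2"
      have \<beta>: "0 \<le> \<beta>" "\<beta> \<le> 1" using le1[OF w(1)] by (auto simp: \<beta>_def power_le_one)
      have dens: "density n k \<zeta> = (cmod (A k w))\<^sup>2 + \<beta> * (cmod (Ms k w))\<^sup>2" for k
        unfolding density_def w_def[symmetric] \<beta>_def M_def norm_mult power_mult_distrib
        by (simp add: algebra_simps)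
      have d'0: "0 \<le> density n h' \<zeta>" unfolding dens using \<beta> by simp
      show ?thesis
      proof (cases "\<zeta> \<in> ball l \<delta>")
        case True
        have "cmod (w - l) \<le> cmod (w - \<zeta>) + cmod (\<zeta> - l)"
          using norm_triangle_ineq[of "w - \<zeta>" "\<zeta> - l"] by simp
        then have wl: "cmod (w - l) < \<rho>" using True n wz \<delta> by (simp add: dist_norm norm_minus_commute)
        have "(cmod (A h w))\<^sup>2 \<le> (sqrt C * nf)\<^sup>2" unfolding nf_def by (intro power_mono pt w wl h) simp
        then have 1: "(cmod (A h w))\<^sup>2 \<le> C * nf\<^sup>2" using C0 by (simp add: power_mult_distrib)
        have "\<beta> * (cmod (Ms h w))\<^sup>2 \<le> (C * (1 - (rad n)\<^sup>2)) * B\<^sup>2"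
          using C[OF w(1) wl] B(2)[OF w(1)] \<beta> unfolding \<beta>_def w(2)[symmetric]
          by (intro mult_mono power_mono) auto
        then have "density n h \<zeta> \<le> J n" unfolding dens J_def using 1 by simp
        moreover have "0 \<le> E * (density n h' \<zeta> + 2 * (cmod \<kappa>)\<^sup>2)" using E d'0 by simp
        ultimately show ?thesis using True by simp
      next
        case False
        have "cmod (l - \<zeta>) \<le> cmod (l - w) + cmod (w - \<zeta>)"
          using norm_triangle_ineq[of "l - w" "w - \<zeta>"] by simp
        then have lw: "\<delta> / 2 \<le> cmod (l - w)" using False n wz by (simp add: dist_norm)
        have div: "(cmod x)\<^sup>2 \<le> (4 / \<delta>\<^sup>2) * (cmod ((l - w) * x))\<^sup>2" for x
        proof -
          have "(\<delta> / 2)\<^sup>2 * (cmod x)\<^sup>2 \<le> (cmod (l - w))\<^sup>2 * (cmod x)\<^sup>2"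
            using lw \<delta> by (intro mult_right_mono power_mono) auto
          then show ?thesis using \<delta> unfolding norm_mult power_mult_distrib by (simp add: power_divide field_simps)
        qed
        have "(cmod (A h w))\<^sup>2 \<le> (4 / \<delta>\<^sup>2) * (cmod (A h' w - \<kappa> * b w))\<^sup>2"
          using div[of "A h w"] K2[OF w(1)] by simp
        also have "\<dots> \<le> (4 / \<delta>\<^sup>2) * (2 * ((cmod (A h' w))\<^sup>2 + (cmod (\<kappa> * b w))\<^sup>2))"
          by (intro mult_left_mono norm_diff_sq_le) simp
        also have "\<dots> = E * ((cmod (A h' w))\<^sup>2 + (cmod \<kappa>)\<^sup>2 * (1 - \<beta>))"
          by (simp add: E_def \<beta>_def norm_mult power_mult_distrib)
        finally have 1: "(cmod (A h w))\<^sup>2 \<le> E * ((cmod (A h' w))\<^sup>2 + (cmod \<kappa>)\<^sup>2 * (1 - \<beta>))" .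
        have "(cmod (Ms h w))\<^sup>2 \<le> (4 / \<delta>\<^sup>2) * (cmod (Ms h' w - (- \<kappa>)))\<^sup>2"
          using div[of "Ms h w"] K1[OF w(1)] by simp
        also have "\<dots> \<le> (4 / \<delta>\<^sup>2) * (2 * ((cmod (Ms h' w))\<^sup>2 + (cmod (- \<kappa>))\<^sup>2))"
          by (intro mult_left_mono norm_diff_sq_le) simp
        also have "\<dots> = E * ((cmod (Ms h' w))\<^sup>2 + (cmod \<kappa>)\<^sup>2)" by (simp add: E_def)
        finally have "\<beta> * (cmod (Ms h w))\<^sup>2 \<le> \<beta> * (E * ((cmod (Ms h' w))\<^sup>2 + (cmod \<kappa>)\<^sup>2))"
          using \<beta> by (intro mult_left_mono) auto
        then have "density n h \<zeta> \<le> E * (density n h' \<zeta> + (cmod \<kappa>)\<^sup>2)"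
          unfolding dens using 1 by (simp add: algebra_simps)
        also have "\<dots> \<le> E * (density n h' \<zeta> + 2 * (cmod \<kappa>)\<^sup>2)" using E by (intro mult_left_mono) auto
        finally show ?thesis using False by simp
      qed
    qed
    have integrated: "(LINT \<zeta>|arc_measure. density n h \<zeta>) \<le> \<mu> * J n + E * ((LINT \<zeta>|arc_measure. density n h' \<zeta>) + 2 * (C * ng\<^sup>2))"
      if n: "1 - rad n < \<delta> / 2" for n
    proof -
      have ii: "integrable arc_measure (\<lambda>\<zeta>. indicator (ball l \<delta>) \<zeta> * J n)"
        by (intro integrable_mult_left integrable_real_indicator) (auto simp: arc.emeasure_eq_measure)
      have id: "integrable arc_measure (\<lambda>\<zeta>. E * (density n h' \<zeta> + 2 * (cmod \<kappa>)\<^sup>2))"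
        by (intro integrable_mult_right Bochner_Integration.integrable_add density_integrable h' arc.integrable_const)
      have "(LINT \<zeta>|arc_measure. density n h \<zeta>) \<le>
          (LINT \<zeta>|arc_measure. indicator (ball l \<delta>) \<zeta> * J n + E * (density n h' \<zeta> + 2 * (cmod \<kappa>)\<^sup>2))"
        by (intro integral_mono_AE AE_arc density_integrable h Bochner_Integration.integrable_add ii id) (rule pointwise[OF _ n])
      also have "\<dots> = \<mu> * J n + E * ((LINT \<zeta>|arc_measure. density n h' \<zeta>) + 2 * (cmod \<kappa>)\<^sup>2)"
      proof -
        have "(LINT \<zeta>|arc_measure. density n h' \<zeta> + 2 * (cmod \<kappa>)\<^sup>2) = (LINT \<zeta>|arc_measure. density n h' \<zeta>) + 2 * (cmod \<kappa>)\<^sup>2"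
          using density_integrable[OF h', of n] by simp
        then show ?thesis using ii id by (simp add: \<mu>_def)
      qed
      also have "\<dots> \<le> \<mu> * J n + E * ((LINT \<zeta>|arc_measure. density n h' \<zeta>) + 2 * (C * ng\<^sup>2))"
        using \<kappa> E by (intro add_left_mono mult_left_mono) auto
      finally show ?thesis .
    qed
    have "nf\<^sup>2 \<le> \<mu> * (C * nf\<^sup>2) + E * (ng\<^sup>2 + 2 * (C * ng\<^sup>2))"
    proof (rule LIMSEQ_le)
      show "(\<lambda>n. LINT \<zeta>|arc_measure. density n h \<zeta>) \<longlonglongrightarrow> nf\<^sup>2" unfolding nf_def by (rule density_tendsto[OF h])
      have "J \<longlonglongrightarrow> C * nf\<^sup>2 + C * (1 - 1\<^sup>2) * B\<^sup>2" unfolding J_def by (intro tendsto_intros rad_tendsto)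
      then have J: "J \<longlonglongrightarrow> C * nf\<^sup>2" by simp
      have "(\<lambda>n. LINT \<zeta>|arc_measure. density n h' \<zeta>) \<longlonglongrightarrow> ng\<^sup>2" unfolding ng_def by (rule density_tendsto[OF h'])
      then show "(\<lambda>n. \<mu> * J n + E * ((LINT \<zeta>|arc_measure. density n h' \<zeta>) + 2 * (C * ng\<^sup>2))) \<longlonglongrightarrow>
          \<mu> * (C * nf\<^sup>2) + E * (ng\<^sup>2 + 2 * (C * ng\<^sup>2))"
        by (intro tendsto_intros J)
      have "\<forall>\<^sub>F n in sequentially. 1 - rad n < \<delta> / 2" using \<delta> by (intro eventually_rad) simp
      then show "\<exists>N. \<forall>n\<ge>N. (LINT \<zeta>|arc_measure. density n h \<zeta>) \<le> \<mu> * J n + E * ((LINT \<zeta>|arc_measure. density n h' \<zeta>) + 2 * (C * ng\<^sup>2))"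
        using integrated by (auto simp: eventually_sequentially)
    qed
    moreover have "\<mu> * (C * nf\<^sup>2) \<le> 1/2 * nf\<^sup>2" using mult_right_mono[OF \<mu>(2), of "nf\<^sup>2"] by (simp add: mult_ac)
    ultimately have "nf\<^sup>2 \<le> 1/2 * nf\<^sup>2 + E * (ng\<^sup>2 + 2 * (C * ng\<^sup>2))" by linarith
    then show ?thesis by (simp add: nf_def ng_def h'_def algebra_simps)
  qed
  then show ?thesis by blast
qed

lemma linop_resolvent_op: "hb.linop (resolvent_op l)"
proof -
  have "resolvent_op l (f + g) = resolvent_op l f + resolvent_op l g" if "f \<in> Hb b" "g \<in> Hb b" for f g
    unfolding resolvent_op_def using that linop_X_adj by (simp add: hb.linop_def cs_add_right)
  moreover have "resolvent_op l (cs c f) = cs c (resolvent_op l f)" if "f \<in> Hb b" for f c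
    unfolding resolvent_op_def using that linop_X_adj by (simp add: hb.linop_def cs_diff_right cs_cs mult.commute)
  moreover have "resolvent_op l f \<in> Hb b" if "f \<in> Hb b" for f
    unfolding resolvent_op_def by (intro hb.V_diff hb.V_cs X_adj_Hb that)
  ultimately show ?thesis by (simp add: hb.linop_def)
qed

lemma resolvent_op_le: "f \<in> Hb b \<Longrightarrow> hb.nrm (resolvent_op l f) \<le> (cmod l + 1) * hb.nrm f"
  using hb.nrm_triangle_diff[OF hb.V_cs X_adj_Hb, of f f l] X_adj_le[of f]
  by (simp add: resolvent_op_def hb.nrm_cs algebra_simps)

lemma resolvent_dense:
  assumes l: "cmod l = 1" and u: "u \<in> Hb b" and orth: "\<And>f. f \<in> Hb b \<Longrightarrow> Hb_inner b (resolvent_op l f) u = 0"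
  shows "u = 0"
proof -
  note uH = Hb_H2[OF u]
  have rec: "tc u (Suc n) = cnj l * tc u n" for n
  proof -
    have lm: "lin_mult l (monomial n) \<in> H2" by (rule lin_mult_H2[OF monomial_H2])
    have "Hb_inner b (A (lin_mult l (monomial n))) u = 0"
      using orth[OF A_Hb[OF monomial_H2[of n]]] by (simp add: resolvent_op_A monomial_H2)
    then have "Hb_inner b u (A (lin_mult l (monomial n))) = 0"
      using hb.ip_commute[OF A_Hb[OF lm] u] by simp
    then have "H2_inner u (cs l (monomial n) - monomial (Suc n)) = 0"
      using Hb_inner_A[OF u lm] by (simp add: lin_mult_def monomial_Suc)
    \<comment> \<open>Pairing with (l - z) z^n compares neighbouring coefficients; the conjugate of
      \<open>l\<close> comes from the second argument.\<close>
    then show ?thesis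
      using uH by (simp add: H2.ip_diff_right H2_cs monomial_H2 H2.ip_cs_right H2_inner_monomial)
  qed
  have "cmod (tc u n) = cmod (tc u 0)" for n
    by (induction n) (use l in \<open>auto simp: rec norm_mult\<close>)
  then have eq: "(\<lambda>n. (cmod (tc u n))\<^sup>2) = (\<lambda>n. (cmod (tc u 0))\<^sup>2)" by (metis (no_types))
  have "(\<lambda>n. (cmod (tc u n))\<^sup>2) \<longlonglongrightarrow> 0" by (rule summable_LIMSEQ_zero[OF H2_summable[OF uH]])
  then have "(\<lambda>n::nat. (cmod (tc u 0))\<^sup>2) \<longlonglongrightarrow> 0" by (simp only: eq)
  then have z: "tc u 0 = 0" by (simp add: LIMSEQ_const_iff)
  have "tc u n = tc 0 n" for n
  proof -
    have "tc u n = 0" by (induction n) (simp_all add: z rec)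
    then show ?thesis using tc_cs[OF H2_zero, of 0 n] by (simp add: cs_zero)
  qed
  then show ?thesis by (intro H2_eqI uH H2_zero)
qed

text \<open>The estimate for polynomials passes to all vectors by density and continuity.
  \<open>D\<close> is raised to at least 1 so that its root may be divided by.\<close>

lemma resolvent_if_kernel_bounded:
  assumes kb: "kernel_bounded_at l" and l: "cmod l = 1"
  shows "l \<in> resolvent_set (Hb b) (Hb_inner b) (X_adj b)"
proof -
  obtain D0 where D0: "\<And>h. h \<in> polys \<Longrightarrow> (hb.nrm (A h))\<^sup>2 \<le> D0 * (hb.nrm (A (lin_mult l h)))\<^sup>2"
    using resolvent_lower_bound_polys[OF kb l] by blast
  define D where "D = max 1 D0"
  have D: "D \<ge> 1" by (simp add: D_def)
  have below: "1 / sqrt D * hb.nrm f \<le> hb.nrm (resolvent_op l f)" if f: "f \<in> Hb b" for f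
  proof -
    obtain s where s: "hb.tends (\<lambda>n. A (s n)) f" "\<And>n. s n \<in> polys" using polys_dense[OF f] by blast
    have "hb.tends (\<lambda>n. resolvent_op l (A (s n))) (resolvent_op l f)"
      by (rule hb.tends_bounded_op[OF linop_resolvent_op resolvent_op_le s(1)])
    then have lim: "(\<lambda>n. sqrt D * hb.nrm (resolvent_op l (A (s n)))) \<longlonglongrightarrow> sqrt D * hb.nrm (resolvent_op l f)"
      by (intro tendsto_intros hb.tends_nrm)
    have "hb.nrm (A (s n)) \<le> sqrt D * hb.nrm (resolvent_op l (A (s n)))" for n
    proof (rule power2_le_imp_le)
      have "(hb.nrm (A (s n)))\<^sup>2 \<le> D0 * (hb.nrm (A (lin_mult l (s n))))\<^sup>2" by (rule D0[OF s(2)])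
      also have "\<dots> \<le> D * (hb.nrm (A (lin_mult l (s n))))\<^sup>2" by (intro mult_right_mono) (auto simp: D_def)
      finally show "(hb.nrm (A (s n)))\<^sup>2 \<le> (sqrt D * hb.nrm (resolvent_op l (A (s n))))\<^sup>2"
        using D by (simp add: power_mult_distrib resolvent_op_A polys_H2[OF s(2)])
      show "0 \<le> sqrt D * hb.nrm (resolvent_op l (A (s n)))"
        using D hb.nrm_nonneg[OF A_Hb[OF lin_mult_H2[OF polys_H2[OF s(2)]]]] by (simp add: resolvent_op_A polys_H2[OF s(2)])
    qed
    then have "hb.nrm f \<le> sqrt D * hb.nrm (resolvent_op l f)"
      using LIMSEQ_le[OF hb.tends_nrm[OF s(1)] lim] by blast
    then show ?thesis using D by (simp add: field_simps)
  qed
  have "\<exists>B. bounded_op (Hb b) (Hb_inner b) B \<and> (\<forall>f\<in>Hb b. B (resolvent_op l f) = f) \<and> (\<forall>f\<in>Hb b. resolvent_op l (B f) = f)"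
  proof (rule hb.invertible_if_bounded_below[OF linop_resolvent_op resolvent_op_le _ below])
    show "0 < 1 / sqrt D" using D by simp
    show "u = 0" if "u \<in> Hb b" "\<And>f. f \<in> Hb b \<Longrightarrow> Hb_inner b (resolvent_op l f) u = 0" for u
      by (rule resolvent_dense[OF l that])
  qed
  moreover have "resolvent_op l f = (\<lambda>z. l * f z - X_adj b f z)" for f
    by (simp add: resolvent_op_def fun_eq_iff cs_apply)
  ultimately show ?thesis unfolding resolvent_set_def by simp
qed

section \<open>Invertibility implies analytic continuation\<close>

text \<open>With \<open>\<mu> = 1 / cnj w\<close> and \<open>B = (l - X\<^sup>*)\<^sup>-\<^sup>1\<close> one has \<open>kb w = \<mu> B (kb 0) + (l - \<mu>) B (kb w)\<close>, so that
  \<open>f w = Hb_inner b f (kb w)\<close> has a power series expansion in \<open>cnj l - 1 / w\<close>.\<close>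

lemma local_continuation:
  assumes l: "cmod l = 1" and res: "l \<in> resolvent_set (Hb b) (Hb_inner b) (X_adj b)" and f: "f \<in> Hb b"
  shows "\<exists>\<rho>>0. \<exists>g. g holomorphic_on ball l \<rho> \<and> (\<forall>z\<in>ball l \<rho> \<inter> ball 0 1. g z = f z)"
proof -
  obtain B where B: "bounded_op (Hb b) (Hb_inner b) B" and BX: "\<And>g. g \<in> Hb b \<Longrightarrow> B (\<lambda>z. l * g z - X_adj b g z) = g"
    using res by (auto simp: resolvent_set_def)
  have linB: "hb.linop B" using B by (simp add: hb.bounded_op_iff)
  have Bin: "\<And>g. g \<in> Hb b \<Longrightarrow> B g \<in> Hb b" and Badd: "\<And>g h. g \<in> Hb b \<Longrightarrow> h \<in> Hb b \<Longrightarrow> B (g + h) = B g + B h"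
    and Bcs: "\<And>c g. g \<in> Hb b \<Longrightarrow> B (cs c g) = cs c (B g)" using linB by (auto simp: hb.linop_def)
  obtain C1 where C1: "\<And>g. g \<in> Hb b \<Longrightarrow> hb.nrm (B g) \<le> C1 * hb.nrm g"
    using B by (auto simp: hb.bounded_op_iff)
  define C where "C = max 1 C1"
  have C: "C \<ge> 1" "C1 \<le> C" unfolding C_def by auto
  have CB: "hb.nrm (B g) \<le> C * hb.nrm g" if "g \<in> Hb b" for g
    using C1[OF that] mult_right_mono[OF C(2) hb.nrm_nonneg[OF that]] by linarith
  have Bpow: "(B ^^ n) g \<in> Hb b" "hb.nrm ((B ^^ n) g) \<le> C ^ n * hb.nrm g" if g: "g \<in> Hb b" for g n
  proof -
    show in': "(B ^^ n) g \<in> Hb b" for n by (induction n) (simp_all add: g Bin)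
    show "hb.nrm ((B ^^ n) g) \<le> C ^ n * hb.nrm g"
    proof (induction n)
      case (Suc n)
      have "hb.nrm (B ((B ^^ n) g)) \<le> C * hb.nrm ((B ^^ n) g)" by (rule CB[OF in'])
      also have "\<dots> \<le> C * (C ^ n * hb.nrm g)" using Suc C by (intro mult_left_mono) auto
      finally show ?case by (simp add: mult.assoc)
    qed simp
  qed
  have Bpow_lin: "(B ^^ n) (cs c g + cs d h) = cs c ((B ^^ n) g) + cs d ((B ^^ n) h)" if "g \<in> Hb b" "h \<in> Hb b" for c d g h n
  proof (induction n)
    case (Suc n)
    show ?case
      unfolding funpow.simps o_apply Suc.IH by (simp only: Badd Bcs hb.V_cs Bpow that)
  qed simp
  have k0: "kb 0 \<in> Hb b" by (rule kb_Hb) simp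
  \<comment> \<open>Coefficients of the expansion; they grow at most like C^n, so the series
    converges for |x| < 1/C.\<close>
  define c where "c n = Hb_inner b f ((B ^^ Suc n) (kb 0))" for n
  define K where "K = hb.nrm f * hb.nrm (kb 0) * C"
  have cle: "cmod (c n) \<le> K * C ^ n" for n
  proof -
    have "cmod (c n) \<le> hb.nrm f * hb.nrm ((B ^^ Suc n) (kb 0))"
      unfolding c_def by (rule hb.Cauchy_Schwarz[OF f Bpow(1)[OF k0]])
    also have "\<dots> \<le> hb.nrm f * (C ^ Suc n * hb.nrm (kb 0))"
      by (rule mult_left_mono[OF Bpow(2)[OF k0] hb.nrm_nonneg[OF f]])
    finally show ?thesis by (simp add: K_def mult_ac)
  qed
  define G where "G x = (\<Sum>n. c n * x ^ n)" for x
  have Gs: "(\<lambda>n. c n * (x - 0) ^ n) sums G x" if x: "x \<in> ball 0 (1 / C)" for x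
  proof -
    have "C * cmod x < 1" using x C by (simp add: field_simps)
    then have "summable (\<lambda>n. K * (C * cmod x) ^ n)" using C by (intro summable_mult summable_geometric) simp
    then have "summable (\<lambda>n. c n * x ^ n)"
    proof (rule summable_comparison_test_ev[rotated], intro always_eventually allI)
      fix n
      have "norm (c n * x ^ n) \<le> (K * C ^ n) * cmod x ^ n"
        unfolding norm_mult norm_power by (intro mult_right_mono cle) simp
      then show "norm (c n * x ^ n) \<le> K * (C * cmod x) ^ n" by (simp add: power_mult_distrib mult_ac)
    qed
    then show ?thesis by (simp add: G_def summable_sums)
  qed
  have Ghol: "G holomorphic_on ball 0 (1 / C)" by (rule power_series_holomorphic) (rule Gs)
  \<comment> \<open>On this ball |z| > 1/2, hence |cnj l - 1/z| = |z - l| / |z| < 2 \<rho> =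
    1/C.\<close>
  define \<rho> where "\<rho> = 1 / (2 * C)"
  have \<rho>: "\<rho> > 0" "\<rho> \<le> 1 / 2" using C by (auto simp: \<rho>_def field_simps)
  have geo: "z \<noteq> 0" "cnj l - 1 / z \<in> ball 0 (1 / C)" if z: "z \<in> ball l \<rho>" for z
  proof -
    have d: "cmod (z - l) < \<rho>" using z by (simp add: dist_norm norm_minus_commute)
    have zn: "cmod z > 1 / 2" using norm_triangle_ineq2[of l "l - z"] d \<rho> l by (simp add: norm_minus_commute)
    then show z0: "z \<noteq> 0" by auto
    have ll: "cnj l * l = 1" using complex_norm_square[of l] l by (simp add: mult.commute)
    have "cnj l - 1 / z = cnj l * (z - l) / z" using z0 ll by (simp add: field_simps)
    then have "cmod (cnj l - 1 / z) = cmod (z - l) / cmod z" using l by (simp add: norm_divide norm_mult)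
    also have "\<dots> < \<rho> / (1/2)" using d zn \<rho> by (intro frac_less) auto
    finally show "cnj l - 1 / z \<in> ball 0 (1 / C)" by (simp add: \<rho>_def)
  qed
  define g where "g z = (1 / z) * G (cnj l - 1 / z)" for z
  have "(\<lambda>z. cnj l - 1 / z) holomorphic_on ball l \<rho>" using geo(1) by (intro holomorphic_intros) blast
  then have "(G \<circ> (\<lambda>z. cnj l - 1 / z)) holomorphic_on ball l \<rho>"
    by (rule holomorphic_on_compose_gen[OF _ Ghol]) (use geo(2) in blast)
  then have ghol: "g holomorphic_on ball l \<rho>"
    unfolding g_def using geo(1) by (intro holomorphic_intros) (auto simp: o_def)
  have "g w = f w" if w: "w \<in> ball l \<rho>" "cmod w < 1" for w
  proof -
    define \<mu> where "\<mu> = 1 / cnj w"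
    have w0: "w \<noteq> 0" by (rule geo(1)[OF w(1)])
    define x where "x = kb w"
    have x: "x \<in> Hb b" unfolding x_def by (rule kb_Hb[OF w(2)])
    have Xx: "X_adj b x \<in> Hb b" by (rule X_adj_Hb[OF x])
    \<comment> \<open>By \<open>X_adj_kb\<close> the adjoint shift sends \<open>x\<close> to \<mu>
      (x - kb 0).\<close>
    have "(\<lambda>z. l * x z - X_adj b x z) = cs (l - \<mu>) x + cs \<mu> (kb 0)"
    proof
      fix z
      have "x z = cnj w * X_adj b x z + kb 0 z"
        using fun_cong[OF X_adj_kb[OF w(2)], of z] by (simp add: x_def cs_apply)
      then show "l * x z - X_adj b x z = (cs (l - \<mu>) x + cs \<mu> (kb 0)) z"
        using w0 by (simp add: \<mu>_def cs_apply field_simps)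
    qed
    then have xB: "x = B (cs (l - \<mu>) x + cs \<mu> (kb 0))" using BX[OF x] by simp
    define p where "p n = Hb_inner b f ((B ^^ n) x)" for n
    have rec: "p n = cnj \<mu> * c n + cnj (l - \<mu>) * p (Suc n)" for n
    proof -
      have "(B ^^ n) x = (B ^^ n) (B (cs (l - \<mu>) x + cs \<mu> (kb 0)))" using xB by simp
      also have "\<dots> = (B ^^ Suc n) (cs (l - \<mu>) x + cs \<mu> (kb 0))" by (simp add: funpow_swap1)
      also have "\<dots> = cs (l - \<mu>) ((B ^^ Suc n) x) + cs \<mu> ((B ^^ Suc n) (kb 0))" by (rule Bpow_lin[OF x k0])
      finally have "p n = Hb_inner b f (cs (l - \<mu>) ((B ^^ Suc n) x) + cs \<mu> ((B ^^ Suc n) (kb 0)))"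
        unfolding p_def by (rule arg_cong)
      then show ?thesis
        unfolding p_def c_def hb.ip_add_right[OF hb.V_cs[OF Bpow(1)[OF x]] hb.V_cs[OF Bpow(1)[OF k0]] f]
          hb.ip_cs_right[OF Bpow(1)[OF x] f] hb.ip_cs_right[OF Bpow(1)[OF k0] f] by simp
    qed
    let ?y = "cnj l - 1 / w"
    have cm: "cnj \<mu> = 1 / w" "cnj (l - \<mu>) = ?y" by (simp_all add: \<mu>_def)
    have y: "C * cmod ?y < 1" using geo(2)[OF w(1)] C by (simp add: field_simps)
    \<comment> \<open>Iterating x = (l - \<mu>) B x + \<mu> B (kb 0) leaves a remainder of order (C
      |?y|)^N.\<close>
    have part: "f w = (\<Sum>n<N. (1 / w) * (c n * ?y ^ n)) + ?y ^ N * p N" for N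
    proof (induction N)
      case 0
      show ?case using Hb_inner_kb[OF f w(2)] by (simp add: p_def x_def)
    next
      case (Suc N)
      have "?y ^ N * p N = (1 / w) * (c N * ?y ^ N) + ?y ^ Suc N * p (Suc N)"
        unfolding rec[of N] cm by (simp add: algebra_simps)
      then show ?case using Suc by simp
    qed
    have "(\<lambda>N. ?y ^ N * p N) \<longlonglongrightarrow> 0"
    proof (rule Lim_null_comparison)
      show "\<forall>\<^sub>F N in sequentially. norm (?y ^ N * p N) \<le> hb.nrm f * hb.nrm x * (C * cmod ?y) ^ N"
      proof (intro always_eventually allI)
        fix N
        have "cmod (p N) \<le> hb.nrm f * hb.nrm ((B ^^ N) x)"
          unfolding p_def by (rule hb.Cauchy_Schwarz[OF f Bpow(1)[OF x]])
        also have "\<dots> \<le> hb.nrm f * (C ^ N * hb.nrm x)"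
          by (rule mult_left_mono[OF Bpow(2)[OF x] hb.nrm_nonneg[OF f]])
        finally have "cmod ?y ^ N * cmod (p N) \<le> cmod ?y ^ N * (hb.nrm f * (C ^ N * hb.nrm x))"
          by (intro mult_left_mono) auto
        then show "norm (?y ^ N * p N) \<le> hb.nrm f * hb.nrm x * (C * cmod ?y) ^ N"
          by (simp add: norm_mult norm_power power_mult_distrib mult_ac)
      qed
      show "(\<lambda>N. hb.nrm f * hb.nrm x * (C * cmod ?y) ^ N) \<longlonglongrightarrow> 0"
        using y C by (intro tendsto_mult_right_zero LIMSEQ_power_zero) simp
    qed
    then have "(\<lambda>N. f w - ?y ^ N * p N) \<longlonglongrightarrow> f w - 0" by (intro tendsto_intros)
    moreover have "(\<lambda>N. f w - ?y ^ N * p N) = (\<lambda>N. \<Sum>n<N. (1 / w) * (c n * ?y ^ n))"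
      using part by (auto simp: fun_eq_iff algebra_simps)
    ultimately have "(\<lambda>n. (1 / w) * (c n * ?y ^ n)) sums f w" by (simp add: sums_def)
    moreover have "(\<lambda>n. (1 / w) * (c n * ?y ^ n)) sums g w"
      unfolding g_def using Gs[OF geo(2)[OF w(1)]] by (intro sums_mult) simp
    ultimately show ?thesis by (rule sums_unique2[symmetric])
  qed
  then show ?thesis using ghol \<rho>(1) by (intro exI[of _ \<rho>] conjI exI[of _ g]) auto
qed

section \<open>Continuous extensions\<close>

text \<open>Otherwise kernels blow up along some sequence tending to \<open>l\<close>, although the
  values of each \<open>f\<close> along it converge and so stay bounded.\<close>

lemma kernel_bounded_if_continuous:
  assumes ext: "\<And>f. f \<in> Hb b \<Longrightarrow> \<exists>G. continuous_extension_to f I G" and l: "l \<in> I" and l1: "cmod l = 1"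
  shows "kernel_bounded_at l"
proof (rule ccontr)
  assume "\<not> kernel_bounded_at l"
  then have "\<exists>w. cmod w < 1 \<and> cmod (w - l) < 1 / real (Suc n) \<and> \<not> (1 - (cmod (b w))\<^sup>2 \<le> real n * (1 - (cmod w)\<^sup>2))" for n
    unfolding kernel_bounded_at_def by (metis of_nat_0_less_iff zero_less_Suc zero_less_divide_1_iff)
  then have "\<exists>w. \<forall>n. cmod (w n) < 1 \<and> cmod (w n - l) < 1 / real (Suc n) \<and> \<not> (1 - (cmod (b (w n)))\<^sup>2 \<le> real n * (1 - (cmod (w n))\<^sup>2))"
    by (intro choice allI)
  then obtain w where w1: "\<And>n. cmod (w n) < 1" and wl: "\<And>n. cmod (w n - l) < 1 / real (Suc n)"
    and big: "\<And>n. real n * (1 - (cmod (w n))\<^sup>2) < 1 - (cmod (b (w n)))\<^sup>2"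
    by (auto simp: not_le)
  have "(\<lambda>n. w n - l) \<longlonglongrightarrow> 0"
    by (rule Lim_null_comparison[OF _ LIMSEQ_Suc[OF lim_1_over_n[where 'a = real]]])
      (use wl in \<open>auto intro!: always_eventually less_imp_le simp del: of_nat_Suc\<close>)
  then have wlim: "w \<longlonglongrightarrow> l" by (simp add: Lim_null[symmetric])
  have "\<exists>C. \<forall>n. hb.nrm (kb (w n)) \<le> C"
  proof (rule hb.uniform_boundedness)
    show "kb (w n) \<in> Hb b" for n by (rule kb_Hb[OF w1])
    fix f assume f: "f \<in> Hb b"
    obtain G where G: "continuous_on (ball 0 1 \<union> I) G" "\<And>z. z \<in> ball 0 1 \<Longrightarrow> G z = f z"
      using ext[OF f] by (auto simp: continuous_extension_to_def)
    have "(\<lambda>n. G (w n)) \<longlonglongrightarrow> G l"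
      by (rule continuous_on_tendsto_compose[OF G(1) wlim]) (use l w1 in auto)
    then have "(\<lambda>n. f (w n)) \<longlonglongrightarrow> G l" using G(2) w1 by simp
    then have "Bseq (\<lambda>n. f (w n))" by (rule convergent_imp_Bseq[OF convergentI])
    then show "\<exists>M. \<forall>n. cmod (Hb_inner b f (kb (w n))) \<le> M"
      using Hb_inner_kb[OF f w1] by (auto simp: Bseq_def)
  qed
  then obtain C where C: "\<And>n. hb.nrm (kb (w n)) \<le> C" by blast
  obtain n where n: "C\<^sup>2 < real n" using reals_Archimedean2 by blast
  have pos: "0 < 1 - (cmod (w n))\<^sup>2" using w1[of n] by (simp add: power_less_one_iff)
  have "real n < (1 - (cmod (b (w n)))\<^sup>2) / (1 - (cmod (w n))\<^sup>2)" using big[of n] pos by (simp add: field_simps)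
  also have "\<dots> = (hb.nrm (kb (w n)))\<^sup>2" using kb_nrm_sq[OF w1] by simp
  also have "\<dots> \<le> C\<^sup>2" by (intro power_mono C hb.nrm_nonneg kb_Hb w1)
  finally show False using n by simp
qed

lemma continuous_symbol:
  assumes ext: "\<And>f. f \<in> Hb b \<Longrightarrow> \<exists>G. continuous_extension_to f I G"
    and I: "I \<noteq> {}" "\<And>l. l \<in> I \<Longrightarrow> cmod l = 1"
  shows "\<exists>F. continuous_extension_to b I F \<and> (\<forall>\<zeta>\<in>I. cmod (F \<zeta>) = 1)"
proof -
  have kb: "kernel_bounded_at l" if "l \<in> I" for l
    by (rule kernel_bounded_if_continuous[OF ext that I(2)[OF that]])
  obtain l where l: "l \<in> I" using I(1) by blast
  have "\<forall>\<^sub>F n in sequentially. 0 < cmod (b (of_real (rad n) * l))"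
    by (rule order_tendstoD(1)[OF modulus_tendsto_1[OF kb[OF l] I(2)[OF l]]]) simp
  \<comment> \<open>A point where \<open>b\<close> does not vanish exists because |b| tends to 1
    along the radius to \<open>l\<close>.\<close>
  then obtain n where n: "b (of_real (rad n) * l) \<noteq> 0" by (auto simp: eventually_sequentially)
  define v where "v = of_real (rad n) * l"
  have v: "cmod v < 1" "b v \<noteq> 0" using n rad_mult_close(1)[OF I(2)[OF l]] by (auto simp: v_def)
  obtain G where G: "continuous_on (ball 0 1 \<union> I) G" "\<And>z. z \<in> ball 0 1 \<Longrightarrow> G z = kb v z"
    using ext[OF kb_Hb[OF v(1)]] by (auto simp: continuous_extension_to_def)
  \<comment> \<open>Solves kb v z = (1 - cnj (b v) b z) / (1 - cnj v z) for b z.\<close>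
  define F where "F z = (1 - (1 - cnj v * z) * G z) / cnj (b v)" for z
  have F: "continuous_on (ball 0 1 \<union> I) F" unfolding F_def using v(2) by (intro continuous_intros G(1)) simp
  have Fb: "F z = b z" if z: "z \<in> ball 0 1" for z
  proof -
    have "1 - cnj v * z \<noteq> 0" using one_minus_ne[of v z] v(1) z by simp
    then have "(1 - cnj v * z) * G z = 1 - cnj (b v) * b z"
      using z G(2)[OF z] kb_eq[OF v(1)] by (simp add: szego_def)
    then show ?thesis using v(2) by (simp add: F_def)
  qed
  have "cmod (F \<zeta>) = 1" if \<zeta>: "\<zeta> \<in> I" for \<zeta>
  proof -
    have "(\<lambda>n. of_real (rad n) * \<zeta>) \<longlonglongrightarrow> of_real 1 * \<zeta>" by (intro tendsto_intros rad_tendsto)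
    then have "(\<lambda>n. of_real (rad n) * \<zeta>) \<longlonglongrightarrow> \<zeta>" by simp
    then have "(\<lambda>n. F (of_real (rad n) * \<zeta>)) \<longlonglongrightarrow> F \<zeta>"
      by (rule continuous_on_tendsto_compose[OF F]) (use \<zeta> rad_mult_close(1)[OF I(2)[OF \<zeta>]] in auto)
    then have "(\<lambda>n. cmod (F (of_real (rad n) * \<zeta>))) \<longlonglongrightarrow> cmod (F \<zeta>)" by (rule tendsto_norm)
    moreover have "(\<lambda>n. cmod (F (of_real (rad n) * \<zeta>))) = (\<lambda>n. cmod (b (of_real (rad n) * \<zeta>)))"
      using Fb rad_mult_close(1)[OF I(2)[OF \<zeta>]] by simp
    ultimately show ?thesis using modulus_tendsto_1[OF kb[OF \<zeta>] I(2)[OF \<zeta>]] LIMSEQ_unique by simp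
  qed
  then show ?thesis using F Fb by (auto simp: continuous_extension_to_def)
qed

end

section \<open>Geometry of arcs, gluing and Schwarz reflection\<close>

section \<open>Continuation across arcs\<close>

lemma open_arcD:
  assumes "open_arc I" "l \<in> I"
  shows "cmod l = 1" and "\<exists>\<delta>>0. \<forall>t. \<bar>t\<bar> < \<delta> \<longrightarrow> l * cis t \<in> I"
proof -
  obtain \<alpha> \<beta> where I: "I = cis ` {\<alpha><..<\<beta>}" using assms by (auto simp: open_arc_def)
  then obtain t0 where t0: "\<alpha> < t0" "t0 < \<beta>" "l = cis t0" using assms(2) by auto
  show "cmod l = 1" using t0 by simp
  have "l * cis t \<in> I" if "\<bar>t\<bar> < min (t0 - \<alpha>) (\<beta> - t0)" for t
    unfolding I t0(3) cis_mult using that by (intro imageI) auto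
  then show "\<exists>\<delta>>0. \<forall>t. \<bar>t\<bar> < \<delta> \<longrightarrow> l * cis t \<in> I"
    using t0 by (intro exI[of _ "min (t0 - \<alpha>) (\<beta> - t0)"]) auto
qed

lemma Ln_near_1:
  assumes "\<delta> > 0"
  shows "\<exists>\<rho>>0. \<rho> \<le> 1 \<and> (\<forall>z. cmod (z - 1) < \<rho> \<longrightarrow> cmod (Ln z) < \<delta>)"
proof -
  have "isCont Ln 1" by (intro continuous_at_Ln) auto
  then obtain d where d: "d > 0" "\<And>z. dist z 1 < d \<Longrightarrow> dist (Ln z) (Ln 1) < \<delta>"
    using assms unfolding continuous_at_eps_delta by blast
  show ?thesis
    by (rule exI[of _ "min d 1"]) (use d in \<open>auto simp: dist_norm\<close>)
qed

text \<open>A unimodular quotient \<zeta> / l close to 1 is \<open>cis\<close> of the small angle Im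
  (Ln (\<zeta> / l)).\<close>

lemma open_arc_near:
  assumes "open_arc I" "l \<in> I"
  shows "\<exists>\<epsilon>>0. \<forall>\<zeta>. cmod \<zeta> = 1 \<and> cmod (\<zeta> - l) < \<epsilon> \<longrightarrow> \<zeta> \<in> I"
proof -
  have l: "cmod l = 1" by (rule open_arcD(1)[OF assms])
  obtain \<delta> where \<delta>: "\<delta> > 0" "\<And>t. \<bar>t\<bar> < \<delta> \<Longrightarrow> l * cis t \<in> I" using open_arcD(2)[OF assms] by blast
  obtain \<rho> where \<rho>: "\<rho> > 0" "\<rho> \<le> 1" "\<And>z. cmod (z - 1) < \<rho> \<Longrightarrow> cmod (Ln z) < \<delta>" using Ln_near_1[OF \<delta>(1)] by blast
  have "\<zeta> \<in> I" if \<zeta>: "cmod \<zeta> = 1" "cmod (\<zeta> - l) < \<rho>" for \<zeta>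
  proof -
    have l0: "l \<noteq> 0" using l by auto
    have "\<zeta> / l - 1 = (\<zeta> - l) / l" using l0 by (simp add: field_simps)
    then have "cmod (\<zeta> / l - 1) < \<rho>" using \<zeta> l by (simp add: norm_divide)
    then have "cmod (Ln (\<zeta> / l)) < \<delta>" by (rule \<rho>(3))
    then have "\<bar>Im (Ln (\<zeta> / l))\<bar> < \<delta>" using abs_Im_le_cmod[of "Ln (\<zeta> / l)"] by linarith
    then have "l * cis (Im (Ln (\<zeta> / l))) \<in> I" by (rule \<delta>(2))
    moreover have "cis (Im (Ln (\<zeta> / l))) = \<zeta> / l"
    proof -
      have z0: "\<zeta> / l \<noteq> 0" using \<zeta> l by auto
      have "Re (Ln (\<zeta> / l)) = 0" using z0 \<zeta> l by (simp add: norm_divide)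
      then have "exp (Ln (\<zeta> / l)) = cis (Im (Ln (\<zeta> / l)))" by (simp add: exp_eq_polar)
      then show ?thesis using z0 by simp
    qed
    ultimately show ?thesis using l0 by simp
  qed
  then show ?thesis using \<rho>(1) by blast
qed

text \<open>A common point outside the unit disc is reflected in the circle.\<close>

lemma balls_meet_in_disc:
  assumes l: "cmod l = 1" "cmod l' = 1" and z: "z \<in> ball l \<rho> \<inter> ball l' \<rho>'"
  shows "ball l \<rho> \<inter> ball l' \<rho>' \<inter> ball 0 1 \<noteq> {}"
proof -
  define S where "S = ball l \<rho> \<inter> ball l' \<rho>'"
  have S: "open S" by (auto simp: S_def)
  have "\<exists>w\<in>S. cmod w \<le> 1"
  proof (cases "cmod z \<le> 1")
    case True
    then show ?thesis using z by (auto simp: S_def)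
  next
    case False
    then have z0: "z \<noteq> 0" by auto
    \<comment> \<open>Reflection divides the distance to any point of the circle by |z| > 1, so the
      image stays in both balls.\<close>
    have inv: "cmod (1 / cnj z - m) \<le> cmod (z - m)" if m: "cmod m = 1" for m
    proof -
      have mm: "m * cnj m = 1" using complex_norm_square[of m] m by simp
      have "1 / cnj z - m = m * cnj (m - z) / cnj z" using z0 mm by (simp add: field_simps)
      then have "cmod (1 / cnj z - m) = cmod (m - z) / cmod z" using m by (simp only: norm_divide norm_mult complex_mod_cnj mult_1)
      also have "\<dots> \<le> cmod (m - z)" using False by (simp add: divide_le_eq mult_left_le_one_le mult_le_cancel_left1)
      finally show ?thesis by (simp add: norm_minus_commute)
    qed
    have "1 / cnj z \<in> S"
      using z inv[OF l(1)] inv[OF l(2)] by (auto simp: S_def dist_norm norm_minus_commute intro: le_less_trans)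
    moreover have "cmod (1 / cnj z) \<le> 1" using False by (simp add: norm_divide divide_le_eq)
    ultimately show ?thesis by blast
  qed
  then obtain w where w: "w \<in> S" "cmod w \<le> 1" by blast
  \<comment> \<open>\<open>w\<close> may lie on the circle; a slight radial contraction moves it
    into the open disc without leaving the open set \<open>S\<close>.\<close>
  have "(\<lambda>n. of_real (rad n) * w) \<longlonglongrightarrow> of_real 1 * w" by (intro tendsto_intros rad_tendsto)
  then have "\<forall>\<^sub>F n in sequentially. of_real (rad n) * w \<in> S" using S w by (intro topological_tendstoD) auto
  then obtain n where n: "of_real (rad n) * w \<in> S" by (auto simp: eventually_sequentially)
  have "cmod (of_real (rad n) * w) = rad n * cmod w" using rad[of n] by (simp add: norm_mult)
  also have "\<dots> \<le> rad n * 1" using w(2) rad[of n] by (intro mult_left_mono) auto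
  also have "\<dots> < 1" using rad[of n] by simp
  finally have "cmod (of_real (rad n) * w) < 1" .
  then show ?thesis using n unfolding S_def by auto
qed

text \<open>Local extensions agree on overlaps by the identity theorem: an overlap of two balls is
  convex, hence connected, and if nonempty it meets the disc, where both equal
  \<open>f\<close>.\<close>

lemma glue_continuations:
  assumes f: "f holomorphic_on ball 0 1" and I: "\<And>l. l \<in> I \<Longrightarrow> cmod l = 1"
    and loc: "\<And>l. l \<in> I \<Longrightarrow> \<exists>\<rho>>0. \<exists>g. g holomorphic_on ball l \<rho> \<and> (\<forall>z\<in>ball l \<rho> \<inter> ball 0 1. g z = f z)"
  shows "\<exists>F. analytic_continuation_across f I F"
proof -
  have "\<forall>l. \<exists>p. l \<in> I \<longrightarrow> fst p > 0 \<and> snd p holomorphic_on ball l (fst p) \<and> (\<forall>z\<in>ball l (fst p) \<inter> ball 0 1. snd p z = f z)"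
    using loc by force
  then have "\<exists>p. \<forall>l. l \<in> I \<longrightarrow> fst (p l) > 0 \<and> snd (p l) holomorphic_on ball l (fst (p l)) \<and> (\<forall>z\<in>ball l (fst (p l)) \<inter> ball 0 1. snd (p l) z = f z)"
    by (rule choice)
  then obtain p where p: "\<And>l. l \<in> I \<Longrightarrow> fst (p l) > 0" "\<And>l. l \<in> I \<Longrightarrow> snd (p l) holomorphic_on ball l (fst (p l))"
    "\<And>l z. l \<in> I \<Longrightarrow> z \<in> ball l (fst (p l)) \<Longrightarrow> z \<in> ball 0 1 \<Longrightarrow> snd (p l) z = f z"
    by blast
  define B where "B l = ball l (fst (p l))" for l
  define g where "g l = snd (p l)" for l
  have consistent: "g l z = g l' z" if ll: "l \<in> I" "l' \<in> I" and z: "z \<in> B l \<inter> B l'" for l l' z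
  proof (rule analytic_continuation_open[of "B l \<inter> B l' \<inter> ball 0 1" "B l \<inter> B l'" "g l" "g l'" z])
    show "B l \<inter> B l' \<inter> ball 0 1 \<noteq> {}"
      unfolding B_def by (rule balls_meet_in_disc[OF I[OF ll(1)] I[OF ll(2)]]) (use z in \<open>auto simp: B_def\<close>)
    show "connected (B l \<inter> B l')" unfolding B_def by (intro convex_connected convex_Int convex_ball)
    show "g l holomorphic_on B l \<inter> B l'" "g l' holomorphic_on B l \<inter> B l'"
      unfolding g_def B_def using p(2)[OF ll(1)] p(2)[OF ll(2)] by (auto elim: holomorphic_on_subset)
    show "g l w = g l' w" if "w \<in> B l \<inter> B l' \<inter> ball 0 1" for w
      using that p(3)[OF ll(1), of w] p(3)[OF ll(2), of w] by (auto simp: g_def B_def)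
  qed (use z in \<open>auto simp: B_def\<close>)
  define F where "F z = (if z \<in> ball 0 1 then f z else g (SOME l. l \<in> I \<and> z \<in> B l) z)" for z
  have FB: "F z = g l z" if l: "l \<in> I" and z: "z \<in> B l" for l z
  proof (cases "z \<in> ball 0 1")
    case True
    then show ?thesis using p(3)[OF l, of z] z by (simp add: F_def g_def B_def)
  next
    case False
    have "(SOME l. l \<in> I \<and> z \<in> B l) \<in> I \<and> z \<in> B (SOME l. l \<in> I \<and> z \<in> B l)"
      by (rule someI[of _ l]) (use l z in blast)
    then show ?thesis using consistent[OF _ l, of "SOME l. l \<in> I \<and> z \<in> B l" z] z False by (simp add: F_def)
  qed
  have "F holomorphic_on ball 0 1 \<union> (\<Union>l\<in>I. B l)"
  proof (rule holomorphic_on_Un)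
    show "F holomorphic_on ball 0 1" by (rule holomorphic_transform[OF f]) (simp add: F_def)
    show "F holomorphic_on (\<Union>l\<in>I. B l)"
    proof (rule holomorphic_on_UN_open)
      fix l assume l: "l \<in> I"
      show "F holomorphic_on B l"
        by (rule holomorphic_transform[of "g l"]) (use p(2)[OF l] FB[OF l] in \<open>auto simp: g_def B_def\<close>)
    qed (auto simp: B_def)
  qed (auto simp: B_def)
  moreover have "I \<subseteq> (\<Union>l\<in>I. B l)" using p(1) by (auto simp: B_def)
  moreover have "open (\<Union>l\<in>I. B l)" by (auto simp: B_def)
  ultimately have "analytic_continuation_across f I F"
    unfolding analytic_continuation_across_def F_def by auto
  then show ?thesis by blast
qed

lemma schwarz_reflection_local:
  assumes b: "b holomorphic_on ball 0 1" and I: "open_arc I" "l \<in> I"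
    and F: "continuous_extension_to b I F" and F1: "\<And>\<zeta>. \<zeta> \<in> I \<Longrightarrow> cmod (F \<zeta>) = 1"
  shows "\<exists>\<rho>>0. \<exists>g. g holomorphic_on ball l \<rho> \<and> (\<forall>z\<in>ball l \<rho> \<inter> ball 0 1. g z = b z)"
proof -
  have l: "cmod l = 1" by (rule open_arcD(1)[OF I])
  then have l0: "l \<noteq> 0" by auto
  obtain \<delta>0 where \<delta>0: "\<delta>0 > 0" "\<And>t. \<bar>t\<bar> < \<delta>0 \<Longrightarrow> l * cis t \<in> I" using open_arcD(2)[OF I] by blast
  have Fc: "continuous_on (ball 0 1 \<union> I) F" and Fb: "\<And>z. z \<in> ball 0 1 \<Longrightarrow> F z = b z"
    using F by (auto simp: continuous_extension_to_def)
  \<comment> \<open>This chart maps the upper half plane into the disc and a real interval around 0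
    into \<open>I\<close>, so reflection in the circle becomes reflection in the real line.\<close>
  define e where "e z = l * exp (\<i> * z)" for z
  have e_norm: "cmod (e z) = exp (- Im z)" for z using l by (simp add: e_def norm_mult)
  have e_upper: "e z \<in> ball 0 1" if "Im z > 0" for z using that by (simp add: e_norm)
  have e_real: "e z \<in> I" if "Im z = 0" "cmod z < \<delta>0" for z
  proof -
    have "exp (\<i> * z) = cis (Re z)" using that(1) by (simp add: exp_eq_polar)
    moreover have "\<bar>Re z\<bar> < \<delta>0" using abs_Re_le_cmod[of z] that(2) by linarith
    ultimately show ?thesis using \<delta>0(2) by (simp add: e_def)
  qed
  define \<phi> where "\<phi> z = F (e z)" for z
  have \<phi>c: "continuous_on {z \<in> ball 0 \<delta>0. 0 \<le> Im z} \<phi>"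
    unfolding \<phi>_def
  proof (rule continuous_on_compose2[OF Fc])
    show "continuous_on {z \<in> ball 0 \<delta>0. 0 \<le> Im z} e" unfolding e_def by (intro continuous_intros)
    show "e ` {z \<in> ball 0 \<delta>0. 0 \<le> Im z} \<subseteq> ball 0 1 \<union> I"
    proof
      fix y assume "y \<in> e ` {z \<in> ball 0 \<delta>0. 0 \<le> Im z}"
      then obtain z where "cmod z < \<delta>0" "0 \<le> Im z" "y = e z" by auto
      then show "y \<in> ball 0 1 \<union> I" using e_upper[of z] e_real[of z] by (cases "Im z = 0") auto
    qed
  qed
  have \<phi>0: "cmod (\<phi> 0) = 1" using F1 I(2) by (simp add: \<phi>_def e_def)
  have "\<exists>d>0. \<forall>z\<in>{z \<in> ball 0 \<delta>0. 0 \<le> Im z}. dist z 0 < d \<longrightarrow> dist (\<phi> z) (\<phi> 0) < 1"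
    using \<phi>c[unfolded continuous_on_iff, rule_format, of 0 1] \<delta>0(1) by simp
  then obtain d where d: "d > 0" "\<And>z. cmod z < \<delta>0 \<Longrightarrow> 0 \<le> Im z \<Longrightarrow> cmod z < d \<Longrightarrow> dist (\<phi> z) (\<phi> 0) < 1"
    by auto
  \<comment> \<open>On the smaller half ball \<phi> stays within distance 1 of the unimodular value
    \<phi> 0, hence is nonzero and its reflection can be inverted.\<close>
  define \<delta> where "\<delta> = min \<delta>0 d"
  have \<delta>: "\<delta> > 0" "\<delta> \<le> \<delta>0" "\<delta> \<le> d" using d \<delta>0 by (auto simp: \<delta>_def)
  have \<phi>ne: "\<phi> z \<noteq> 0" if "cmod z < \<delta>" "0 \<le> Im z" for z
    using d(2)[of z] that \<delta> \<phi>0 by (auto simp: dist_norm)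
  define S where "S = ball (0 :: complex) \<delta>"
  define \<psi> where "\<psi> z = (if 0 \<le> Im z then \<phi> z else 1 / cnj (\<phi> (cnj z)))" for z
  have "\<psi> holomorphic_on S"
  \<comment> \<open>The line is the real axis with normal -i; the inner product of -i and z is - Im
    z, so the negative side is the upper half plane.\<close>
  proof (rule holomorphic_on_paste_across_line[of S "- \<i>" _ 0])
    show "open S" by (simp add: S_def)
    have up: "\<phi> holomorphic_on S \<inter> {z. 0 < Im z}"
    proof -
      have "(b \<circ> e) holomorphic_on S \<inter> {z. 0 < Im z}"
        by (rule holomorphic_on_compose_gen[OF _ b]) (use e_upper in \<open>auto simp: e_def[abs_def] intro!: holomorphic_intros\<close>)
      then show ?thesis by (rule holomorphic_transform) (use Fb e_upper in \<open>auto simp: \<phi>_def\<close>)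
    qed
    then have "\<psi> holomorphic_on S \<inter> {z. 0 < Im z}"
      by (rule holomorphic_transform) (auto simp: \<psi>_def)
    moreover have "S \<inter> {z. - \<i> \<bullet> z < 0} = S \<inter> {z. 0 < Im z}" by (auto simp: inner_complex_def)
    ultimately show "\<psi> holomorphic_on S \<inter> {z. - \<i> \<bullet> z < 0}" by simp
    have "cnj ` (S \<inter> {z. Im z < 0}) \<subseteq> S \<inter> {z. 0 < Im z}" by (auto simp: S_def)
    then have "\<phi> holomorphic_on cnj ` (S \<inter> {z. Im z < 0})" using up holomorphic_on_subset by blast
    moreover have "open (S \<inter> {z. Im z < 0})" by (auto simp: S_def intro!: open_Int open_halfspace_Im_lt)
    ultimately have "(cnj \<circ> \<phi> \<circ> cnj) holomorphic_on S \<inter> {z. Im z < 0}" by (rule holomorphic_on_compose_cnj_cnj)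
    then have "(\<lambda>z. 1 / (cnj \<circ> \<phi> \<circ> cnj) z) holomorphic_on S \<inter> {z. Im z < 0}"
      by (rule holomorphic_on_divide[OF holomorphic_on_const]) (use \<phi>ne in \<open>auto simp: S_def\<close>)
    then have "\<psi> holomorphic_on S \<inter> {z. Im z < 0}"
      by (rule holomorphic_transform) (auto simp: \<psi>_def)
    moreover have "S \<inter> {z. 0 < - \<i> \<bullet> z} = S \<inter> {z. Im z < 0}" by (auto simp: inner_complex_def)
    ultimately show "\<psi> holomorphic_on S \<inter> {z. 0 < - \<i> \<bullet> z}" by simp
    have sub: "{z \<in> S. 0 \<le> Im z} \<subseteq> {z \<in> ball 0 \<delta>0. 0 \<le> Im z}" using \<delta> by (auto simp: S_def)
    have c1: "continuous_on {z \<in> S. 0 \<le> Im z} \<phi>" by (rule continuous_on_subset[OF \<phi>c sub])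
    have c2: "continuous_on {z \<in> S. Im z \<le> 0} (\<lambda>z. 1 / cnj (\<phi> (cnj z)))"
    proof (intro continuous_intros ballI)
      show "continuous_on {z \<in> S. Im z \<le> 0} (\<lambda>z. \<phi> (cnj z))"
        by (rule continuous_on_compose2[OF c1]) (auto simp: S_def intro!: continuous_intros)
      show "cnj (\<phi> (cnj z)) \<noteq> 0" if "z \<in> {z \<in> S. Im z \<le> 0}" for z using that \<phi>ne[of "cnj z"] by (auto simp: S_def)
    qed
    have "continuous_on S (\<lambda>z. if Im z \<le> 0 then 1 / cnj (\<phi> (cnj z)) else \<phi> z)"
    proof (rule continuous_on_cases_le[OF c2 c1])
      fix z assume z: "z \<in> S" "Im z = 0"
      have "e z \<in> I" using z \<delta> by (intro e_real) (auto simp: S_def)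
      then have "cmod (\<phi> z) = 1" using F1 by (simp add: \<phi>_def)
      moreover have "cnj z = z" using z by (simp add: complex_eq_iff)
      ultimately show "1 / cnj (\<phi> (cnj z)) = \<phi> z"
        using complex_norm_square[of "\<phi> z"] by (auto intro!: eq_divide_imp[symmetric])
    qed (intro continuous_intros)
    then show "continuous_on S \<psi>"
    proof (rule continuous_on_eq)
      fix z assume z: "z \<in> S"
      show "(if Im z \<le> 0 then 1 / cnj (\<phi> (cnj z)) else \<phi> z) = \<psi> z"
      proof (cases "Im z = 0")
        case True
        have "e z \<in> I" using z True \<delta> by (intro e_real) (auto simp: S_def)
        then have "cmod (\<phi> z) = 1" using F1 by (simp add: \<phi>_def)
        moreover have "cnj z = z" using True by (simp add: complex_eq_iff)
        ultimately have "1 / cnj (\<phi> (cnj z)) = \<phi> z"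
          using complex_norm_square[of "\<phi> z"] by (auto intro!: eq_divide_imp[symmetric])
        then show ?thesis using True by (simp add: \<psi>_def)
      qed (auto simp: \<psi>_def)
    qed
  qed simp
  moreover obtain \<rho> where \<rho>: "\<rho> > 0" "\<rho> \<le> 1" "\<And>z. cmod (z - 1) < \<rho> \<Longrightarrow> cmod (Ln z) < \<delta>" using Ln_near_1[OF \<delta>(1)] by blast
  have near: "cmod (w / l - 1) < \<rho>" if "w \<in> ball l \<rho>" for w
  proof -
    have "w / l - 1 = (w - l) / l" using l0 by (simp add: field_simps)
    then show ?thesis using that l by (simp add: norm_divide dist_norm norm_minus_commute)
  qed
  have nonneg: "w / l \<notin> \<real>\<^sub>\<le>\<^sub>0" if "w \<in> ball l \<rho>" for w
  proof
    assume "w / l \<in> \<real>\<^sub>\<le>\<^sub>0"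
    then have "Re (w / l) \<le> 0" by (auto simp: complex_nonpos_Reals_iff)
    moreover have "\<bar>Re (w / l - 1)\<bar> < 1" using abs_Re_le_cmod[of "w / l - 1"] near[OF that] \<rho>(2) by linarith
    ultimately show False by simp
  qed
  \<comment> \<open>Undoes the chart; for |w/l - 1| < 1 the logarithm stays off its branch
    cut.\<close>
  define g where "g w = \<psi> (- \<i> * Ln (w / l))" for w
  have "(\<psi> \<circ> (\<lambda>w. - \<i> * Ln (w / l))) holomorphic_on ball l \<rho>"
  proof (rule holomorphic_on_compose_gen)
    show "\<psi> holomorphic_on S" by fact
    show "(\<lambda>w. - \<i> * Ln (w / l)) holomorphic_on ball l \<rho>"
      using nonneg l0 by (intro holomorphic_intros) auto
    show "(\<lambda>w. - \<i> * Ln (w / l)) ` ball l \<rho> \<subseteq> S" using \<rho>(3) near by (auto simp: S_def norm_mult)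
  qed
  then have "g holomorphic_on ball l \<rho>" by (simp add: g_def[abs_def] o_def)
  moreover have "g w = b w" if w: "w \<in> ball l \<rho>" "w \<in> ball 0 1" for w
  proof -
    have w0: "w / l \<noteq> 0" using nonneg[OF w(1)] by auto
    have "Re (Ln (w / l)) = ln (cmod w)" using w0 l by (simp add: norm_divide)
    moreover have "ln (cmod w) < 0" using w0 w(2) by simp
    ultimately have im: "Im (- \<i> * Ln (w / l)) > 0" by simp
    have "e (- \<i> * Ln (w / l)) = w" using w0 l0 by (simp add: e_def)
    then show ?thesis using im Fb[OF w(2)] by (simp add: g_def \<psi>_def \<phi>_def)
  qed
  ultimately show ?thesis using \<rho>(1) by blast
qed

context schur
begin

text \<open>A Lipschitz bound for \<open>F\<close> near \<open>l\<close>, applied to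
  \<open>w\<close> and its radial projection to \<open>I\<close>, gives 1 - |b w| <= B (1 -
  |w|).\<close>

lemma kernel_bounded_if_continuation:
  assumes I: "open_arc I" "l \<in> I" and F: "analytic_continuation_across b I F" and F1: "\<And>\<zeta>. \<zeta> \<in> I \<Longrightarrow> cmod (F \<zeta>) = 1"
  shows "kernel_bounded_at l"
proof -
  have l: "cmod l = 1" by (rule open_arcD(1)[OF I])
  obtain U where U: "open U" "I \<subseteq> U" "F holomorphic_on ball 0 1 \<union> U" and Fb: "\<And>z. z \<in> ball 0 1 \<Longrightarrow> F z = b z"
    using F by (auto simp: analytic_continuation_across_def)
  have "l \<in> U" using U I by blast
  then obtain \<rho> where \<rho>: "\<rho> > 0" "cball l \<rho> \<subseteq> U" using U(1) open_contains_cball by blast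
  obtain \<epsilon> where \<epsilon>: "\<epsilon> > 0" "\<And>\<zeta>. cmod \<zeta> = 1 \<Longrightarrow> cmod (\<zeta> - l) < \<epsilon> \<Longrightarrow> \<zeta> \<in> I" using open_arc_near[OF I] by blast
  have FU: "F holomorphic_on U" using U(3) by (rule holomorphic_on_subset) auto
  have "deriv F holomorphic_on U" by (rule holomorphic_deriv[OF FU U(1)])
  then have "continuous_on (cball l \<rho>) (deriv F)"
    using \<rho>(2) holomorphic_on_imp_continuous_on continuous_on_subset by blast
  then have "compact (deriv F ` cball l \<rho>)" by (intro compact_continuous_image) auto
  then obtain B where B: "\<And>z. z \<in> cball l \<rho> \<Longrightarrow> cmod (deriv F z) \<le> B"
    using compact_imp_bounded bounded_iff by (metis (no_types, lifting) image_eqI)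
  have lip: "cmod (F x - F y) \<le> B * cmod (x - y)" if "x \<in> cball l \<rho>" "y \<in> cball l \<rho>" for x y
  proof (rule field_differentiable_bound[of "cball l \<rho>"])
    show "(F has_field_derivative deriv F z) (at z within cball l \<rho>)" if "z \<in> cball l \<rho>" for z
      using holomorphic_derivI[OF FU U(1), of z] that \<rho>(2) has_field_derivative_at_within by blast
  qed (use B that in auto)
  have B0: "B \<ge> 0" using order_trans[OF norm_ge_zero B[of l]] \<rho> by simp
  \<comment> \<open>The radial projection of \<open>w\<close> lies within 2 r of \<open>l\<close>,
    so the Lipschitz bound and membership in \<open>I\<close> both apply; r <= 1/2 keeps
    \<open>w\<close> away from 0.\<close>
  define r where "r = min (min \<rho> \<epsilon> / 2) (1/2)"
  have r: "r > 0" "2 * r \<le> \<rho>" "2 * r \<le> \<epsilon>" "r \<le> 1/2" using \<rho> \<epsilon> by (auto simp: r_def)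
  have "1 - (cmod (b w))\<^sup>2 \<le> (2 * B) * (1 - (cmod w)\<^sup>2)" if w: "cmod w < 1" "cmod (w - l) < r" for w
  proof -
    have wn: "cmod w \<ge> 1 - cmod (w - l)" using norm_triangle_ineq2[of l "l - w"] l by (simp add: norm_minus_commute)
    then have wpos: "cmod w > 0" using w r by linarith
    define w0 where "w0 = w / of_real (cmod w)"
    have w01: "cmod w0 = 1" using wpos by (simp add: w0_def norm_divide)
    have "w0 - w = w0 * of_real (1 - cmod w)" using wpos by (simp add: w0_def field_simps)
    then have d: "cmod (w0 - w) = 1 - cmod w" using w01 w(1) by (simp only: norm_mult norm_of_real) simp
    have "cmod (w0 - l) \<le> cmod (w0 - w) + cmod (w - l)" using norm_triangle_ineq[of "w0 - w" "w - l"] by simp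
    then have w0l: "cmod (w0 - l) < 2 * r" using d wn w by linarith
    have "w0 \<in> I" using w01 w0l r by (intro \<epsilon>(2)) auto
    then have "cmod (F w0) = 1" by (rule F1)
    moreover have "cmod (F w0 - F w) \<le> B * (1 - cmod w)"
      using lip[of w0 w] d w0l w r by (simp add: dist_norm norm_minus_commute)
    moreover have "F w = b w" using w by (intro Fb) simp
    ultimately have "1 - cmod (b w) \<le> B * (1 - cmod w)"
      using norm_triangle_ineq2[of "F w0" "F w"] by simp
    have bw: "cmod (b w) \<le> 1" by (rule le1[OF w(1)])
    have "1 - (cmod (b w))\<^sup>2 = (1 - cmod (b w)) * (1 + cmod (b w))" by (simp add: power2_eq_square algebra_simps)
    also have "\<dots> \<le> (1 - cmod (b w)) * 2" using bw by (intro mult_left_mono) auto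
    also have "\<dots> \<le> 2 * (B * (1 - cmod w))" using \<open>1 - cmod (b w) \<le> B * (1 - cmod w)\<close> by simp
    also have "\<dots> \<le> 2 * (B * (1 - (cmod w)\<^sup>2))"
      using B0 w by (intro mult_left_mono) (auto simp: power2_eq_square mult_left_le)
    finally show ?thesis by simp
  qed
  then show ?thesis unfolding kernel_bounded_at_def using r(1) by blast
qed

end

theorem theorem4p1:
  fixes b :: "complex \<Rightarrow> complex" and I :: "complex set"
  assumes "b holomorphic_on ball 0 1"
    and "\<forall>z\<in>ball 0 1. cmod (b z) \<le> 1"
    and "open_arc I"
  defines "stmt_i \<equiv> \<exists>F. analytic_continuation_across b I F \<and> (\<forall>\<zeta>\<in>I. cmod (F \<zeta>) = 1)"
    and "stmt_ii \<equiv> I \<subseteq> resolvent_set (Hb b) (Hb_inner b) (X_adj b)"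
    and "stmt_iii \<equiv> \<forall>f\<in>Hb b. \<exists>F. analytic_continuation_across f I F"
    and "stmt_iv \<equiv> \<forall>f\<in>Hb b. \<exists>F. continuous_extension_to f I F"
    and "stmt_v \<equiv> \<exists>F. continuous_extension_to b I F \<and> (\<forall>\<zeta>\<in>I. cmod (F \<zeta>) = 1)"
  shows "(stmt_i \<longleftrightarrow> stmt_ii) \<and> (stmt_ii \<longleftrightarrow> stmt_iii) \<and>
         (stmt_iii \<longleftrightarrow> stmt_iv) \<and> (stmt_iv \<longleftrightarrow> stmt_v)"
proof -
  interpret schur b using assms(1,2) by unfold_locales auto
  have I1: "cmod l = 1" if "l \<in> I" for l by (rule open_arcD(1)[OF assms(3) that])
  have I0: "I \<noteq> {}" using assms(3) by (auto simp: open_arc_def)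
  have "stmt_ii" if i: "stmt_i"
  proof -
    obtain F where F: "analytic_continuation_across b I F" "\<And>\<zeta>. \<zeta> \<in> I \<Longrightarrow> cmod (F \<zeta>) = 1"
      using i unfolding stmt_i_def by blast
    show ?thesis unfolding stmt_ii_def
      using resolvent_if_kernel_bounded[OF kernel_bounded_if_continuation[OF assms(3) _ F] I1] by blast
  qed
  moreover have "stmt_iii" if "stmt_ii"
    unfolding stmt_iii_def
  proof
    fix f assume f: "f \<in> Hb b"
    show "\<exists>F. analytic_continuation_across f I F"
    proof (rule glue_continuations[OF _ I1])
      show "f holomorphic_on ball 0 1" using H2_disc_hol[OF Hb_H2[OF f]] by (simp add: disc_hol_def)
      fix l assume l: "l \<in> I"
      show "\<exists>\<rho>>0. \<exists>g. g holomorphic_on ball l \<rho> \<and> (\<forall>z\<in>ball l \<rho> \<inter> ball 0 1. g z = f z)"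
        using local_continuation[OF I1[OF l] _ f] that l by (auto simp: stmt_ii_def)
    qed
  qed
  moreover have "stmt_iv" if iii: "stmt_iii"
    unfolding stmt_iv_def
  proof
    fix f assume "f \<in> Hb b"
    then obtain F U where "open U" "I \<subseteq> U" "F holomorphic_on ball 0 1 \<union> U" "\<forall>z\<in>ball 0 1. F z = f z"
      using iii unfolding stmt_iii_def by (auto simp: analytic_continuation_across_def)
    then have "continuous_extension_to f I F"
      unfolding continuous_extension_to_def
      using continuous_on_subset[OF holomorphic_on_imp_continuous_on, of F "ball 0 1 \<union> U" "ball 0 1 \<union> I"] by blast
    then show "\<exists>F. continuous_extension_to f I F" by blast
  qed
  moreover have "stmt_v" if "stmt_iv"
    unfolding stmt_v_def by (rule continuous_symbol[OF _ I0 I1]) (use that in \<open>auto simp: stmt_iv_def\<close>)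
  moreover have "stmt_i" if v: "stmt_v"
  proof -
    obtain F where F: "continuous_extension_to b I F" "\<And>\<zeta>. \<zeta> \<in> I \<Longrightarrow> cmod (F \<zeta>) = 1"
      using v unfolding stmt_v_def by blast
    obtain G where G: "analytic_continuation_across b I G"
      using glue_continuations[OF assms(1) I1 schwarz_reflection_local[OF assms(1,3) _ F]] by blast
    \<comment> \<open>The glued function is only known to extend \<open>b\<close>; on
      \<open>I\<close> it equals \<open>F\<close> because both are radial limits of
      \<open>b\<close>.\<close>
    have "cmod (G \<zeta>) = 1" if \<zeta>: "\<zeta> \<in> I" for \<zeta>
    proof -
      have s: "(\<lambda>n. of_real (rad n) * \<zeta>) \<longlonglongrightarrow> \<zeta>"
        using tendsto_mult[OF tendsto_of_real[OF rad_tendsto] tendsto_const[of \<zeta>]] by simp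
      have in': "of_real (rad n) * \<zeta> \<in> ball 0 1" for n using rad_mult_close(1)[OF I1[OF \<zeta>]] by simp
      obtain U where U: "I \<subseteq> U" "G holomorphic_on ball 0 1 \<union> U" "\<And>z. z \<in> ball 0 1 \<Longrightarrow> G z = b z"
        using G by (auto simp: analytic_continuation_across_def)
      have Gc: "(\<lambda>n. G (of_real (rad n) * \<zeta>)) \<longlonglongrightarrow> G \<zeta>"
        by (rule continuous_on_tendsto_compose[OF holomorphic_on_imp_continuous_on[OF U(2)] s]) (use U(1) \<zeta> in' in auto)
      have Fc: "(\<lambda>n. F (of_real (rad n) * \<zeta>)) \<longlonglongrightarrow> F \<zeta>"
        by (rule continuous_on_tendsto_compose[of "ball 0 1 \<union> I", OF _ s]) (use F(1) \<zeta> in' in \<open>auto simp: continuous_extension_to_def\<close>)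
      have "(\<lambda>n. G (of_real (rad n) * \<zeta>)) = (\<lambda>n. F (of_real (rad n) * \<zeta>))"
        using U(3)[OF in'] F(1) in' by (auto simp: continuous_extension_to_def)
      then have "G \<zeta> = F \<zeta>" using Gc Fc LIMSEQ_unique by metis
      then show ?thesis using F(2)[OF \<zeta>] by simp
    qed
    then show ?thesis unfolding stmt_i_def using G by blast
  qed
  ultimately show ?thesis by blast
qed

end
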